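(* Assume (A1)–(A6) and let the cone $K=K_1\times\dots\times K_{N_s}$ in the representation of $W$ be a product of nonnegative cones $\mathbb{R}_{\ge0}$, second-order cones $Q^{m_s}$ and positive semidefinite cones $\mathbb{S}^{q_s}_+$. Let $v\in\mathbb{R}[t,x]$ be a polynomial. Then the sum-of-squares programs obtained from the robust counterpart converge to the strict Lie constraint, in the following sense: $$\mathcal{L}_fv(t,x,w)<0\quad\forall(t,x,w)\in[0,T]\times X\times W$$ holds if and only if there exist a finite degree $d$, a number $\epsilon>0$ and polynomial multipliers $\zeta_s$ (vector- or matrix-valued according to $K_s$) such that, with $\mathbb{K}=[0,T]\times X$, (i) $-\mathcal{L}_{f_0}v-\sum_{s}\langle e_s,\zeta_s\rangle-\epsilon\in\Sigma^1[\mathbb{K}]_{\le2d}$; (ii) $G_s^T\zeta_s=0$ for all $s$, and $\sum_{s}(A_s^T\zeta_s)_\ell+f_\ell\cdot\nabla_xv=0$ for $\ell=1,\dots,L$, as polynomial identities in $(t,x)$; (iii) for each $s$: if $K_s=\mathbb{R}_{\ge0}$, $\zeta_s\in\Sigma^1[\mathbb{K}]_{\le2d}$; if $K_s=\mathbb{S}^{q_s}_+$, $\zeta_s\in\Sigma^{q_s}[\mathbb{K}]_{\le2d}$; if $K_s=Q^{m_s}$, then $\zeta_s=(\beta,\tau)$ and there are polynomials $\omega_1,\dots,\omega_{m_s}\in\mathbb{R}[t,x]$ with $\tau=\sum_j\omega_j$ and $\begin{bmatrix}\tau&\beta_j\\ \beta_j&\omega_j\end{bmatrix}\in\Sigma^2[\mathbb{K}]_{\le2d}$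 for $j=1,\dots,m_s$.
   Context: Setting and assumptions. (A1) $T>0$ is finite. (A2) $X\subset\mathbb{R}^n$ and $X_0\subset X$ are compact. (A3) $f(t,x,w)=f_0(t,x)+\sum_{\ell=1}^Lw_\ell f_\ell(t,x)$ with $f_0,\dots,f_L$ valued in $\mathbb{R}^n$ and Lipschitz on $[0,T]\times X$. (A4) $W=\{w\in\mathbb{R}^L:\forall s\ \exists\lambda_s\in\mathbb{R}^{q'_s}:\ A_sw+G_s\lambda_s+e_s\in K_s\}$ with $A_s,G_s$ constant linear maps and $e_s$ a constant; $W$ is compact with nonempty interior and, if $K$ is non-polyhedral, there is a Slater point $(\bar w,\bar\lambda)$ with $A_s\bar w+G_s\bar\lambda_s+e_s\in\mathrm{int}(K_s)$ for all $s$. (A5) Non-return: if a trajectory of $\dot x=f(t,x,w)$ started in $X_0$ with $W$-valued input $w(\cdot)$ is in $\partial X$ at some time $t\in[0,T]$, then for every $W$-valued input agreeing with $w(\cdot)$ on $[0,t]$ the corresponding trajectory is outside $X$ at all times in $(t,T]$. (A6) $f_0,\dots,f_L$ are polynomial and $[0,T]\times X$ is Archimedean (defined below). Cones: $Q^m=\{(u,\tau)\in\mathbb{R}^m\times\mathbb{R}_{\ge0}:\|u\|_2\le\tau\}$; $\mathbb{S}^q_+$ is the cone of positive semidefinite symmetric $q\times q$ matrices. All three kinds are self-dual; $\langle\cdot,\cdot\rangle$ is the Euclidean (for matrices, trace) inner product and $A_s^T,G_s^T$ are the corresponding adjoints. Lie derivatives: $\mathcal{L}_{f_0}v=\partial_tv+f_0\cdot\nabla_xv$;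 $\mathcal{L}_fv(t,x,w)=\mathcal{L}_{f_0}v(t,x)+\sum_\ell w_\ell f_\ell(t,x)\cdot\nabla_xv(t,x)$. Weighted SOS cones: let $\mathbb{K}=\{z=(t,x):G_i(z)\succeq0,\ i=1,\dots,N_c\}$ with symmetric polynomial matrices $G_i$ of size $n_i$. $\Sigma^q[\mathbb{K}]$ is the set of symmetric $q\times q$ polynomial matrices of the form $\sum_kC_{0k}^TC_{0k}+\sum_{i=1}^{N_c}\sum_kC_{ik}^TG_iC_{ik}$ (finite sums, $C_{0k}\in\mathbb{R}[z]^{1\times q}$, $C_{ik}\in\mathbb{R}[z]^{n_i\times q}$); $\Sigma^q[\mathbb{K}]_{\le2d}$ requires each summand to have degree at most $2d$. $\mathbb{K}$ is Archimedean if $R-\|z\|_2^2\in\Sigma^1[\mathbb{K}]$ for some $R>0$. *)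

theory Defs
  imports "HOL-Analysis.Analysis"
begin

text \<open>
  Polynomials in \<open>(t, x)\<close> are real polynomial functions on \<open>real \<times> real ^ 'n\<close>
  (\<open>real_polynomial_function\<close> from the library; over the reals, polynomials and polynomial functions
  are the same thing, so polynomial identities are identities of functions). Matrices and vectors
  whose size is not fixed by a type are functions \<open>nat \<Rightarrow> nat \<Rightarrow> _\<close>, indexed from 0.
\<close>

type_synonym 'n tx = "real \<times> (real ^ 'n)"
type_synonym 'n pol = "'n tx \<Rightarrow> real"
type_synonym 'n pmat = "nat \<Rightarrow> nat \<Rightarrow> 'n pol"
type_synonym rmat = "nat \<Rightarrow> nat \<Rightarrow> real"

definition exponents :: "nat \<Rightarrow> ('a::euclidean_space \<Rightarrow> nat) set" where
  "exponents k = {\<alpha>. (\<forall>b. b \<notin> Basis \<longrightarrow> \<alpha> b = 0) \<and> (\<Sum>b\<in>Basis. \<alpha> b) \<le> k}"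

definition monomial :: "('a::euclidean_space \<Rightarrow> nat) \<Rightarrow> 'a \<Rightarrow> real" where
  "monomial \<alpha> z = (\<Prod>b\<in>Basis. (z \<bullet> b) ^ \<alpha> b)"

definition degree_le :: "nat \<Rightarrow> ('a::euclidean_space \<Rightarrow> real) \<Rightarrow> bool" where
  "degree_le k p \<longleftrightarrow> (\<exists>c. p = (\<lambda>z. \<Sum>\<alpha>\<in>exponents k. c \<alpha> * monomial \<alpha> z))"

lemma finite_exponents: "finite (exponents k :: ('a::euclidean_space \<Rightarrow> nat) set)"
proof -
  have "finite {\<alpha>::'a \<Rightarrow> nat. (\<forall>b\<in>Basis. \<alpha> b \<in> {..k}) \<and> (\<forall>b. b \<notin> Basis \<longrightarrow> \<alpha> b = 0)}"
    using finite_set_of_finite_funs[of "Basis :: 'a set" "{..k}" 0] by (rule finite_subset[rotated]) auto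
  moreover have "\<alpha> b \<le> k" if "\<alpha> \<in> exponents k" "b \<in> Basis" for \<alpha> :: "'a \<Rightarrow> nat" and b
    using that member_le_sum[of b Basis \<alpha>] by (auto simp: exponents_def)
  ultimately show ?thesis
    by (elim finite_subset[rotated]) (auto simp: exponents_def)
qed

lemma degree_le_monomial:
  assumes "\<alpha> \<in> exponents k"
  shows "degree_le k (\<lambda>z. a * monomial \<alpha> z)"
  unfolding degree_le_def
proof (intro exI[of _ "\<lambda>\<beta>. if \<beta> = \<alpha> then a else 0"] ext)
  fix z
  have "(\<Sum>\<beta>\<in>exponents k. (if \<beta> = \<alpha> then a else 0) * monomial \<beta> z)
      = (\<Sum>\<beta>\<in>exponents k. if \<beta> = \<alpha> then a * monomial \<beta> z else 0)"
    by (rule sum.cong) auto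
  then show "a * monomial \<alpha> z = (\<Sum>\<beta>\<in>exponents k. (if \<beta> = \<alpha> then a else 0) * monomial \<beta> z)"
    using assms by (simp add: finite_exponents)
qed

lemma degree_le_add:
  assumes "degree_le k p" "degree_le k q"
  shows "degree_le k (\<lambda>z. p z + q z)"
proof -
  obtain c d where "p = (\<lambda>z. \<Sum>\<alpha>\<in>exponents k. c \<alpha> * monomial \<alpha> z)"
    "q = (\<lambda>z. \<Sum>\<alpha>\<in>exponents k. d \<alpha> * monomial \<alpha> z)"
    using assms unfolding degree_le_def by blast
  then show ?thesis unfolding degree_le_def
    by (intro exI[of _ "\<lambda>\<alpha>. c \<alpha> + d \<alpha>"]) (simp add: distrib_right sum.distrib)
qed

lemma degree_le_sum:
  assumes "finite S" "\<And>i. i \<in> S \<Longrightarrow> degree_le k (p i)"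
  shows "degree_le k (\<lambda>z. \<Sum>i\<in>S. p i z)"
  using assms
proof (induction S rule: finite_induct)
  case empty
  show ?case unfolding degree_le_def by (intro exI[of _ "\<lambda>_. 0"]) simp
next
  case (insert i S)
  then show ?case using degree_le_add[of k "p i" "\<lambda>z. \<Sum>i\<in>S. p i z"] by simp
qed

lemma degree_le_mono:
  assumes "degree_le k p" "k \<le> l"
  shows "degree_le l p"
proof -
  obtain c where p: "p = (\<lambda>z. \<Sum>\<alpha>\<in>exponents k. c \<alpha> * monomial \<alpha> z)"
    using assms(1) unfolding degree_le_def by blast
  show ?thesis unfolding p
    by (intro degree_le_sum finite_exponents degree_le_monomial)
      (use assms(2) in \<open>auto simp: exponents_def\<close>)
qed

lemma degree_le_mult:
  assumes "degree_le k p" "degree_le l q"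
  shows "degree_le (k + l) (\<lambda>z. p z * q z)"
proof -
  obtain c d where p: "p = (\<lambda>z. \<Sum>\<alpha>\<in>exponents k. c \<alpha> * monomial \<alpha> z)"
    and q: "q = (\<lambda>z. \<Sum>\<alpha>\<in>exponents l. d \<alpha> * monomial \<alpha> z)"
    using assms unfolding degree_le_def by blast
  have eq: "p z * q z = (\<Sum>\<alpha>\<in>exponents k. \<Sum>\<beta>\<in>exponents l.
      (c \<alpha> * d \<beta>) * monomial (\<lambda>b. \<alpha> b + \<beta> b) z)" for z
    by (simp add: p q sum_product monomial_def power_add prod.distrib mult_ac)
  show ?thesis unfolding eq
    by (intro degree_le_sum finite_exponents degree_le_monomial)
      (auto simp: exponents_def sum.distrib intro: add_mono)
qed

lemma real_polynomial_function_iff_degree_le: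
  "real_polynomial_function p \<longleftrightarrow> (\<exists>k. degree_le k p)"
proof
  assume "real_polynomial_function p"
  then show "\<exists>k. degree_le k p"
  proof (induction p rule: real_polynomial_function.induct)
    case (linear f)
    interpret bounded_linear f by fact
    have "f z = (\<Sum>b\<in>Basis. f b * monomial (\<lambda>b'. if b' = b then 1 else 0) z)" for z
    proof -
      have m: "monomial (\<lambda>b'. if b' = b then 1 else 0) z = z \<bullet> b" if "b \<in> Basis" for b
      proof -
        have "monomial (\<lambda>b'. if b' = b then 1 else 0) z = (\<Prod>b'\<in>Basis. if b' = b then z \<bullet> b' else 1)"
          unfolding monomial_def by (rule prod.cong) auto
        then show ?thesis using that by simp
      qed
      have "f z = f (\<Sum>b\<in>Basis. (z \<bullet> b) *\<^sub>R b)" by (simp add: euclidean_representation)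
      also have "\<dots> = (\<Sum>b\<in>Basis. f b * (z \<bullet> b))" by (simp add: sum scaleR mult.commute)
      finally show ?thesis by (simp add: m cong: sum.cong)
    qed
    then have "f = (\<lambda>z. \<Sum>b\<in>Basis. f b * monomial (\<lambda>b'. if b' = b then 1 else 0) z)" by blast
    moreover have "degree_le 1 (\<lambda>z. \<Sum>b\<in>Basis. f b * monomial (\<lambda>b'. if b' = b then 1 else 0) z)"
      by (intro degree_le_sum degree_le_monomial) (auto simp: exponents_def)
    ultimately show ?case by auto
  next
    case (const c)
    have "degree_le 0 (\<lambda>z::'a. c * monomial (\<lambda>_. 0) z)"
      by (intro degree_le_monomial) (simp add: exponents_def)
    then show ?case by (auto simp: monomial_def)
  next
    case (add f g)
    then obtain k l where "degree_le k f" "degree_le l g" by blast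
    then have "degree_le (max k l) (\<lambda>z. f z + g z)"
      by (intro degree_le_add) (auto elim: degree_le_mono)
    then show ?case by blast
  next
    case (mult f g)
    then show ?case using degree_le_mult by blast
  qed
next
  assume "\<exists>k. degree_le k p"
  then obtain k c where p: "p = (\<lambda>z. \<Sum>\<alpha>\<in>exponents k. c \<alpha> * monomial \<alpha> z)"
    unfolding degree_le_def by blast
  have b: "real_polynomial_function (\<lambda>z::'a. z \<bullet> b)" for b
    by (rule real_polynomial_function.intros(1)) (rule bounded_linear_inner_left)
  show "real_polynomial_function p" unfolding p monomial_def
    by (intro real_polynomial_function_sum finite_exponents real_polynomial_function.intros(4)
        real_polynomial_function.intros(2) real_polynomial_function_prod
        real_polynomial_function_power b) auto
qed

definition time_deriv :: "('n::finite) pol \<Rightarrow> 'n pol" where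
  "time_deriv v z = deriv (\<lambda>s. v (s, snd z)) (fst z)"

definition grad_x :: "('n::finite) pol \<Rightarrow> 'n tx \<Rightarrow> real ^ 'n" where
  "grad_x v z = (\<chi> i. deriv (\<lambda>h. v (fst z, snd z + h *\<^sub>R axis i 1)) 0)"

definition lie0 :: "(('n::finite) tx \<Rightarrow> real ^ 'n) \<Rightarrow> 'n pol \<Rightarrow> 'n pol" where
  "lie0 f0 v z = time_deriv v z + f0 z \<bullet> grad_x v z"

definition dynamics ::
  "(('n::finite) tx \<Rightarrow> real ^ 'n) \<Rightarrow> ('l::finite \<Rightarrow> 'n tx \<Rightarrow> real ^ 'n) \<Rightarrow>
   real \<Rightarrow> real ^ 'n \<Rightarrow> real ^ 'l \<Rightarrow> real ^ 'n" where
  "dynamics f0 f t x w = f0 (t, x) + (\<Sum>l\<in>UNIV. (w $ l) *\<^sub>R f l (t, x))"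

definition lie ::
  "(('n::finite) tx \<Rightarrow> real ^ 'n) \<Rightarrow> ('l::finite \<Rightarrow> 'n tx \<Rightarrow> real ^ 'n) \<Rightarrow> 'n pol \<Rightarrow>
   real \<Rightarrow> real ^ 'n \<Rightarrow> real ^ 'l \<Rightarrow> real" where
  "lie f0 f v t x w =
     lie0 f0 v (t, x) + (\<Sum>l\<in>UNIV. (w $ l) * (f l (t, x) \<bullet> grad_x v (t, x)))"

definition input_signal :: "real \<Rightarrow> (real ^ 'l::finite) set \<Rightarrow> (real \<Rightarrow> real ^ 'l) \<Rightarrow> bool" where
  "input_signal T W w \<longleftrightarrow>
     w \<in> borel_measurable (lebesgue_on {0..T}) \<and> (\<forall>t\<in>{0..T}. w t \<in> W)"

text \<open>Caratheodory solutions on \<open>{0..b}\<close>, in integral form.\<close>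

definition trajectory ::
  "(real \<Rightarrow> real ^ 'n \<Rightarrow> real ^ 'l \<Rightarrow> real ^ 'n) \<Rightarrow> (real \<Rightarrow> real ^ 'l) \<Rightarrow> real \<Rightarrow>
   (real \<Rightarrow> real ^ ('n::finite)) \<Rightarrow> bool" where
  "trajectory F w b x \<longleftrightarrow> continuous_on {0..b} x \<and>
     (\<forall>t\<in>{0..b}. ((\<lambda>s. F s (x s) (w s)) has_integral (x t - x 0)) {0..t})"

text \<open>A trajectory may cease to exist before time \<open>T\<close> once it has left \<open>X\<close>; it then has to
  be outside \<open>X\<close> for as long as it exists.\<close>

definition non_return ::
  "(real \<Rightarrow> real ^ 'n \<Rightarrow> real ^ 'l \<Rightarrow> real ^ 'n) \<Rightarrow> real \<Rightarrow> (real ^ ('n::finite)) set \<Rightarrow>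
   (real ^ 'n) set \<Rightarrow> (real ^ ('l::finite)) set \<Rightarrow> bool" where
  "non_return F T X X0 W \<longleftrightarrow>
     (\<forall>w x t. input_signal T W w \<and> t \<in> {0..T} \<and> trajectory F w t x \<and> x 0 \<in> X0 \<and> x t \<in> frontier X \<longrightarrow>
        (\<forall>w' b x'. input_signal T W w' \<and> (\<forall>r\<in>{0..t}. w' r = w r) \<and>
             b \<in> {t..T} \<and> trajectory F w' b x' \<and> x' 0 = x 0 \<longrightarrow>
           (\<forall>r\<in>{t<..b}. x' r \<notin> X)))"

text \<open>
  Each cone lives in a space of matrices: \<open>1 \<times> 1\<close> for the nonnegative reals,
  \<open>(m + 1) \<times> 1\<close> for the second-order cone with \<open>(u, \<tau>)\<close> stored as
  \<open>u j = y j 0\<close> for \<open>j < m\<close> and \<open>\<tau> = y m 0\<close>, and symmetric \<open>q \<times> q\<close> for the semidefinite cone.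
\<close>

datatype cone_kind = NonNeg | SOC nat | PSD nat

fun positive_size :: "cone_kind \<Rightarrow> bool" where
  "positive_size NonNeg = True"
| "positive_size (SOC m) = (0 < m)"
| "positive_size (PSD q) = (0 < q)"

fun cone_rows :: "cone_kind \<Rightarrow> nat" where
  "cone_rows NonNeg = 1"
| "cone_rows (SOC m) = m + 1"
| "cone_rows (PSD q) = q"

fun cone_cols :: "cone_kind \<Rightarrow> nat" where
  "cone_cols NonNeg = 1"
| "cone_cols (SOC m) = 1"
| "cone_cols (PSD q) = q"

definition cone_space :: "cone_kind \<Rightarrow> rmat set" where
  "cone_space k = {y. (\<forall>i j. \<not> (i < cone_rows k \<and> j < cone_cols k) \<longrightarrow> y i j = 0) \<and>
     (\<forall>q. k = PSD q \<longrightarrow> (\<forall>i j. y i j = y j i))}"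

definition cone_inner :: "cone_kind \<Rightarrow> rmat \<Rightarrow> rmat \<Rightarrow> real" where
  "cone_inner k y z = (\<Sum>i<cone_rows k. \<Sum>j<cone_cols k. y i j * z i j)"

definition psd :: "nat \<Rightarrow> rmat \<Rightarrow> bool" where
  "psd q M \<longleftrightarrow> (\<forall>i<q. \<forall>j<q. M i j = M j i) \<and>
     (\<forall>u::nat \<Rightarrow> real. 0 \<le> (\<Sum>i<q. \<Sum>j<q. u i * M i j * u j))"

fun cone_set :: "cone_kind \<Rightarrow> rmat set" where
  "cone_set NonNeg = {y \<in> cone_space NonNeg. 0 \<le> y 0 0}"
| "cone_set (SOC m) = {y \<in> cone_space (SOC m). 0 \<le> y m 0 \<and> L2_set (\<lambda>j. y j 0) {..<m} \<le> y m 0}"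
| "cone_set (PSD q) = {y \<in> cone_space (PSD q). psd q y}"

text \<open>Interior relative to the ambient space. On \<open>cone_space\<close>, where all but finitely many
  coordinates vanish, the product topology of \<open>rmat\<close> is the Euclidean one.\<close>

definition cone_interior :: "cone_kind \<Rightarrow> rmat set" where
  "cone_interior k = top_of_set (cone_space k) interior_of cone_set k"

text \<open>The product of the cones is a polyhedron: it is cut out of the product of the ambient spaces
  by finitely many affine inequalities.\<close>

definition polyhedral_product :: "('s::finite \<Rightarrow> cone_kind) \<Rightarrow> bool" where
  "polyhedral_product K \<longleftrightarrow>
     (\<exists>H :: (('s \<Rightarrow> rmat) \<times> real) set. finite H \<and>
        (\<forall>y. (\<forall>s. y s \<in> cone_space (K s)) \<longrightarrow>
           ((\<forall>s. y s \<in> cone_set (K s)) \<longleftrightarrow>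
            (\<forall>(a, b)\<in>H. (\<Sum>s\<in>UNIV. cone_inner (K s) (a s) (y s)) \<le> b))))"

text \<open>
  The linear maps \<open>A\<^sub>s\<close> and \<open>G\<^sub>s\<close> are given by the images \<open>A s l\<close> and \<open>G s k\<close> (\<open>k < q s\<close>) of the
  standard basis vectors, so that the components of the adjoints are
  \<open>(A\<^sub>s\<^sup>T \<zeta>)\<^sub>l = cone_inner (K s) (A s l) \<zeta>\<close> and \<open>(G\<^sub>s\<^sup>T \<zeta>)\<^sub>k = cone_inner (K s) (G s k) \<zeta>\<close>.
\<close>

definition conic_data ::
  "('s::finite \<Rightarrow> cone_kind) \<Rightarrow> ('s \<Rightarrow> nat) \<Rightarrow> ('s \<Rightarrow> 'l::finite \<Rightarrow> rmat) \<Rightarrow>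
   ('s \<Rightarrow> nat \<Rightarrow> rmat) \<Rightarrow> ('s \<Rightarrow> rmat) \<Rightarrow> bool" where
  "conic_data K q A G e \<longleftrightarrow>
     (\<forall>s. positive_size (K s) \<and> (\<forall>l. A s l \<in> cone_space (K s)) \<and>
          (\<forall>k<q s. G s k \<in> cone_space (K s)) \<and> e s \<in> cone_space (K s))"

definition affine_image ::
  "nat \<Rightarrow> ('l::finite \<Rightarrow> rmat) \<Rightarrow> (nat \<Rightarrow> rmat) \<Rightarrow> rmat \<Rightarrow> real ^ 'l \<Rightarrow> (nat \<Rightarrow> real) \<Rightarrow> rmat" where
  "affine_image q A G e w \<mu> =
     (\<lambda>i j. (\<Sum>l\<in>UNIV. w $ l * A l i j) + (\<Sum>k<q. \<mu> k * G k i j) + e i j)"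

definition conic_set ::
  "('s::finite \<Rightarrow> cone_kind) \<Rightarrow> ('s \<Rightarrow> nat) \<Rightarrow> ('s \<Rightarrow> 'l::finite \<Rightarrow> rmat) \<Rightarrow>
   ('s \<Rightarrow> nat \<Rightarrow> rmat) \<Rightarrow> ('s \<Rightarrow> rmat) \<Rightarrow> (real ^ 'l) set" where
  "conic_set K q A G e =
     {w. \<forall>s. \<exists>\<mu>. affine_image (q s) (A s) (G s) (e s) w \<mu> \<in> cone_set (K s)}"

definition slater ::
  "('s::finite \<Rightarrow> cone_kind) \<Rightarrow> ('s \<Rightarrow> nat) \<Rightarrow> ('s \<Rightarrow> 'l::finite \<Rightarrow> rmat) \<Rightarrow>
   ('s \<Rightarrow> nat \<Rightarrow> rmat) \<Rightarrow> ('s \<Rightarrow> rmat) \<Rightarrow> bool" where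
  "slater K q A G e \<longleftrightarrow>
     (\<exists>w \<mu>. \<forall>s. affine_image (q s) (A s) (G s) (e s) w (\<mu> s) \<in> cone_interior (K s))"

text \<open>
  The set \<open>\<K>\<close> is described by symmetric polynomial matrices \<open>g i\<close> of size \<open>N i\<close>, \<open>i :: 'c\<close>.
  Entries of a \<open>pmat\<close> outside the relevant size are ignored.
\<close>

definition symmetric_pmat :: "nat \<Rightarrow> ('n::finite) pmat \<Rightarrow> bool" where
  "symmetric_pmat q F \<longleftrightarrow>
     (\<forall>a<q. \<forall>b<q. real_polynomial_function (F a b) \<and> F a b = F b a)"

definition semialg_set :: "('c::finite \<Rightarrow> nat) \<Rightarrow> ('c \<Rightarrow> ('n::finite) pmat) \<Rightarrow> 'n tx set" where
  "semialg_set N g = {z. \<forall>i. psd (N i) (\<lambda>a b. g i a b z)}"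

text \<open>The possible summands \<open>C\<^sup>T C\<close> (with \<open>C\<close> a row) and \<open>C\<^sup>T (g i) C\<close> (with \<open>C\<close> of size
  \<open>N i \<times> q\<close>).\<close>

definition wsos_summands ::
  "('c::finite \<Rightarrow> nat) \<Rightarrow> ('c \<Rightarrow> ('n::finite) pmat) \<Rightarrow> nat \<Rightarrow> 'n pmat set" where
  "wsos_summands N g q =
     {(\<lambda>a b z. C a z * C b z) | C. \<forall>a<q. real_polynomial_function (C a)} \<union>
     {(\<lambda>a b z. \<Sum>p<N i. \<Sum>r<N i. C p a z * g i p r z * C r b z) | i C.
        \<forall>p<N i. \<forall>a<q. real_polynomial_function (C p a)}"

definition wsos ::
  "('c::finite \<Rightarrow> nat) \<Rightarrow> ('c \<Rightarrow> ('n::finite) pmat) \<Rightarrow> nat \<Rightarrow> 'n pmat set" where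
  "wsos N g q =
     {F. \<exists>Ss. set Ss \<subseteq> wsos_summands N g q \<and>
           (\<forall>a<q. \<forall>b<q. F a b = (\<lambda>z. \<Sum>S\<leftarrow>Ss. S a b z))}"

definition wsos_deg ::
  "('c::finite \<Rightarrow> nat) \<Rightarrow> ('c \<Rightarrow> ('n::finite) pmat) \<Rightarrow> nat \<Rightarrow> nat \<Rightarrow> 'n pmat set" where
  "wsos_deg N g q D =
     {F. \<exists>Ss. set Ss \<subseteq> wsos_summands N g q \<and>
           (\<forall>S\<in>set Ss. \<forall>a<q. \<forall>b<q. degree_le D (S a b)) \<and>
           (\<forall>a<q. \<forall>b<q. F a b = (\<lambda>z. \<Sum>S\<leftarrow>Ss. S a b z))}"

definition archimedean :: "('c::finite \<Rightarrow> nat) \<Rightarrow> ('c \<Rightarrow> ('n::finite) pmat) \<Rightarrow> bool" where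
  "archimedean N g \<longleftrightarrow> (\<exists>R>0. (\<lambda>_ _ z. R - (norm z)\<^sup>2) \<in> wsos N g 1)"

definition sym2 :: "('n::finite) pol \<Rightarrow> 'n pol \<Rightarrow> 'n pol \<Rightarrow> 'n pmat" where
  "sym2 p r s = (\<lambda>a b. if a = 0 \<and> b = 0 then p else if a = 1 \<and> b = 1 then s else r)"

definition multiplier :: "cone_kind \<Rightarrow> ('n::finite) pmat \<Rightarrow> bool" where
  "multiplier k \<zeta> \<longleftrightarrow>
     (\<forall>i j. real_polynomial_function (\<zeta> i j)) \<and> (\<forall>z. (\<lambda>i j. \<zeta> i j z) \<in> cone_space k)"

definition pairing :: "cone_kind \<Rightarrow> rmat \<Rightarrow> ('n::finite) pmat \<Rightarrow> 'n pol" where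
  "pairing k y \<zeta> z = cone_inner k y (\<lambda>i j. \<zeta> i j z)"

fun multiplier_sos ::
  "('c::finite \<Rightarrow> nat) \<Rightarrow> ('c \<Rightarrow> ('n::finite) pmat) \<Rightarrow> nat \<Rightarrow> cone_kind \<Rightarrow> 'n pmat \<Rightarrow> bool" where
  "multiplier_sos N g D NonNeg \<zeta> \<longleftrightarrow> \<zeta> \<in> wsos_deg N g 1 D"
| "multiplier_sos N g D (PSD q) \<zeta> \<longleftrightarrow> \<zeta> \<in> wsos_deg N g q D"
| "multiplier_sos N g D (SOC m) \<zeta> \<longleftrightarrow>
     (\<exists>\<omega> :: nat \<Rightarrow> 'n pol. (\<forall>j<m. real_polynomial_function (\<omega> j)) \<and>
        \<zeta> m 0 = (\<lambda>z. \<Sum>j<m. \<omega> j z) \<and>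
        (\<forall>j<m. sym2 (\<zeta> m 0) (\<zeta> j 0) (\<omega> j) \<in> wsos_deg N g 2 D))"

end

theory Submission
  imports Defs
begin

text \<open>
  Pointwise in \<open>(t, x)\<close>, conic duality turns negativity of an affine function of \<open>w\<close> on \<open>W\<close> into
  a multiplier in \<open>K \<inter> ker G\<^sup>T\<close>. Compactness of \<open>[0, T] \<times> X\<close> leaves finitely many constant
  multipliers \<open>h\<close>, which can be combined with polynomial coefficients that are positive on
  \<open>[0, T] \<times> X\<close> so that the equality constraints hold identically. A psd matrix is a sum of matrices
  \<open>u u\<^sup>T\<close>, so a scalar weighted sum of squares times a constant \<open>h\<close> is a matrix one; hence Putinar's
  theorem is needed only for scalar polynomials. It follows from the fact that a maximal proper
  archimedean quadratic module is the set of polynomials nonnegative at some point.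
\<close>

section \<open>Putinar's theorem for archimedean quadratic modules\<close>

text \<open>The equalities in (ii) must hold as identities, whereas Stone-Weierstrass gives
  coefficients only up to an error. So the combination is chosen to overshoot: on
  \<open>{0..T} \<times> X\<close> the left side of each equality is strictly negative. Its negative
  is a polynomial positive there, hence again a scalar certificate, and becomes the coefficient of a
  constant multiplier whose image under \<open>A\<^sup>T\<close> is a unit vector. Such multipliers
  exist because \<open>W\<close> is bounded: a lower bound for the coordinate \<open>w $ l\<close>
  on \<open>W\<close> is an affine inequality to which duality applies. Overshooting and correcting
  cost a little in the constant term; this is paid from the gap between zero and the maximum over
  \<open>W\<close>, which is attained. Duality has two proofs, since the cone to be separated need
  not be closed: a Slater point supplies the positive distance, and for polyhedral cones Farkas'
  lemma avoids the question. The converse direction is weak duality at each single point.\<close>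

lemmas polynomial_intros = real_polynomial_function.intros(2,3,4) real_polynomial_function_diff
  real_polynomial_function_minus real_polynomial_function_divide real_polynomial_function_power
  real_polynomial_function_sum real_polynomial_function_prod

lemma bounded_linear_coordinates:
  fixes f :: "'a::euclidean_space \<Rightarrow> real"
  assumes "bounded_linear f"
  shows "f = (\<lambda>z. \<Sum>b\<in>Basis. f b * (z \<bullet> b))"
proof
  fix z
  interpret bounded_linear f by fact
  have "f z = f (\<Sum>b\<in>Basis. (z \<bullet> b) *\<^sub>R b)" by (simp add: euclidean_representation)
  also have "\<dots> = (\<Sum>b\<in>Basis. f b * (z \<bullet> b))" by (simp add: sum scaleR mult.commute)
  finally show "f z = (\<Sum>b\<in>Basis. f b * (z \<bullet> b))" .
qed

text \<open>Adding one square at a time makes every closure property an induction with a single use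
  of \<open>add\<close> and \<open>square_mult\<close>, without index sets.\<close>

inductive_set sum_squares :: "('a::euclidean_space \<Rightarrow> real) set" where
  zero: "(\<lambda>_. 0) \<in> sum_squares"
| step: "real_polynomial_function h \<Longrightarrow> s \<in> sum_squares \<Longrightarrow> (\<lambda>z. (h z)\<^sup>2 + s z) \<in> sum_squares"

lemma sum_squares_poly: "s \<in> sum_squares \<Longrightarrow> real_polynomial_function s"
  by (induction rule: sum_squares.induct) auto

lemma sum_squares_square:
  assumes "real_polynomial_function h" shows "(\<lambda>z. (h z)\<^sup>2) \<in> sum_squares"
  using sum_squares.step[OF assms sum_squares.zero] by simp

lemma sum_squares_add:
  assumes "s \<in> sum_squares" "t \<in> sum_squares" shows "(\<lambda>z. s z + t z) \<in> sum_squares"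
  using assms(1)
proof (induction rule: sum_squares.induct)
  case (step h s)
  then show ?case using sum_squares.step[of h "\<lambda>z. s z + t z"] by (simp add: add.assoc)
qed (use assms(2) in simp)

lemma sum_squares_mult_square:
  assumes "s \<in> sum_squares" "real_polynomial_function h" shows "(\<lambda>z. (h z)\<^sup>2 * s z) \<in> sum_squares"
  using assms(1)
proof (induction rule: sum_squares.induct)
  case zero
  show ?case using sum_squares.zero by simp
next
  case (step k s)
  then show ?case
    using sum_squares.step[of "\<lambda>z. h z * k z" "\<lambda>z. (h z)\<^sup>2 * s z"] assms(2)
    by (simp add: distrib_left power_mult_distrib polynomial_intros)
qed

text \<open>Products of two members need not be members; only squares may multiply. For this reason
  products are later handled by polarization.\<close>

locale quadratic_module =
  fixes M :: "('a::euclidean_space \<Rightarrow> real) set"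
  assumes poly: "f \<in> M \<Longrightarrow> real_polynomial_function f"
    and one: "(\<lambda>_. 1) \<in> M"
    and add: "f \<in> M \<Longrightarrow> g \<in> M \<Longrightarrow> (\<lambda>z. f z + g z) \<in> M"
    and square_mult: "f \<in> M \<Longrightarrow> real_polynomial_function h \<Longrightarrow> (\<lambda>z. (h z)\<^sup>2 * f z) \<in> M"
begin

lemma cong: "f \<in> M \<Longrightarrow> (\<And>z. f z = g z) \<Longrightarrow> g \<in> M"
  by (metis ext)

lemma scale: "f \<in> M \<Longrightarrow> 0 \<le> c \<Longrightarrow> (\<lambda>z. c * f z) \<in> M"
  using square_mult[of f "\<lambda>_. sqrt c"] by (simp add: polynomial_intros)

lemma square: "real_polynomial_function h \<Longrightarrow> (\<lambda>z. (h z)\<^sup>2) \<in> M"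
  using square_mult[OF one] by simp

lemma const: "0 \<le> c \<Longrightarrow> (\<lambda>_. c) \<in> M"
  using scale[OF one] by simp

lemma sum_squares_mult: "s \<in> sum_squares \<Longrightarrow> f \<in> M \<Longrightarrow> (\<lambda>z. s z * f z) \<in> M"
proof (induction rule: sum_squares.induct)
  case zero
  then show ?case using const[of 0] by simp
next
  case (step h s)
  then show ?case using add[OF square_mult[of f h]] by (simp add: distrib_right)
qed

lemma sum_squares_subset: "s \<in> sum_squares \<Longrightarrow> s \<in> M"
  using sum_squares_mult[OF _ one] by simp

text \<open>Writing \<open>h\<close> as the difference of the squares of (h + 1)/2 and (h - 1)/2
  distributes the two signs of \<open>f\<close>. In other words, the support of \<open>M\<close> is
  an ideal.\<close>

lemma ideal_mult:
  assumes "f \<in> M" "(\<lambda>z. - f z) \<in> M" and h: "real_polynomial_function h"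
  shows "(\<lambda>z. h z * f z) \<in> M"
proof -
  have "real_polynomial_function (\<lambda>z. (h z + 1) / 2)" "real_polynomial_function (\<lambda>z. (h z - 1) / 2)"
    using h by (auto intro!: polynomial_intros)
  then have "(\<lambda>z. ((h z + 1) / 2)\<^sup>2 * f z + ((h z - 1) / 2)\<^sup>2 * - f z) \<in> M"
    using assms by (intro add square_mult)
  then show ?thesis
    by (rule cong) (simp add: power2_eq_square field_simps)
qed

lemma mono_const:
  assumes "(\<lambda>z. f z - c) \<in> M" "d \<le> c" shows "(\<lambda>z. f z - d) \<in> M"
  by (rule cong[OF add[OF assms(1) const[of "c - d"]]]) (use assms(2) in auto)

text \<open>For a polynomial \<open>a\<close> this is the smallest quadratic module containing
  \<open>M\<close> and \<open>a\<close>. The coefficients are sums of squares, as those are what may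
  multiply \<open>a\<close>.\<close>

definition adjoin :: "('a \<Rightarrow> real) \<Rightarrow> ('a \<Rightarrow> real) set" where
  "adjoin a = {\<lambda>z. m z + s z * a z | m s. m \<in> M \<and> s \<in> sum_squares}"

lemma adjoinI: "m \<in> M \<Longrightarrow> s \<in> sum_squares \<Longrightarrow> f = (\<lambda>z. m z + s z * a z) \<Longrightarrow> f \<in> adjoin a"
  unfolding adjoin_def by blast

lemma adjoin_quadratic_module:
  assumes a: "real_polynomial_function a" shows "quadratic_module (adjoin a)"
proof
  show "real_polynomial_function f" if mem: "f \<in> adjoin a" for f
  proof -
    obtain m s where f: "f = (\<lambda>z. m z + s z * a z)" "m \<in> M" "s \<in> sum_squares"
      using mem unfolding adjoin_def by blast
    show ?thesis unfolding f(1)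
      by (intro real_polynomial_function.intros(3,4) poly[OF f(2)] sum_squares_poly[OF f(3)] a)
  qed
  show "(\<lambda>_. 1) \<in> adjoin a"
    by (rule adjoinI[OF one sum_squares.zero]) simp
  show "(\<lambda>z. f z + g z) \<in> adjoin a" if fg: "f \<in> adjoin a" "g \<in> adjoin a" for f g
  proof -
    obtain m s where f: "f = (\<lambda>z. m z + s z * a z)" "m \<in> M" "s \<in> sum_squares"
      using fg unfolding adjoin_def by blast
    obtain n t where g: "g = (\<lambda>z. n z + t z * a z)" "n \<in> M" "t \<in> sum_squares"
      using fg unfolding adjoin_def by blast
    show ?thesis
      by (rule adjoinI[OF add[OF f(2) g(2)] sum_squares_add[OF f(3) g(3)]])
        (simp add: f(1) g(1) algebra_simps)
  qed
  show "(\<lambda>z. (h z)\<^sup>2 * f z) \<in> adjoin a" if fh: "f \<in> adjoin a" "real_polynomial_function h" for f h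
  proof -
    obtain m s where f: "f = (\<lambda>z. m z + s z * a z)" "m \<in> M" "s \<in> sum_squares"
      using fh unfolding adjoin_def by blast
    show ?thesis
      by (rule adjoinI[OF square_mult[OF f(2) fh(2)] sum_squares_mult_square[OF f(3) fh(2)]])
        (simp add: f(1) algebra_simps)
  qed
qed

lemma subset_adjoin: "M \<subseteq> adjoin a"
  using sum_squares.zero by (auto intro: adjoinI)

lemma in_adjoin: "a \<in> adjoin a"
proof (rule adjoinI)
  show "(\<lambda>_. 0) \<in> M" by (rule const) simp
  show "(\<lambda>z. 1\<^sup>2) \<in> sum_squares"
    by (rule sum_squares_square) (rule real_polynomial_function.intros)
qed simp

end

section \<open>Maximal proper quadratic modules and the Positivstellensatz\<close>

locale proper_quadratic_module = quadratic_module +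
  assumes proper: "(\<lambda>_. -1) \<notin> M"

locale maximal_quadratic_module = proper_quadratic_module +
  assumes maximal: "\<And>M'. proper_quadratic_module M' \<Longrightarrow> M \<subseteq> M' \<Longrightarrow> M' = M"
begin

lemma adjoin_improper:
  assumes c: "real_polynomial_function c" "c \<notin> M"
  shows "(\<lambda>_. -1) \<in> adjoin c"
proof (rule ccontr)
  assume "(\<lambda>_. -1) \<notin> adjoin c"
  with adjoin_quadratic_module[OF c(1)] have "proper_quadratic_module (adjoin c)"
    by (simp add: proper_quadratic_module_def proper_quadratic_module_axioms_def)
  then have "adjoin c = M" by (rule maximal) (rule subset_adjoin)
  then have "c \<in> M" using in_adjoin[of c] by (rule subst)
  then show False using c(2) by (rule notE[rotated])
qed

text \<open>Otherwise adjoining either sign yields -1 = s1 + t1 a = s2 - t2 a. Computing t1 t2 a in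
  both ways eliminates \<open>a\<close> and shows that -t1 is in \<open>M\<close>. As t1 is in
  \<open>M\<close> too, \<open>ideal_mult\<close> puts t1 a into \<open>M\<close>, and then s1 + t1
  a = -1 contradicts properness.\<close>

lemma total:
  assumes a: "real_polynomial_function a"
  shows "a \<in> M \<or> (\<lambda>z. - a z) \<in> M"
proof (rule ccontr)
  assume "\<not> ?thesis"
  then have not: "a \<notin> M" "(\<lambda>z. - a z) \<notin> M" by blast+
  have b: "real_polynomial_function (\<lambda>z. - a z)" using a by (rule real_polynomial_function_minus)
  obtain s1 t1 where 1: "(\<lambda>_. -1) = (\<lambda>z. s1 z + t1 z * a z)" "s1 \<in> M" "t1 \<in> sum_squares"
    using adjoin_improper[OF a not(1)] unfolding adjoin_def by blast
  obtain s2 t2 where 2: "(\<lambda>_. -1) = (\<lambda>z. s2 z + t2 z * - a z)" "s2 \<in> M" "t2 \<in> sum_squares"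
    using adjoin_improper[OF b not(2)] unfolding adjoin_def by blast
  have e1: "t1 z * a z = - 1 - s1 z" and e2: "t2 z * a z = 1 + s2 z" for z
    using fun_cong[OF 1(1), of z] fun_cong[OF 2(1), of z] by auto
  have eq: "t2 z + (t1 z * s2 z + t2 z * s1 z) = - t1 z" for z
  proof -
    have "t1 z * (1 + s2 z) = t2 z * (- 1 - s1 z)"
      unfolding e1[symmetric] e2[symmetric] by simp
    then show ?thesis by (simp add: algebra_simps)
  qed
  have "(\<lambda>z. t2 z + (t1 z * s2 z + t2 z * s1 z)) \<in> M"
    by (intro add sum_squares_mult 1 2 sum_squares_subset[OF 2(3)])
  then have "(\<lambda>z. - t1 z) \<in> M" by (rule cong) (rule eq)
  then have "(\<lambda>z. a z * t1 z) \<in> M"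
    using ideal_mult a sum_squares_subset[OF 1(3)] by blast
  then have "(\<lambda>z. s1 z + a z * t1 z) \<in> M" using 1(2) add by blast
  then have "(\<lambda>_. -1) \<in> M"
  proof (rule cong)
    show "s1 z + a z * t1 z = -1" for z using e1[of z] by (simp add: mult.commute)
  qed
  then show False using proper by blast
qed

end

text \<open>The polynomials bounded with respect to \<open>M\<close> form a ring: sums are
  immediate, squares need an identity, products follow by polarization. It contains the constants
  and, by the hypothesis on \<open>R\<close>, the coordinates, hence everything.\<close>

lemma (in quadratic_module) bounded_polynomials:
  assumes R: "(\<lambda>z. R - (norm z)\<^sup>2) \<in> M"
    and p: "real_polynomial_function p"
  shows "\<exists>c\<ge>0. (\<lambda>z. c - p z) \<in> M \<and> (\<lambda>z. c + p z) \<in> M"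
proof -
  define B where "B p \<longleftrightarrow> real_polynomial_function p \<and> (\<exists>c>0. (\<lambda>z. c - p z) \<in> M \<and> (\<lambda>z. c + p z) \<in> M)"
    for p
  have BI: "B f" if "real_polynomial_function f" "c > 0" "(\<lambda>z. c - f z) \<in> M" "(\<lambda>z. c + f z) \<in> M" for f c
    unfolding B_def using that by blast
  have constB: "B (\<lambda>_. a)" for a
    by (rule BI[of _ "\<bar>a\<bar> + 1"]) (rule real_polynomial_function.intros, simp, (rule const, simp)+)
  have addB: "B (\<lambda>z. f z + g z)" if f: "B f" and g: "B g" for f g
  proof -
    obtain c d where c: "c > 0" "(\<lambda>z. c - f z) \<in> M" "(\<lambda>z. c + f z) \<in> M"
      and d: "d > 0" "(\<lambda>z. d - g z) \<in> M" "(\<lambda>z. d + g z) \<in> M"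
      and fg: "real_polynomial_function f" "real_polynomial_function g"
      using f g unfolding B_def by blast
    show ?thesis
    proof (rule BI[of _ "c + d"])
      show "(\<lambda>z. (c + d) - (f z + g z)) \<in> M" by (rule cong[OF add[OF c(2) d(2)]]) simp
      show "(\<lambda>z. (c + d) + (f z + g z)) \<in> M" by (rule cong[OF add[OF c(3) d(3)]]) simp
    qed (use c(1) d(1) in \<open>auto intro: real_polynomial_function.intros(3) fg\<close>)
  qed
  have minusB: "B (\<lambda>z. - f z)" if f: "B f" for f
  proof -
    obtain c where c: "c > 0" "(\<lambda>z. c - f z) \<in> M" "(\<lambda>z. c + f z) \<in> M"
      and pf: "real_polynomial_function f"
      using f unfolding B_def by blast
    show ?thesis
      by (rule BI[OF real_polynomial_function_minus[OF pf] c(1)]) (use c in simp_all)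
  qed
  have sqB: "B (\<lambda>z. (f z)\<^sup>2)" if f: "B f" for f
  proof -
    obtain c where c: "c > 0" "(\<lambda>z. c - f z) \<in> M" "(\<lambda>z. c + f z) \<in> M"
      and pf: "real_polynomial_function f"
      using f unfolding B_def by blast
    \<comment> \<open>The two products add up to 2c times the difference of the squares of c and
      f.\<close>
    have 1: "(\<lambda>z. (c - f z)\<^sup>2 * (c + f z)) \<in> M" "(\<lambda>z. (c + f z)\<^sup>2 * (c - f z)) \<in> M"
      by (intro square_mult[OF c(3)] square_mult[OF c(2)] polynomial_intros pf)+
    show ?thesis
    proof (rule BI[OF real_polynomial_function_power[OF pf]])
      have "0 \<le> 1 / (2 * c)" using c(1) by simp
      from scale[OF add[OF 1] this] show "(\<lambda>z. c\<^sup>2 - (f z)\<^sup>2) \<in> M"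
        by (rule cong) (use c(1) in \<open>simp add: field_simps power2_eq_square\<close>)
      show "(\<lambda>z. c\<^sup>2 + (f z)\<^sup>2) \<in> M" by (rule add[OF const square[OF pf]]) simp
    qed (use c(1) in simp)
  qed
  have scaleB: "B (\<lambda>z. a * f z)" if f: "B f" and a: "a > 0" for a f
  proof -
    obtain c where c: "c > 0" "(\<lambda>z. c - f z) \<in> M" "(\<lambda>z. c + f z) \<in> M"
      and pf: "real_polynomial_function f"
      using f unfolding B_def by blast
    show ?thesis
    proof (rule BI[of _ "a * c"])
      show "(\<lambda>z. a * c - a * f z) \<in> M"
        by (rule cong[OF scale[OF c(2), of a]]) (use a in \<open>simp_all add: algebra_simps\<close>)
      show "(\<lambda>z. a * c + a * f z) \<in> M"
        by (rule cong[OF scale[OF c(3), of a]]) (use a in \<open>simp_all add: algebra_simps\<close>)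
    qed (use a c(1) in \<open>auto intro: real_polynomial_function.intros(2,4) pf\<close>)
  qed
  have multB: "B (\<lambda>z. f z * g z)" if f: "B f" and g: "B g" for f g
  proof -
    have "B (\<lambda>z. 1/4 * ((f z + g z)\<^sup>2 + - ((f z + - g z)\<^sup>2)))"
      by (intro scaleB addB minusB sqB f g) auto
    moreover have "(\<lambda>z. 1/4 * ((f z + g z)\<^sup>2 + - ((f z + - g z)\<^sup>2))) = (\<lambda>z. f z * g z)"
      by (simp add: power2_eq_square algebra_simps)
    ultimately show ?thesis by simp
  qed
  have coord: "B (\<lambda>z. z \<bullet> b)" if b: "b \<in> Basis" for b
  proof -
    have lin: "real_polynomial_function (\<lambda>z. z \<bullet> b')" for b' :: 'a
      by (rule real_polynomial_function.intros(1)) (rule bounded_linear_inner_left)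
    have sums: "(\<lambda>z. \<Sum>b'\<in>S. (z \<bullet> b')\<^sup>2) \<in> M" if "finite S" for S
      using that
    proof (induction S rule: finite_induct)
      case empty
      show ?case using const[of 0] by simp
    next
      case (insert b' S)
      then show ?case using add[OF square[OF lin] insert.IH] by simp
    qed
    have "(\<lambda>z. (R - (norm z)\<^sup>2) + (\<Sum>b'\<in>Basis - {b}. (z \<bullet> b')\<^sup>2)) \<in> M"
      by (intro add R sums) auto
    moreover have "(norm z)\<^sup>2 = (z \<bullet> b)\<^sup>2 + (\<Sum>b'\<in>Basis - {b}. (z \<bullet> b')\<^sup>2)" for z
    proof -
      have "(norm z)\<^sup>2 = (\<Sum>b'\<in>Basis. (z \<bullet> b')\<^sup>2)"
        unfolding power2_norm_eq_inner by (subst euclidean_inner) (simp add: power2_eq_square)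
      then show ?thesis using b by (simp add: sum.remove)
    qed
    ultimately have Rb: "(\<lambda>z. R - (z \<bullet> b)\<^sup>2) \<in> M"
      by (simp add: algebra_simps)
    \<comment> \<open>For a = 1 and a = -1 the quadratic terms cancel and |R|/2 + 1 - a (z \<bullet>
      b) remains. The last constant is nonnegative for either sign of \<open>R\<close>.\<close>
    have half: "(\<lambda>z. 1/2 * (R - (z \<bullet> b)\<^sup>2) + (1/2 * (z \<bullet> b - a)\<^sup>2 + (1/2 * \<bar>R\<bar> - 1/2 * R + 1/2))) \<in> M" for a
      by (rule add[OF scale[OF Rb] add[OF scale[OF square] const]])
        (auto intro!: real_polynomial_function_diff[OF lin] real_polynomial_function.intros(2))
    show ?thesis
    proof (rule BI[OF lin])
      show "(\<lambda>z. (1/2 * \<bar>R\<bar> + 1) - z \<bullet> b) \<in> M"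
        by (rule cong[OF half[of 1]]) (simp add: power2_eq_square algebra_simps)
      show "(\<lambda>z. (1/2 * \<bar>R\<bar> + 1) + z \<bullet> b) \<in> M"
        by (rule cong[OF half[of "-1"]]) (simp add: power2_eq_square algebra_simps)
    qed simp
  qed
  have sumB: "B (\<lambda>z. \<Sum>b\<in>S. F b z)" if "finite S" "\<And>b. b \<in> S \<Longrightarrow> B (F b)" for S :: "'a set" and F
    using that
  proof (induction S rule: finite_induct)
    case empty
    show ?case using constB[of 0] by simp
  next
    case (insert b S)
    then show ?case using addB[of "F b" "\<lambda>z. \<Sum>b\<in>S. F b z"] by simp
  qed
  from p have "B p"
  proof (induction p rule: real_polynomial_function.induct)
    case (linear f)
    interpret bounded_linear f by fact
    have "f = (\<lambda>z. \<Sum>b\<in>Basis. f b * (z \<bullet> b))" by (rule bounded_linear_coordinates) fact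
    moreover have "B (\<lambda>z. \<Sum>b\<in>Basis. f b * (z \<bullet> b))"
      by (intro sumB multB constB coord) auto
    ultimately show ?case by simp
  qed (auto intro: constB addB multB)
  then show ?thesis unfolding B_def by (meson less_imp_le)
qed

text \<open>A maximal archimedean module is the set of polynomials that are nonnegative at a single point:
  the value of \<open>f\<close> there is the cut it defines in the constants.\<close>

lemma (in maximal_quadratic_module) evaluation:
  assumes R: "(\<lambda>z. R - (norm z)\<^sup>2) \<in> M"
  shows "\<exists>z. \<forall>m\<in>M. 0 \<le> m z"
proof -
  have neg: "(\<lambda>_. c) \<notin> M" if "c < 0" for c
  proof
    assume "(\<lambda>_. c) \<in> M"
    then have "(\<lambda>_. (1 / \<bar>c\<bar>) * c) \<in> M" by (intro scale) auto
    then show False using proper that by simp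
  qed
  \<comment> \<open>The slack \<open>\<epsilon>\<close> is needed because the supremum of a cut need
    not belong to the cut.\<close>
  define val where "val f a \<longleftrightarrow> real_polynomial_function f \<and>
      (\<forall>\<epsilon>>0. (\<lambda>z. f z - a + \<epsilon>) \<in> M \<and> (\<lambda>z. a - f z + \<epsilon>) \<in> M)" for f a
  have ex: "\<exists>a. val f a" if f: "real_polynomial_function f" for f
  proof -
    define S where "S = {r. (\<lambda>z. f z - r) \<in> M}"
    obtain c where c: "(\<lambda>z. c - f z) \<in> M" "(\<lambda>z. c + f z) \<in> M"
      using bounded_polynomials[OF R f] by blast
    have "- c \<in> S" using c(2) unfolding S_def by (simp add: add.commute)
    have ub: "r \<le> c" if "r \<in> S" for r
    proof (rule ccontr)
      assume "\<not> r \<le> c"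
      moreover have "(\<lambda>z. (c - f z) + (f z - r)) \<in> M"
        using that c(1) unfolding S_def by (intro add) auto
      ultimately show False using neg[of "c - r"] by simp
    qed
    then have bdd: "bdd_above S" by (rule bdd_aboveI)
    have "(\<lambda>z. f z - Sup S + \<epsilon>) \<in> M" if "\<epsilon> > 0" for \<epsilon>
    proof -
      obtain r where "r \<in> S" "Sup S - \<epsilon> < r"
        using less_cSup_iff[OF _ bdd, of "Sup S - \<epsilon>"] \<open>- c \<in> S\<close> \<open>\<epsilon> > 0\<close> by auto
      then show ?thesis
        using mono_const[of f r "Sup S - \<epsilon>"] unfolding S_def by (simp add: algebra_simps)
    qed
    moreover have "(\<lambda>z. Sup S - f z + \<epsilon>) \<in> M" if "\<epsilon> > 0" for \<epsilon>
    proof -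
      \<comment> \<open>Above the supremum f - r is no longer in \<open>M\<close>, so
        \<open>total\<close> yields its negative.\<close>
      have "Sup S + \<epsilon> \<notin> S" using cSup_upper[OF _ bdd, of "Sup S + \<epsilon>"] that by force
      moreover have "real_polynomial_function (\<lambda>z. f z - (Sup S + \<epsilon>))"
        using f by (intro polynomial_intros)
      ultimately have "(\<lambda>z. - (f z - (Sup S + \<epsilon>))) \<in> M"
        using total unfolding S_def by blast
      then show ?thesis by (simp add: algebra_simps)
    qed
    ultimately show ?thesis unfolding val_def using f by blast
  qed
  have val_const: "val (\<lambda>_. a) a" for a
    unfolding val_def using const by (auto intro: polynomial_intros)
  have val_add: "val (\<lambda>z. f z + g z) (a + b)" if f: "val f a" and g: "val g b" for f g a b
    unfolding val_def
  proof (intro conjI allI impI)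
    show "real_polynomial_function (\<lambda>z. f z + g z)"
      using f g unfolding val_def by (auto intro: polynomial_intros)
    fix \<epsilon> :: real assume "\<epsilon> > 0"
    then have *: "(\<lambda>z. f z - a + \<epsilon>/2) \<in> M" "(\<lambda>z. a - f z + \<epsilon>/2) \<in> M"
      "(\<lambda>z. g z - b + \<epsilon>/2) \<in> M" "(\<lambda>z. b - g z + \<epsilon>/2) \<in> M"
      using f g unfolding val_def by auto
    show "(\<lambda>z. f z + g z - (a + b) + \<epsilon>) \<in> M"
      by (rule cong[OF add[OF *(1,3)]]) (simp add: field_simps)
    show "(\<lambda>z. a + b - (f z + g z) + \<epsilon>) \<in> M"
      by (rule cong[OF add[OF *(2,4)]]) (simp add: field_simps)
  qed
  have val_minus: "val (\<lambda>z. - f z) (- a)" if "val f a" for f a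
    using that unfolding val_def by (auto simp: real_polynomial_function_minus add.commute)
  have val_scale: "val (\<lambda>z. c * f z) (c * a)" if f: "val f a" and c: "c > 0" for f a c
    unfolding val_def
  proof (intro conjI allI impI)
    show "real_polynomial_function (\<lambda>z. c * f z)"
      using f unfolding val_def by (auto intro: polynomial_intros)
    fix \<epsilon> :: real assume "\<epsilon> > 0"
    then have *: "(\<lambda>z. f z - a + \<epsilon>/c) \<in> M" "(\<lambda>z. a - f z + \<epsilon>/c) \<in> M"
      using f c unfolding val_def by auto
    have "c \<ge> 0" using c by simp
    show "(\<lambda>z. c * f z - c * a + \<epsilon>) \<in> M"
      by (rule cong[OF scale[OF *(1) \<open>c \<ge> 0\<close>]]) (use c in \<open>simp add: field_simps\<close>)
    show "(\<lambda>z. c * a - c * f z + \<epsilon>) \<in> M"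
      by (rule cong[OF scale[OF *(2) \<open>c \<ge> 0\<close>]]) (use c in \<open>simp add: field_simps\<close>)
  qed
  have val_scale': "val (\<lambda>z. c * f z) (c * a)" if f: "val f a" for f a c
  proof -
    consider "c > 0" | "c = 0" | "- c > 0" by linarith
    then show ?thesis
    proof cases
      case 3
      show ?thesis using val_minus[OF val_scale[OF f 3]] by simp
    qed (use val_scale[OF f] val_const[of 0] in auto)
  qed
  \<comment> \<open>The identity for bounded squares again, now with the bound
    \<open>\<delta>\<close> = sqrt \<epsilon>. Value 0 comes first because a general value reduces
    to it by expanding the square of f - a.\<close>
  have val_sq0: "val (\<lambda>z. (f z)\<^sup>2) 0" if f: "val f 0" for f
    unfolding val_def
  proof (intro conjI allI impI)
    have pf: "real_polynomial_function f" using f unfolding val_def by blast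
    then show "real_polynomial_function (\<lambda>z. (f z)\<^sup>2)" by auto
    fix \<epsilon> :: real assume "\<epsilon> > 0"
    define \<delta> where "\<delta> = sqrt \<epsilon>"
    have \<delta>: "\<delta> > 0" "\<epsilon> = \<delta>\<^sup>2" using \<open>\<epsilon> > 0\<close> by (auto simp: \<delta>_def)
    show "(\<lambda>z. (f z)\<^sup>2 - 0 + \<epsilon>) \<in> M"
      using add[OF square[OF pf] const[of \<epsilon>]] \<open>\<epsilon> > 0\<close> by simp
    have *: "(\<lambda>z. f z + \<delta>) \<in> M" "(\<lambda>z. \<delta> - f z) \<in> M"
      using f \<delta>(1) unfolding val_def by (auto simp: add.commute)
    have "(\<lambda>z. 1 / (2 * \<delta>) * ((\<delta> - f z)\<^sup>2 * (f z + \<delta>) + (f z + \<delta>)\<^sup>2 * (\<delta> - f z))) \<in> M"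
      by (intro scale add[OF square_mult[OF *(1)] square_mult[OF *(2)]] polynomial_intros pf)
        (use \<delta> in simp)
    then show "(\<lambda>z. 0 - (f z)\<^sup>2 + \<epsilon>) \<in> M"
      by (rule cong) (use \<delta> in \<open>simp add: field_simps power2_eq_square\<close>)
  qed
  have val_sq: "val (\<lambda>z. (f z)\<^sup>2) (a\<^sup>2)" if f: "val f a" for f a
  proof -
    have "val (\<lambda>z. f z + - a) 0" using val_add[OF f val_const[of "-a"]] by simp
    from val_add[OF val_add[OF val_sq0[OF this] val_scale'[OF f, of "2 * a"]] val_const[of "- a\<^sup>2"]]
    show ?thesis by (simp add: power2_eq_square algebra_simps)
  qed
  have val_mult: "val (\<lambda>z. f z * g z) (a * b)" if f: "val f a" and g: "val g b" for f g a b
    using val_scale'[OF val_add[OF val_sq[OF val_add[OF f g]]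
        val_minus[OF val_sq[OF val_add[OF f val_minus[OF g]]]]], of "1/4"]
    by (simp add: power2_eq_square algebra_simps)
  have lin: "real_polynomial_function (\<lambda>z. z \<bullet> b)" for b :: 'a
    by (rule real_polynomial_function.intros(1)) (rule bounded_linear_inner_left)
  then have "\<forall>b. \<exists>a. val (\<lambda>z. z \<bullet> b) a"
    using ex by blast
  from choice[OF this] obtain \<alpha> where \<alpha>: "\<And>b. val (\<lambda>z. z \<bullet> b) (\<alpha> b)"
    by blast
  \<comment> \<open>The point is assembled from the values of the coordinates. As \<open>val\<close>
    respects sums and products, every polynomial then has its value at this point.\<close>
  define z where "z = (\<Sum>b\<in>Basis. \<alpha> b *\<^sub>R b)"
  have val_sum: "val (\<lambda>z. \<Sum>b\<in>S. F b z) (\<Sum>b\<in>S. c b)"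
    if "finite S" "\<And>b. b \<in> S \<Longrightarrow> val (F b) (c b)" for S :: "'a set" and F c
    using that
  proof (induction S rule: finite_induct)
    case empty
    show ?case using val_const[of 0] by simp
  next
    case (insert b S)
    then show ?case using val_add[of "F b" "c b" "\<lambda>z. \<Sum>b\<in>S. F b z"] by simp
  qed
  have "val p (p z)" if "real_polynomial_function p" for p
    using that
  proof (induction p rule: real_polynomial_function.induct)
    case (linear f)
    interpret bounded_linear f by fact
    have "f = (\<lambda>z. \<Sum>b\<in>Basis. f b * (z \<bullet> b))" by (rule bounded_linear_coordinates) fact
    moreover have "f z = (\<Sum>b\<in>Basis. f b * \<alpha> b)"
      by (simp add: z_def sum scaleR mult.commute)
    moreover have "val (\<lambda>z. \<Sum>b\<in>Basis. f b * (z \<bullet> b)) (\<Sum>b\<in>Basis. f b * \<alpha> b)"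
      by (intro val_sum val_mult val_const \<alpha>) auto
    ultimately show ?case by simp
  qed (auto intro: val_const val_add val_mult)
  then have v: "val m (m z)" if "m \<in> M" for m using poly that by blast
  have "0 \<le> m z" if "m \<in> M" for m
  proof (rule ccontr)
    assume "\<not> 0 \<le> m z"
    then have "- m z / 2 > 0" by simp
    \<comment> \<open>With - m z / 2 in the role of \<open>\<epsilon>\<close>, adding
      \<open>m\<close> leaves the negative constant m z / 2.\<close>
    then have "(\<lambda>y. m z - m y + - m z / 2) \<in> M" using v[OF that] unfolding val_def by blast
    from add[OF this that] show False using neg[of "m z / 2"] \<open>\<not> 0 \<le> m z\<close> by simp
  qed
  then show ?thesis by blast
qed

text \<open>Properness excludes one fixed element, so it passes to unions of chains and Zorn's lemma
  applies.\<close>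

lemma (in proper_quadratic_module) extend_to_maximal:
  "\<exists>M'. maximal_quadratic_module M' \<and> M \<subseteq> M'"
proof -
  define A where "A = {M'. proper_quadratic_module M' \<and> M \<subseteq> M'}"
  have "\<exists>Q\<in>A. \<forall>X\<in>A. Q \<subseteq> X \<longrightarrow> X = Q"
  proof (rule subset_Zorn_nonempty)
    show "A \<noteq> {}" using proper_quadratic_module_axioms unfolding A_def by blast
    fix C assume C: "C \<noteq> {}" "subset.chain A C"
    then have CA: "proper_quadratic_module Y \<and> M \<subseteq> Y" if "Y \<in> C" for Y
      using that unfolding A_def subset.chain_def by blast
    then have qm: "quadratic_module Y" if "Y \<in> C" for Y
      using that proper_quadratic_module_def by blast
    have "proper_quadratic_module (\<Union>C)"
    proof
      show "real_polynomial_function f" if "f \<in> \<Union>C" for f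
        using that qm quadratic_module.poly by blast
      show "(\<lambda>_. 1) \<in> \<Union>C" using C(1) qm quadratic_module.one by blast
      show "(\<lambda>z. f z + g z) \<in> \<Union>C" if fg: "f \<in> \<Union>C" "g \<in> \<Union>C" for f g
      proof -
        obtain Y Y' where Y: "f \<in> Y" "Y \<in> C" "g \<in> Y'" "Y' \<in> C" using fg by blast
        then have "Y \<subseteq> Y' \<or> Y' \<subseteq> Y" using C(2) unfolding subset.chain_def by blast
        then show ?thesis using Y qm quadratic_module.add by blast
      qed
      show "(\<lambda>z. (h z)\<^sup>2 * f z) \<in> \<Union>C" if "f \<in> \<Union>C" "real_polynomial_function h" for f h
        using that qm quadratic_module.square_mult by blast
      show "(\<lambda>_. - 1) \<notin> \<Union>C"
        using CA proper_quadratic_module.proper by blast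
    qed
    then show "\<Union>C \<in> A" using C(1) CA unfolding A_def by blast
  qed
  then obtain Q where "Q \<in> A" "\<And>X. X \<in> A \<Longrightarrow> Q \<subseteq> X \<Longrightarrow> X = Q" by blast
  then have "maximal_quadratic_module Q" "M \<subseteq> Q"
    unfolding A_def maximal_quadratic_module_def maximal_quadratic_module_axioms_def by auto
  then show ?thesis by blast
qed

text \<open>If adjoining -p were proper, a maximal extension would provide a point where
  \<open>M\<close> is nonnegative and p \<le> 0. Hence -1 = m - g p with a sum of squares
  \<open>g\<close>, so g p - 1 is in \<open>M\<close>. The factor \<open>g\<close> is then removed
  by descent: p + c3 is in \<open>M\<close> for some constant, and this constant can be lowered in
  steps of fixed size.\<close>

theorem (in quadratic_module) putinar:
  assumes R: "(\<lambda>z. R - (norm z)\<^sup>2) \<in> M"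
    and p: "real_polynomial_function p"
    and pos: "\<And>z. \<forall>m\<in>M. 0 \<le> m z \<Longrightarrow> 0 < p z"
  shows "p \<in> M"
proof -
  let ?p = "\<lambda>z. - p z"
  have pm: "real_polynomial_function ?p" using p by auto
  have "(\<lambda>_. -1) \<in> adjoin ?p"
  proof (rule ccontr)
    assume "\<not> ?thesis"
    then interpret P: proper_quadratic_module "adjoin ?p"
      using adjoin_quadratic_module[OF pm]
      by (simp add: proper_quadratic_module_def proper_quadratic_module_axioms_def)
    obtain Q where Q: "maximal_quadratic_module Q" "adjoin ?p \<subseteq> Q"
      using P.extend_to_maximal by blast
    then obtain z where z: "\<And>m. m \<in> Q \<Longrightarrow> 0 \<le> m z"
      using maximal_quadratic_module.evaluation[OF Q(1), of R] R subset_adjoin by blast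
    then have "0 \<le> ?p z" "\<forall>m\<in>M. 0 \<le> m z" using in_adjoin subset_adjoin Q(2) by blast+
    then show False using pos[of z] by simp
  qed
  then obtain m g where mg: "(\<lambda>_. -1) = (\<lambda>z. m z + g z * ?p z)" "m \<in> M" "g \<in> sum_squares"
    unfolding adjoin_def by blast
  have "m z = g z * p z - 1" for z using fun_cong[OF mg(1), of z] by simp
  then have gp: "(\<lambda>z. g z * p z - 1) \<in> M" by (rule cong[OF mg(2)])
  have g: "real_polynomial_function g" using mg(3) sum_squares_poly by blast
  have "real_polynomial_function (\<lambda>z. (g z)\<^sup>2 * p z)"
    using g p by (intro polynomial_intros) auto
  then obtain c1 where c1: "c1 \<ge> 0" "(\<lambda>z. c1 - (g z)\<^sup>2 * p z) \<in> M"
    using bounded_polynomials[OF R] by blast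
  obtain c2 where c2: "(\<lambda>z. c2 - g z) \<in> M"
    using bounded_polynomials[OF R g] by blast
  obtain c3 where c3: "c3 \<ge> 0" "(\<lambda>z. c3 + p z) \<in> M"
    using bounded_polynomials[OF R p] by blast
  \<comment> \<open>This size makes both constants 2k - c1 - 1 and 2k - c2 in the descent identity
    nonnegative.\<close>
  define k where "k = max (c1 + 1) c2"
  have k: "k \<ge> 1" "c1 + 1 \<le> k" "c2 \<le> k" using c1(1) by (auto simp: k_def)
  have down: "(\<lambda>z. p z + (r - 1 / k\<^sup>2)) \<in> M" if r: "r \<ge> 0" "(\<lambda>z. p z + r) \<in> M" for r
  proof -
    \<comment> \<open>The mixed terms cancel: the bracket equals k^2 (p + r) - 1. The summand with
      factor \<open>r\<close> compensates for 2k g - g^2 lost from the square of k - g; it uses r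
      \<ge> 0.\<close>
    have "(\<lambda>z. 1 / k\<^sup>2 * ((k - g z)\<^sup>2 * (p z + r) + (2 * k * (g z * p z - 1)
        + ((c1 - (g z)\<^sup>2 * p z) + ((2 * k - c1 - 1) + r * (g z * ((c2 - g z) + (2 * k - c2)))))))) \<in> M"
      by (intro scale gp c1 c2 const r mg square_mult[OF r(2)] add[of "\<lambda>z. (k - g z)\<^sup>2 * (p z + r)"]
          add[of "\<lambda>z. 2 * k * (g z * p z - 1)"] add[of "\<lambda>z. c1 - (g z)\<^sup>2 * p z"]
          add[of "\<lambda>z. 2 * k - c1 - 1"] sum_squares_mult[OF mg(3)] add[OF c2] polynomial_intros g)
        (use k c1(1) in auto)
    then show ?thesis
      by (rule cong) (use k in \<open>simp add: field_simps power2_eq_square\<close>)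
  qed
  \<comment> \<open>The maximum with 0 respects the condition r \<ge> 0 of \<open>down\<close>; a
    step that would go below 0 is topped up by a nonnegative constant.\<close>
  have iter: "(\<lambda>z. p z + max 0 (c3 - n / k\<^sup>2)) \<in> M" for n :: nat
  proof (induction n)
    case 0
    then show ?case using c3 by (simp add: add.commute)
  next
    case (Suc n)
    have "0 \<le> 1 / k\<^sup>2" by simp
    then have eq: "max 0 (c3 - n / k\<^sup>2) - 1 / k\<^sup>2 \<le> max 0 (c3 - Suc n / k\<^sup>2)"
      unfolding of_nat_Suc add_divide_distrib by linarith
    show ?case
      by (rule cong[OF add[OF down[OF _ Suc] const[of "max 0 (c3 - Suc n / k\<^sup>2) - (max 0 (c3 - n / k\<^sup>2) - 1 / k\<^sup>2)"]]])
        (use eq in auto)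
  qed
  obtain n :: nat where n: "c3 * k\<^sup>2 < n" using reals_Archimedean2 by blast
  then have "c3 - n / k\<^sup>2 \<le> 0" using k by (simp add: field_simps)
  then show ?thesis using iter[of n] by simp
qed

section \<open>Positive polynomial coefficients and derivatives\<close>

lemma compact_positive_lower_bound:
  fixes f :: "'a::topological_space \<Rightarrow> real"
  assumes "compact Z" "continuous_on Z f" "\<And>z. z \<in> Z \<Longrightarrow> 0 < f z"
  shows "\<exists>m>0. \<forall>z\<in>Z. m \<le> f z"
proof (cases "Z = {}")
  case True
  then show ?thesis by (auto intro: exI[of _ 1])
next
  case False
  then show ?thesis using continuous_attains_inf[OF assms(1) _ assms(2)] assms(3) by blast
qed

text \<open>Strict feasibility of a fixed \<open>h\<close> is an open condition on \<open>z\<close>,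
  so finitely many \<open>h\<close> cover \<open>Z\<close>. Averaging over a continuous partition of
  unity keeps the inequalities strict, since the weights sum to 1 and each \<open>h\<close> has
  weight only where it is feasible. By compactness a uniform margin remains, which pays for
  replacing the weights by polynomials.\<close>

lemma polynomial_selection:
  fixes Z :: "'a::euclidean_space set" and u :: "'j \<Rightarrow> 'a \<Rightarrow> real" and v :: "'j \<Rightarrow> 'h \<Rightarrow> real"
  assumes Z: "compact Z" and J: "finite J"
    and u: "\<And>j. j \<in> J \<Longrightarrow> continuous_on Z (u j)"
    and feasible: "\<And>z. z \<in> Z \<Longrightarrow> \<exists>h\<in>H. \<forall>j\<in>J. 0 < u j z + v j h"
  shows "\<exists>F p. finite F \<and> F \<subseteq> H \<and> (\<forall>h\<in>F. real_polynomial_function (p h) \<and> (\<forall>z\<in>Z. 0 < p h z)) \<and>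
    (\<forall>z\<in>Z. \<forall>j\<in>J. 0 < u j z + (\<Sum>h\<in>F. p h z * v j h))"
proof -
  \<comment> \<open>One continuous function that is positive exactly where all the inequalities hold
    for \<open>h\<close>.\<close>
  define \<psi> where "\<psi> h z = (\<Prod>j\<in>J. max 0 (u j z + v j h))" for h z
  have \<psi>_cont: "continuous_on Z (\<psi> h)" for h
    unfolding \<psi>_def[abs_def] using u by (intro continuous_intros) auto
  have \<psi>_nonneg: "0 \<le> \<psi> h z" for h z
    unfolding \<psi>_def by (intro prod_nonneg) auto
  have \<psi>_pos: "0 < \<psi> h z \<longleftrightarrow> (\<forall>j\<in>J. 0 < u j z + v j h)" for h z
  proof
    assume "0 < \<psi> h z"
    then have "\<forall>j\<in>J. max 0 (u j z + v j h) \<noteq> 0"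
      using J unfolding \<psi>_def by (metis less_irrefl prod_zero)
    then show "\<forall>j\<in>J. 0 < u j z + v j h" by (auto simp: max_def split: if_splits)
  qed (auto simp: \<psi>_def intro!: prod_pos)
  define U where "U h = Z \<inter> \<psi> h -` {0<..}" for h
  have "openin (top_of_set Z) (U h)" for h
    unfolding U_def by (rule continuous_openin_preimage_gen[OF \<psi>_cont]) simp
  then have "\<forall>V\<in>U ` H. openin (top_of_set Z) V" by blast
  moreover have "Z \<subseteq> \<Union>(U ` H)"
  proof
    fix z assume z: "z \<in> Z"
    then obtain h where "h \<in> H" "0 < \<psi> h z" using feasible \<psi>_pos by blast
    then show "z \<in> \<Union>(U ` H)" using z by (auto simp: U_def)
  qed
  ultimately obtain D where D: "D \<subseteq> U ` H" "finite D" "Z \<subseteq> \<Union>D"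
    using Z unfolding compact_eq_openin_cover by meson
  then obtain F where F: "finite F" "F \<subseteq> H" "D = U ` F"
    using finite_subset_image by metis
  have cover: "\<exists>h\<in>F. 0 < \<psi> h z" if "z \<in> Z" for z
    using D(3) F(3) that by (auto simp: U_def)
  define \<Psi> where "\<Psi> z = (\<Sum>h\<in>F. \<psi> h z)" for z
  have \<Psi>: "0 < \<Psi> z" if z: "z \<in> Z" for z
  proof -
    obtain h where h: "h \<in> F" "0 < \<psi> h z" using cover[OF z] by blast
    then have "\<psi> h z \<le> \<Psi> z" unfolding \<Psi>_def using F(1) \<psi>_nonneg by (intro member_le_sum) auto
    then show ?thesis using h(2) by simp
  qed
  define \<phi> where "\<phi> h z = \<psi> h z / \<Psi> z" for h z
  have \<phi>_cont: "continuous_on Z (\<phi> h)" for h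
    unfolding \<phi>_def \<Psi>_def using \<psi>_cont \<Psi> unfolding \<Psi>_def
    by (intro continuous_intros) (auto simp: less_le)
  define E where "E j z = u j z + (\<Sum>h\<in>F. \<phi> h z * v j h)" for j z
  have E_pos: "0 < E j z" if "j \<in> J" "z \<in> Z" for j z
  proof -
    have "(\<Sum>h\<in>F. \<phi> h z) = 1"
      using \<Psi>[OF that(2)] unfolding \<phi>_def by (simp add: sum_divide_distrib[symmetric] \<Psi>_def)
    then have "E j z = (\<Sum>h\<in>F. \<phi> h z) * u j z + (\<Sum>h\<in>F. \<phi> h z * v j h)" by (simp add: E_def)
    also have "\<dots> = (\<Sum>h\<in>F. \<phi> h z * (u j z + v j h))"
      by (simp add: distrib_left sum.distrib sum_distrib_right)
    finally have eq: "E j z = (\<Sum>h\<in>F. \<phi> h z * (u j z + v j h))" .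
    have part: "0 \<le> \<phi> h z * (u j z + v j h)" "0 < \<psi> h z \<Longrightarrow> 0 < \<phi> h z * (u j z + v j h)" for h
    proof -
      show *: "0 < \<phi> h z * (u j z + v j h)" if "0 < \<psi> h z"
        using that \<psi>_pos \<open>j \<in> J\<close> \<Psi>[OF \<open>z \<in> Z\<close>] unfolding \<phi>_def by simp
      show "0 \<le> \<phi> h z * (u j z + v j h)"
        using * \<psi>_nonneg[of h z] by (cases "\<psi> h z = 0") (auto simp: \<phi>_def)
    qed
    obtain h where h: "h \<in> F" "0 < \<psi> h z" using cover[OF \<open>z \<in> Z\<close>] by blast
    show ?thesis unfolding eq using F(1) h part by (intro sum_pos2[of F h]) auto
  qed
  have "\<exists>m>0. \<forall>z\<in>Z. m \<le> E j z" if "j \<in> J" for j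
    using Z E_pos[OF that] u[OF that] \<phi>_cont unfolding E_def
    by (intro compact_positive_lower_bound continuous_intros) auto
  then obtain m where m: "\<And>j. j \<in> J \<Longrightarrow> 0 < m j" "\<And>j z. j \<in> J \<Longrightarrow> z \<in> Z \<Longrightarrow> m j \<le> E j z"
    by metis
  define r where "r = Min (insert 1 (m ` J))"
  have r: "0 < r" "\<And>j z. j \<in> J \<Longrightarrow> z \<in> Z \<Longrightarrow> r \<le> E j z"
  proof -
    show "0 < r" unfolding r_def using J m(1) by (subst Min_gr_iff) auto
    fix j z assume "j \<in> J" "z \<in> Z"
    then have "r \<le> m j" unfolding r_def using J by (intro Min_le) auto
    then show "r \<le> E j z" using m(2)[OF \<open>j \<in> J\<close> \<open>z \<in> Z\<close>] by simp
  qed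
  define B where "B = 1 + (\<Sum>j\<in>J. \<Sum>h\<in>F. \<bar>v j h\<bar>)"
  have B: "1 \<le> B" unfolding B_def by (simp add: sum_nonneg)
  have B_ge: "(\<Sum>h\<in>F. \<bar>v j h\<bar>) \<le> B" if "j \<in> J" for j
    using member_le_sum[OF that, of "\<lambda>j. \<Sum>h\<in>F. \<bar>v j h\<bar>"] J by (simp add: B_def sum_nonneg)
  \<comment> \<open>Raising the weights by \<open>\<eta>\<close> before approximating them to within
    \<open>\<eta>\<close> makes them positive and moves each by at most \<open>2 * \<eta>\<close>.
    The sums then change by at most \<open>2 * \<eta> * B\<close>, half of the margin
    \<open>r\<close>.\<close>
  define \<eta> where "\<eta> = r / (4 * B)"
  have \<eta>: "0 < \<eta>" "2 * \<eta> * B = r / 2" using r(1) B by (auto simp: \<eta>_def)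
  have "\<exists>g. real_polynomial_function g \<and> (\<forall>z\<in>Z. \<bar>(\<phi> h z + \<eta>) - g z\<bar> < \<eta>)" for h
  proof -
    have "continuous_on Z (\<lambda>z. \<phi> h z + \<eta>)" by (intro continuous_intros \<phi>_cont)
    from Stone_Weierstrass_real_polynomial_function[OF Z this \<eta>(1)] show ?thesis by metis
  qed
  then have "\<forall>h. \<exists>g. real_polynomial_function g \<and> (\<forall>z\<in>Z. \<bar>(\<phi> h z + \<eta>) - g z\<bar> < \<eta>)" by blast
  from choice[OF this] obtain p where p: "\<And>h. real_polynomial_function (p h)"
    "\<And>h z. z \<in> Z \<Longrightarrow> \<bar>(\<phi> h z + \<eta>) - p h z\<bar> < \<eta>"
    by blast
  have pos: "0 < p h z" if "z \<in> Z" for h z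
  proof -
    have "0 \<le> \<phi> h z" unfolding \<phi>_def using \<psi>_nonneg \<Psi>[OF that] by simp
    then show ?thesis using p(2)[OF that, of h] by linarith
  qed
  have rest: "0 < u j z + (\<Sum>h\<in>F. p h z * v j h)" if "z \<in> Z" "j \<in> J" for z j
  proof -
    have "\<bar>(\<Sum>h\<in>F. p h z * v j h) - (\<Sum>h\<in>F. \<phi> h z * v j h)\<bar> \<le> (\<Sum>h\<in>F. \<bar>p h z - \<phi> h z\<bar> * \<bar>v j h\<bar>)"
      unfolding sum_subtractf[symmetric] left_diff_distrib[symmetric] abs_mult[symmetric]
      by (rule sum_abs)
    also have "\<dots> \<le> (\<Sum>h\<in>F. (2 * \<eta>) * \<bar>v j h\<bar>)"
    proof (intro sum_mono mult_right_mono)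
      show "\<bar>p h z - \<phi> h z\<bar> \<le> 2 * \<eta>" for h using p(2)[OF that(1), of h] by linarith
    qed simp
    also have "\<dots> \<le> 2 * \<eta> * B"
      unfolding sum_distrib_left[symmetric] using B_ge[OF that(2)] \<eta>(1) by (intro mult_left_mono) auto
    finally show ?thesis using r(2)[OF that(2,1)] r(1) \<eta>(2) unfolding E_def by linarith
  qed
  show ?thesis
    by (intro exI[of _ F] exI[of _ p] conjI ballI F(1,2) p(1) pos rest)
qed

text \<open>Directions in the product space let one induction serve both the time derivative and the
  spatial gradient. The claim carries \<open>has_real_derivative\<close> rather than
  \<open>deriv\<close> because the sum and product rules need differentiability.\<close>

lemma directional_derivative_polynomial:
  assumes "real_polynomial_function v"
  shows "\<exists>v'. real_polynomial_function v' \<and> (\<forall>z. ((\<lambda>h. v (z + h *\<^sub>R d)) has_real_derivative v' z) (at 0))"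
  using assms
proof (induction v rule: real_polynomial_function.induct)
  case (linear f)
  interpret bounded_linear f by fact
  have "((\<lambda>h. f (z + h *\<^sub>R d)) has_real_derivative f d) (at 0)" for z
    unfolding add scaleR by (auto intro!: derivative_eq_intros)
  then show ?case by (intro exI[of _ "\<lambda>_. f d"]) (auto intro: real_polynomial_function.intros)
next
  case (const c)
  show ?case by (intro exI[of _ "\<lambda>_. 0"]) (auto intro: real_polynomial_function.intros)
next
  case (add f g)
  then obtain f' g' where *: "real_polynomial_function f'" "real_polynomial_function g'"
    "\<And>z. ((\<lambda>h. f (z + h *\<^sub>R d)) has_real_derivative f' z) (at 0)"
    "\<And>z. ((\<lambda>h. g (z + h *\<^sub>R d)) has_real_derivative g' z) (at 0)"
    by blast
  have "\<forall>z. ((\<lambda>h. f (z + h *\<^sub>R d) + g (z + h *\<^sub>R d)) has_real_derivative f' z + g' z) (at 0)"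
    using DERIV_add[OF *(3,4)] by blast
  then show ?case using real_polynomial_function.intros(3)[OF *(1,2)] by blast
next
  case (mult f g)
  then obtain f' g' where *: "real_polynomial_function f'" "real_polynomial_function g'"
    "\<And>z. ((\<lambda>h. f (z + h *\<^sub>R d)) has_real_derivative f' z) (at 0)"
    "\<And>z. ((\<lambda>h. g (z + h *\<^sub>R d)) has_real_derivative g' z) (at 0)"
    by blast
  have "\<forall>z. ((\<lambda>h. f (z + h *\<^sub>R d) * g (z + h *\<^sub>R d)) has_real_derivative f' z * g z + g' z * f z) (at 0)"
    using DERIV_mult[OF *(3,4)] by simp
  moreover have "real_polynomial_function (\<lambda>z. f' z * g z + g' z * f z)"
    by (intro real_polynomial_function.intros(3,4) *(1,2) mult.hyps)
  ultimately show ?case by blast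
qed

lemma real_polynomial_function_grad_x:
  assumes "real_polynomial_function v"
  shows "real_polynomial_function (\<lambda>z. grad_x v z $ i)"
proof -
  obtain v' where v': "real_polynomial_function v'"
    "\<And>z. ((\<lambda>h. v (z + h *\<^sub>R (0, axis i 1))) has_real_derivative v' z) (at 0)"
    using directional_derivative_polynomial[OF assms] by blast
  have "grad_x v z $ i = v' z" for z
    using DERIV_imp_deriv[OF v'(2)[of z]] by (simp add: grad_x_def plus_prod_def)
  then show ?thesis using v'(1) by simp
qed

lemma real_polynomial_function_time_deriv:
  assumes "real_polynomial_function v"
  shows "real_polynomial_function (time_deriv v)"
proof -
  obtain v' where v': "real_polynomial_function v'"
    "\<And>z. ((\<lambda>h. v (z + h *\<^sub>R (1, 0))) has_real_derivative v' z) (at 0)"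
    using directional_derivative_polynomial[OF assms] by blast
  have "time_deriv v z = v' z" for z
  proof -
    have "((\<lambda>s. v (s, snd z)) has_real_derivative v' z) (at (0 + fst z))"
      unfolding DERIV_shift using v'(2)[of z] by (simp add: plus_prod_def add.commute)
    then show ?thesis unfolding time_deriv_def using DERIV_imp_deriv by fastforce
  qed
  then have "time_deriv v = v'" by (rule ext)
  then show ?thesis using v'(1) by simp
qed

lemma real_polynomial_function_inner_grad_x:
  assumes "real_polynomial_function v" "polynomial_function f"
  shows "real_polynomial_function (\<lambda>z. f z \<bullet> grad_x v z)"
proof -
  have "real_polynomial_function (\<lambda>z. f z $ i)" for i
    using assms(2) bounded_linear_vec_nth unfolding polynomial_function_def comp_def by blast
  then show ?thesis
    unfolding inner_vec_def inner_real_def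
    by (intro polynomial_intros real_polynomial_function_grad_x[OF assms(1)]) auto
qed

lemma real_polynomial_function_lie0:
  assumes "real_polynomial_function v" "polynomial_function f0"
  shows "real_polynomial_function (lie0 f0 v)"
  unfolding lie0_def[abs_def]
  by (intro real_polynomial_function.intros(3) real_polynomial_function_time_deriv
      real_polynomial_function_inner_grad_x assms)

section \<open>Self-dual cones\<close>

text \<open>Isolates the last variable, in which the form is a quadratic polynomial; completing the
  square in it is the elimination step below.\<close>

lemma psd_bordered_form:
  assumes "\<And>i. i < n \<Longrightarrow> M n i = M i n"
  shows "(\<Sum>i<Suc n. \<Sum>j<Suc n. u i * M i j * u j)
    = (\<Sum>i<n. \<Sum>j<n. u i * M i j * u j) + 2 * u n * (\<Sum>i<n. u i * M i n) + (u n)\<^sup>2 * (M n n :: real)"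
proof -
  have "(\<Sum>j<n. u n * M n j * u j) = u n * (\<Sum>i<n. u i * M i n)"
    unfolding sum_distrib_left by (rule sum.cong) (auto simp: assms)
  moreover have "(\<Sum>i<n. u i * M i n * u n) = u n * (\<Sum>i<n. u i * M i n)"
    unfolding sum_distrib_left by (rule sum.cong) auto
  ultimately show ?thesis by (simp add: sum.distrib power2_eq_square)
qed

text \<open>One step of a Cholesky factorisation; a vanishing pivot needs no separate case because
  then the whole column vanishes and division by zero gives zero.\<close>

lemma psd_outer_products:
  assumes "psd n M"
  shows "\<exists>us. \<forall>a<n. \<forall>b<n. M a b = (\<Sum>u\<leftarrow>us. u a * u b)"
  using assms
proof (induction n arbitrary: M)
  case 0
  then show ?case by simp
next
  case (Suc n)
  define m where "m = M n n"
  \<comment> \<open>The Schur complement of the pivot.\<close>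
  define M' where "M' i j = M i j - M i n * M j n / m" for i j
  have sym: "M i j = M j i" if "i \<le> n" "j \<le> n" for i j
    using Suc.prems that unfolding psd_def by auto
  have form: "0 \<le> (\<Sum>i<n. \<Sum>j<n. u i * M i j * u j) + 2 * t * (\<Sum>i<n. u i * M i n) + t\<^sup>2 * m" for u t
  proof -
    let ?u = "u(n := t)"
    have "0 \<le> (\<Sum>i<Suc n. \<Sum>j<Suc n. ?u i * M i j * ?u j)"
      using Suc.prems unfolding psd_def by blast
    also have "\<dots> = (\<Sum>i<n. \<Sum>j<n. ?u i * M i j * ?u j) + 2 * ?u n * (\<Sum>i<n. ?u i * M i n) + (?u n)\<^sup>2 * M n n"
      by (rule psd_bordered_form) (use sym in auto)
    finally show ?thesis by (simp add: m_def)
  qed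
  have m: "0 \<le> m" using form[of "\<lambda>_. 0" 1] by simp
  \<comment> \<open>With a vanishing pivot the form is affine in the last variable, with slope 2 M i
    n at the \<open>i\<close>-th unit vector; being bounded below forces the slope to be 0.\<close>
  have zero: "M i n = 0" if "i < n" "m = 0" for i
  proof (rule ccontr)
    assume ne: "M i n \<noteq> 0"
    have "(\<Sum>k<n. \<Sum>j<n. (if k = i then 1 else 0) * M k j * (if j = i then 1 else 0)) = M i i"
    proof -
      have "(\<Sum>k<n. \<Sum>j<n. (if k = i then 1 else 0) * M k j * (if j = i then 1 else 0))
          = (\<Sum>k<n. if k = i then M k i else 0)"
        by (rule sum.cong) (use that in \<open>auto simp: if_distrib[of "\<lambda>x. _ * x"] cong: if_cong\<close>)
      then show ?thesis using that by simp
    qed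
    moreover have "(\<Sum>k<n. (if k = i then 1 else 0) * M k n) = M i n"
      using that by (simp add: if_distrib[of "\<lambda>x. x * _"] cong: if_cong)
    ultimately have "0 \<le> M i i + 2 * t * M i n" for t
      using form[of "\<lambda>k. if k = i then 1 else 0" t] that by simp
    from this[of "- (M i i + 1) / (2 * M i n)"] ne show False by (simp add: field_simps)
  qed
  have "psd n M'"
    unfolding psd_def
  proof (intro conjI allI impI)
    show "M' i j = M' j i" if "i < n" "j < n" for i j
      using that sym unfolding M'_def by simp
    fix u :: "nat \<Rightarrow> real"
    define s where "s = (\<Sum>i<n. u i * M i n)"
    have "(\<Sum>i<n. \<Sum>j<n. u i * (M i n * M j n / m) * u j) = (\<Sum>i<n. \<Sum>j<n. (u i * M i n) * (u j * M j n)) / m"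
      by (simp add: sum_divide_distrib mult_ac)
    also have "\<dots> = s\<^sup>2 / m"
      by (simp add: s_def power2_eq_square sum_product)
    finally have "(\<Sum>i<n. \<Sum>j<n. u i * M' i j * u j) = (\<Sum>i<n. \<Sum>j<n. u i * M i j * u j) - s\<^sup>2 / m"
      by (simp add: M'_def algebra_simps sum_subtractf)
    \<comment> \<open>The value -s/m of the last variable minimises the form, and its minimum is the
      form of the Schur complement.\<close>
    also have "\<dots> = (\<Sum>i<n. \<Sum>j<n. u i * M i j * u j) + 2 * (- s / m) * s + (- s / m)\<^sup>2 * m"
      by (cases "m = 0") (simp_all add: power2_eq_square field_simps)
    also have "\<dots> \<ge> 0" using form[of u "- s / m"] by (simp add: s_def)
    finally show "0 \<le> (\<Sum>i<n. \<Sum>j<n. u i * M' i j * u j)" .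
  qed
  from Suc.IH[OF this] obtain us where us: "\<And>a b. a < n \<Longrightarrow> b < n \<Longrightarrow> M' a b = (\<Sum>u\<leftarrow>us. u a * u b)"
    by blast
  \<comment> \<open>The induction hypothesis says nothing about index \<open>n\<close>, so the old
    vectors are set to 0 there; the new vector alone produces the last row and column.\<close>
  define us' where "us' = (\<lambda>i. M i n / sqrt m) # map (\<lambda>u. u(n := 0)) us"
  have "M a b = (\<Sum>u\<leftarrow>us'. u a * u b)" if ab: "a < Suc n" "b < Suc n" for a b
  proof -
    have rest: "(\<Sum>u\<leftarrow>map (\<lambda>u. u(n := 0)) us. u a * u b) = (if a < n \<and> b < n then M' a b else 0)"
    proof (cases "a < n \<and> b < n")
      case True
      then show ?thesis using us by (simp add: comp_def)
    next
      case False
      then have "a = n \<or> b = n" using ab by auto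
      then have "(\<lambda>u. (u(n := 0)) a * (u(n := 0)) b) = (\<lambda>u::nat \<Rightarrow> real. 0)" by auto
      then show ?thesis using False by (auto simp add: comp_def simp del: fun_upd_apply)
    qed
    have "M a b = M a n * M b n / m + (if a < n \<and> b < n then M' a b else 0)"
    proof (cases "m = 0")
      case True
      then have "M n n = 0" by (simp add: m_def)
      then show ?thesis using zero[OF _ True] True sym[of a b] ab
        by (auto simp: M'_def less_Suc_eq)
    next
      case False
      then show ?thesis using sym[of a b] ab by (auto simp: M'_def m_def less_Suc_eq)
    qed
    moreover have "M a n / sqrt m * (M b n / sqrt m) = M a n * M b n / m" using m by simp
    ultimately show ?thesis unfolding us'_def list.map(2) sum_list.Cons rest by (simp only:)
  qed
  then show ?case by blast
qed

section \<open>Inner products, membership and self-duality of the cones\<close>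

lemma cone_inner_commute: "cone_inner k y z = cone_inner k z y"
  by (simp add: cone_inner_def mult.commute)

lemma cone_inner_add: "cone_inner k y (\<lambda>i j. a i j + b i j) = cone_inner k y a + cone_inner k y b"
  by (simp add: cone_inner_def distrib_left sum.distrib)

lemma cone_inner_scale: "cone_inner k y (\<lambda>i j. c * a i j) = c * cone_inner k y a"
  by (simp add: cone_inner_def sum_distrib_left mult_ac)

lemma cone_inner_sum: "cone_inner k y (\<lambda>i j. \<Sum>x\<in>S. a x i j) = (\<Sum>x\<in>S. cone_inner k y (a x))"
proof -
  have "cone_inner k y (\<lambda>i j. \<Sum>x\<in>S. a x i j) = (\<Sum>i<cone_rows k. \<Sum>x\<in>S. \<Sum>j<cone_cols k. y i j * a x i j)"
    unfolding cone_inner_def sum_distrib_left by (intro sum.cong refl, rule sum.swap)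
  then show ?thesis unfolding cone_inner_def by (simp add: sum.swap[of _ S])
qed

lemma cone_inner_affine_image:
  "cone_inner k y (affine_image q A G e w \<mu>)
    = (\<Sum>l\<in>UNIV. w $ l * cone_inner k y (A l)) + (\<Sum>i<q. \<mu> i * cone_inner k y (G i)) + cone_inner k y e"
  unfolding affine_image_def by (simp add: cone_inner_add cone_inner_sum cone_inner_scale)

lemma cone_space_zero: "(\<lambda>_ _. 0) \<in> cone_space k"
  by (simp add: cone_space_def)

lemma cone_space_add: "a \<in> cone_space k \<Longrightarrow> b \<in> cone_space k \<Longrightarrow> (\<lambda>i j. a i j + b i j) \<in> cone_space k"
  by (simp add: cone_space_def)

lemma cone_space_scale: "a \<in> cone_space k \<Longrightarrow> (\<lambda>i j. c * a i j) \<in> cone_space k"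
  by (simp add: cone_space_def)

lemma cone_space_sum: "(\<And>x. x \<in> S \<Longrightarrow> a x \<in> cone_space k) \<Longrightarrow> (\<lambda>i j. \<Sum>x\<in>S. a x i j) \<in> cone_space k"
  unfolding cone_space_def by (auto intro!: sum.neutral sum.cong)

lemma affine_image_in_cone_space:
  assumes "\<And>l. A l \<in> cone_space k" "\<And>i. i < q \<Longrightarrow> G i \<in> cone_space k" "e \<in> cone_space k"
  shows "affine_image q A G e w \<mu> \<in> cone_space k"
  unfolding affine_image_def using assms
  by (intro cone_space_add cone_space_sum cone_space_scale) auto

lemma cone_set_subset: "y \<in> cone_set k \<Longrightarrow> y \<in> cone_space k"
  by (cases k) auto

lemma cone_set_zero: "(\<lambda>_ _. 0) \<in> cone_set k"
  by (cases k) (auto simp: cone_space_zero psd_def L2_set_def)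

lemma cone_set_scale:
  assumes "y \<in> cone_set k" "0 \<le> c"
  shows "(\<lambda>i j. c * y i j) \<in> cone_set k"
proof (cases k)
  case NonNeg
  then show ?thesis using assms by (simp add: cone_space_scale)
next
  case (SOC m)
  have "L2_set (\<lambda>j. c * y j 0) {..<m} = c * L2_set (\<lambda>j. y j 0) {..<m}"
    using assms(2) by (rule L2_set_right_distrib[symmetric])
  then show ?thesis using assms SOC by (simp add: cone_space_scale mult_left_mono)
next
  case (PSD n)
  have "(\<Sum>i<n. \<Sum>j<n. u i * (c * y i j) * u j) = c * (\<Sum>i<n. \<Sum>j<n. u i * y i j * u j)" for u
    by (simp add: sum_distrib_left mult_ac)
  then show ?thesis using assms PSD by (auto simp add: cone_space_scale psd_def)
qed

lemma cone_set_add: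
  assumes "y \<in> cone_set k" "z \<in> cone_set k"
  shows "(\<lambda>i j. y i j + z i j) \<in> cone_set k"
proof (cases k)
  case NonNeg
  then show ?thesis using assms by (simp add: cone_space_add)
next
  case (SOC m)
  then show ?thesis using assms L2_set_triangle_ineq[of "\<lambda>j. y j 0" "\<lambda>j. z j 0" "{..<m}"]
    by (simp add: cone_space_add)
next
  case (PSD n)
  have "(\<Sum>i<n. \<Sum>j<n. u i * (y i j + z i j) * u j)
      = (\<Sum>i<n. \<Sum>j<n. u i * y i j * u j) + (\<Sum>i<n. \<Sum>j<n. u i * z i j * u j)" for u
    by (simp add: algebra_simps sum.distrib)
  then show ?thesis using assms PSD by (auto simp add: cone_space_add psd_def)
qed

lemma cone_set_sum:
  assumes "\<And>x. x \<in> S \<Longrightarrow> a x \<in> cone_set k"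
  shows "(\<lambda>i j. \<Sum>x\<in>S. a x i j) \<in> cone_set k"
  using assms
proof (induction S rule: infinite_finite_induct)
  case (insert x S)
  then show ?case using cone_set_add[of "a x" k "\<lambda>i j. \<Sum>x\<in>S. a x i j"] by simp
qed (simp_all add: cone_set_zero)

text \<open>The second-order case is the Cauchy-Schwarz inequality. In the semidefinite case
  \<open>y\<close> splits into outer products, and the trace product becomes a sum of values of the
  quadratic form of \<open>z\<close>.\<close>

lemma cone_inner_nonneg:
  assumes "y \<in> cone_set k" "z \<in> cone_set k"
  shows "0 \<le> cone_inner k y z"
proof (cases k)
  case NonNeg
  then show ?thesis using assms by (simp add: cone_inner_def)
next
  case (SOC m)
  have "- (\<Sum>j<m. y j 0 * z j 0) \<le> (\<Sum>j<m. \<bar>y j 0\<bar> * \<bar>z j 0\<bar>)"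
    unfolding sum_negf[symmetric] by (intro sum_mono) (simp add: abs_mult[symmetric])
  also have "\<dots> \<le> L2_set (\<lambda>j. y j 0) {..<m} * L2_set (\<lambda>j. z j 0) {..<m}"
    by (rule L2_set_mult_ineq)
  also have "\<dots> \<le> y m 0 * z m 0"
    using assms SOC by (intro mult_mono) auto
  finally show ?thesis by (simp add: SOC cone_inner_def)
next
  case (PSD n)
  then have "psd n y" "psd n z" using assms by auto
  then obtain us where us: "\<And>a b. a < n \<Longrightarrow> b < n \<Longrightarrow> y a b = (\<Sum>u\<leftarrow>us. u a * u b)"
    using psd_outer_products by blast
  have "cone_inner k y z = (\<Sum>i<n. \<Sum>j<n. (\<Sum>u\<leftarrow>us. u i * u j) * z i j)"
    unfolding cone_inner_def PSD by (auto intro!: sum.cong simp: us)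
  also have "\<dots> = (\<Sum>u\<leftarrow>us. \<Sum>i<n. \<Sum>j<n. u i * z i j * u j)"
    by (induction us) (simp_all add: algebra_simps sum.distrib)
  also have "\<dots> \<ge> 0"
    using \<open>psd n z\<close> by (intro sum_list_nonneg) (auto simp: psd_def)
  finally show ?thesis .
qed

text \<open>Few test elements suffice: the unit for the half-line; the axis (0, 1) and the boundary
  point (-u, |u|) for the second-order cone, where u is the vector part of \<open>z\<close>; all
  outer products of vectors for the semidefinite cone.\<close>

lemma cone_set_self_dual:
  assumes z: "z \<in> cone_space k" and nonneg: "\<And>y. y \<in> cone_set k \<Longrightarrow> 0 \<le> cone_inner k z y"
  shows "z \<in> cone_set k"
proof (cases k)
  case NonNeg
  have "(\<lambda>i j. if i = 0 \<and> j = 0 then 1 else 0) \<in> cone_set k"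
    by (simp add: NonNeg cone_space_def)
  from nonneg[OF this] show ?thesis using z by (simp add: NonNeg cone_inner_def)
next
  case (SOC m)
  define L where "L = L2_set (\<lambda>j. z j 0) {..<m}"
  have "(\<lambda>i j. if i = m \<and> j = 0 then 1 else 0) \<in> cone_set k"
    by (auto simp add: SOC cone_space_def L2_set_def)
  from nonneg[OF this] have \<tau>: "0 \<le> z m 0" by (simp add: SOC cone_inner_def)
  have "L \<le> z m 0"
  proof (cases "L = 0")
    case True
    then show ?thesis using \<tau> by simp
  next
    case False
    then have L: "L > 0" using L2_set_nonneg[of "\<lambda>j. z j 0" "{..<m}"] unfolding L_def by linarith
    define y where "y = (\<lambda>i j::nat. if j = 0 then if i < m then - z i 0 else if i = m then L else 0 else 0)"
    have "L2_set (\<lambda>j. y j 0) {..<m} = L"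
      unfolding L_def L2_set_def y_def by (intro arg_cong[of _ _ sqrt] sum.cong) auto
    then have "y \<in> cone_set k"
      using L by (auto simp: SOC cone_space_def y_def)
    from nonneg[OF this] have "0 \<le> (\<Sum>j<m. z j 0 * y j 0) + z m 0 * L"
      by (simp add: SOC cone_inner_def y_def)
    moreover have "(\<Sum>j<m. z j 0 * y j 0) = - L\<^sup>2"
      unfolding L_def L2_set_def y_def
      by (simp add: sum_nonneg real_sqrt_pow2 sum_negf[symmetric] power2_eq_square)
    ultimately have "L * L \<le> z m 0 * L" by (simp add: power2_eq_square)
    then show ?thesis using L by simp
  qed
  then show ?thesis using z \<tau> by (simp add: SOC L_def)
next
  case (PSD n)
  have "0 \<le> (\<Sum>i<n. \<Sum>j<n. u i * z i j * u j)" for u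
  proof -
    define y where "y = (\<lambda>i j. if i < n \<and> j < n then u i * u j else 0)"
    have "0 \<le> (\<Sum>i<n. \<Sum>j<n. x i * y i j * x j)" for x
    proof -
      have "(\<Sum>i<n. \<Sum>j<n. x i * y i j * x j) = (\<Sum>i<n. x i * u i) * (\<Sum>i<n. x i * u i)"
        unfolding sum_product y_def by (auto intro!: sum.cong)
      then show ?thesis by simp
    qed
    then have "y \<in> cone_set k"
      by (auto simp: PSD cone_space_def psd_def y_def)
    from nonneg[OF this] have "0 \<le> (\<Sum>i<n. \<Sum>j<n. z i j * y i j)"
      by (simp add: PSD cone_inner_def)
    also have "\<dots> = (\<Sum>i<n. \<Sum>j<n. u i * z i j * u j)"
      unfolding y_def by (auto intro!: sum.cong)
    finally show ?thesis .
  qed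
  moreover have "z i j = z j i" for i j using z PSD by (auto simp: cone_space_def)
  ultimately show ?thesis using z by (simp add: PSD psd_def)
qed

text \<open>Separation and Farkas' lemma deliver coefficient arrays without symmetry or support
  conditions. Passing to the symmetric part, or cutting off the irrelevant entries, leaves the
  functional on \<open>cone_space k\<close> unchanged.\<close>

lemma cone_space_representative:
  "\<exists>z\<in>cone_space k. \<forall>y\<in>cone_space k. cone_inner k y z = cone_inner k y a"
proof (cases k)
  case (PSD n)
  define z where "z = (\<lambda>i j. if i < n \<and> j < n then (a i j + a j i) / 2 else 0)"
  have "cone_inner k y z = cone_inner k y a" if "y \<in> cone_space k" for y
  proof -
    have sym: "y i j = y j i" for i j using that PSD by (auto simp: cone_space_def)
    have "cone_inner k y z = (\<Sum>i<n. \<Sum>j<n. y i j * a i j / 2 + y j i * a j i / 2)"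
      unfolding cone_inner_def PSD z_def by (auto intro!: sum.cong simp: field_simps sym)
    also have "\<dots> = (\<Sum>i<n. \<Sum>j<n. y i j * a i j / 2) + (\<Sum>i<n. \<Sum>j<n. y j i * a j i / 2)"
      by (simp add: sum.distrib)
    also have "(\<Sum>i<n. \<Sum>j<n. y j i * a j i / 2) = (\<Sum>i<n. \<Sum>j<n. y i j * a i j / 2)"
      by (rule sum.swap)
    also have "(\<Sum>i<n. \<Sum>j<n. y i j * a i j / 2) = cone_inner k y a / 2"
      by (simp add: cone_inner_def PSD sum_divide_distrib)
    finally show ?thesis by simp
  qed
  moreover have "z \<in> cone_space k" by (auto simp: PSD cone_space_def z_def)
  ultimately show ?thesis by blast
qed (rule bexI[of _ "\<lambda>i j. if i < cone_rows k \<and> j < cone_cols k then a i j else 0"];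
    auto simp: cone_inner_def cone_space_def)+

lemma tendsto_pointwise:
  fixes f :: "'c \<Rightarrow> 'a \<Rightarrow> 'b::topological_space"
  assumes "\<And>i. ((\<lambda>n. f n i) \<longlongrightarrow> l i) F"
  shows "(f \<longlongrightarrow> l) F"
proof -
  have "limitin (product_topology (\<lambda>_. euclidean) UNIV) f l F"
    using assms by (simp add: limitin_componentwise)
  then show ?thesis by (simp add: euclidean_product_topology)
qed

text \<open>If no margin worked, perturbations bounded by 1/(n + 1) that leave the cone would
  converge to \<open>y\<close> pointwise, hence in the product topology, contradicting relative
  openness.\<close>

lemma cone_interior_margin:
  assumes "y \<in> cone_interior k"
  shows "\<exists>\<delta>>0. \<forall>\<eta>\<in>cone_space k. (\<forall>i j. \<bar>\<eta> i j\<bar> \<le> \<delta>) \<longrightarrow> (\<lambda>i j. y i j + \<eta> i j) \<in> cone_set k"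
proof (rule ccontr)
  assume neg: "\<not> ?thesis"
  obtain U where U: "openin (top_of_set (cone_space k)) U" "y \<in> U" "U \<subseteq> cone_set k"
    using assms unfolding cone_interior_def interior_of_def by blast
  then obtain V where V: "open V" "U = cone_space k \<inter> V" by (auto simp: openin_open)
  have "\<exists>\<eta>\<in>cone_space k. (\<forall>i j. \<bar>\<eta> i j\<bar> \<le> 1 / Suc n) \<and> (\<lambda>i j. y i j + \<eta> i j) \<notin> cone_set k" for n
  proof -
    have "(0::real) < 1 / Suc n" by simp
    then show ?thesis using neg by blast
  qed
  then obtain \<eta> where \<eta>: "\<And>n. \<eta> n \<in> cone_space k" "\<And>n i j. \<bar>\<eta> n i j\<bar> \<le> 1 / Suc n"
    "\<And>n. (\<lambda>i j. y i j + \<eta> n i j) \<notin> cone_set k"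
    by metis
  have "(\<lambda>n. \<eta> n i j) \<longlonglongrightarrow> 0" for i j
    by (rule Lim_null_comparison[OF _ LIMSEQ_Suc[OF lim_1_over_n]])
      (use \<eta>(2) in \<open>auto intro!: always_eventually simp: field_simps\<close>)
  then have "(\<lambda>n. y i j + \<eta> n i j) \<longlonglongrightarrow> y i j" for i j
    using tendsto_add[OF tendsto_const[of "y i j"]] by fastforce
  then have "(\<lambda>n i j. y i j + \<eta> n i j) \<longlonglongrightarrow> y"
    by (intro tendsto_pointwise)
  then have "\<forall>\<^sub>F n in sequentially. (\<lambda>i j. y i j + \<eta> n i j) \<in> V"
    using V U(2) by (intro topological_tendstoD) auto
  then obtain n where "(\<lambda>i j. y i j + \<eta> n i j) \<in> V"
    by (auto simp: eventually_sequentially)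
  moreover have "(\<lambda>i j. y i j + \<eta> n i j) \<in> cone_space k"
    using U(2) V(2) \<eta>(1) by (intro cone_space_add) auto
  ultimately show False using V(2) U(3) \<eta>(3) by blast
qed

section \<open>Weighted sums of squares\<close>

lemma wsos_summands_cases:
  assumes "S \<in> wsos_summands N g q"
  obtains C where "S = (\<lambda>a b z. C a z * C b z)" "\<And>a. a < q \<Longrightarrow> real_polynomial_function (C a)"
  | i C where "S = (\<lambda>a b z. \<Sum>p<N i. \<Sum>r<N i. C p a z * g i p r z * C r b z)"
    "\<And>p a. p < N i \<Longrightarrow> a < q \<Longrightarrow> real_polynomial_function (C p a)"
  using assms unfolding wsos_summands_def by blast

lemma wsos_summands_square:
  "(\<And>a. a < q \<Longrightarrow> real_polynomial_function (C a)) \<Longrightarrow> (\<lambda>a b z. C a z * C b z) \<in> wsos_summands N g q"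
  unfolding wsos_summands_def by blast

lemma wsos_summands_weighted:
  "(\<And>p a. p < N i \<Longrightarrow> a < q \<Longrightarrow> real_polynomial_function (C p a)) \<Longrightarrow>
    (\<lambda>a b z. \<Sum>p<N i. \<Sum>r<N i. C p a z * g i p r z * C r b z) \<in> wsos_summands N g q"
  unfolding wsos_summands_def by blast

lemma wsos_summands_polynomial:
  assumes g: "\<And>i. symmetric_pmat (N i) (g i)" and S: "S \<in> wsos_summands N g q" and ab: "a < q" "b < q"
  shows "real_polynomial_function (S a b)"
  using S
proof (cases rule: wsos_summands_cases)
  case (1 C)
  then show ?thesis using ab by (auto intro: real_polynomial_function.intros(4))
next
  case (2 i C)
  have "real_polynomial_function (g i p r)" if "p < N i" "r < N i" for p r
    using g that unfolding symmetric_pmat_def by blast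
  then show ?thesis unfolding 2(1)
    by (intro real_polynomial_function_sum real_polynomial_function.intros(4) 2(2)) (use ab in auto)
qed

text \<open>A scalar summand absorbs the factors \<open>U\<close> into \<open>C\<close>. Constant
  \<open>U\<close> produces multiples of outer products; q = 1 produces multiplication by a
  square.\<close>

lemma wsos_summands_conjugate:
  assumes S: "S \<in> wsos_summands N g 1" and U: "\<And>a. a < q \<Longrightarrow> real_polynomial_function (U a)"
  shows "(\<lambda>a b z. U a z * S 0 0 z * U b z) \<in> wsos_summands N g q"
  using S
proof (cases rule: wsos_summands_cases)
  case (1 C)
  have "(\<lambda>a b z. U a z * S 0 0 z * U b z) = (\<lambda>a b z. (C 0 z * U a z) * (C 0 z * U b z))"
    by (simp add: 1(1) mult_ac)
  also have "\<dots> \<in> wsos_summands N g q"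
    by (rule wsos_summands_square) (intro real_polynomial_function.intros(4) 1(2) U, auto)
  finally show ?thesis .
next
  case (2 i C)
  have "(\<lambda>a b z. U a z * S 0 0 z * U b z)
      = (\<lambda>a b z. \<Sum>p<N i. \<Sum>r<N i. (C p 0 z * U a z) * g i p r z * (C r 0 z * U b z))"
    by (simp add: 2(1) sum_distrib_left sum_distrib_right mult_ac)
  also have "\<dots> \<in> wsos_summands N g q"
    by (rule wsos_summands_weighted) (intro real_polynomial_function.intros(4) 2(2) U, auto)
  finally show ?thesis .
qed

text \<open>The form of a congruence transform at \<open>u\<close> is the form of \<open>G\<close>
  at the transformed vector.\<close>

lemma quadratic_form_congruence:
  fixes y :: "nat \<Rightarrow> nat \<Rightarrow> real"
  shows "(\<Sum>a<q. \<Sum>b<q. u a * (\<Sum>p<n. \<Sum>r<n. y p a * G p r * y r b) * u b)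
    = (\<Sum>p<n. \<Sum>r<n. (\<Sum>a<q. u a * y p a) * G p r * (\<Sum>b<q. u b * y r b))"
proof -
  have "(\<Sum>a<q. \<Sum>b<q. u a * (\<Sum>p<n. \<Sum>r<n. y p a * G p r * y r b) * u b)
      = (\<Sum>(a, b)\<in>{..<q} \<times> {..<q}. \<Sum>(p, r)\<in>{..<n} \<times> {..<n}. (u a * y p a) * G p r * (u b * y r b))"
    by (simp add: sum.cartesian_product[symmetric] sum_distrib_left sum_distrib_right mult_ac)
  also have "\<dots> = (\<Sum>(p, r)\<in>{..<n} \<times> {..<n}. \<Sum>(a, b)\<in>{..<q} \<times> {..<q}. (u a * y p a) * G p r * (u b * y r b))"
    unfolding split_def by (rule sum.swap)
  also have "\<dots> = (\<Sum>p<n. \<Sum>r<n. (\<Sum>a<q. u a * y p a) * G p r * (\<Sum>b<q. u b * y r b))"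
    unfolding sum_distrib_right unfolding sum_distrib_left
    by (simp add: sum.cartesian_product[symmetric])
  finally show ?thesis .
qed

lemma wsos_summands_psd:
  assumes S: "S \<in> wsos_summands N g q" and z: "z \<in> semialg_set N g"
  shows "psd q (\<lambda>a b. S a b z)"
  using S
proof (cases rule: wsos_summands_cases)
  case (1 C)
  have "(\<Sum>a<q. \<Sum>b<q. u a * (C a z * C b z) * u b) = (\<Sum>a<q. u a * C a z) * (\<Sum>a<q. u a * C a z)" for u
    unfolding sum_product by (simp add: mult_ac)
  then show ?thesis unfolding 1(1) psd_def by (simp add: mult.commute)
next
  case (2 i C)
  have g: "psd (N i) (\<lambda>a b. g i a b z)" using z by (simp add: semialg_set_def)
  have sym: "(\<Sum>p<N i. \<Sum>r<N i. C p a z * g i p r z * C r b z)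
      = (\<Sum>p<N i. \<Sum>r<N i. C p b z * g i p r z * C r a z)" for a b
    by (subst sum.swap) (use g in \<open>auto intro!: sum.cong simp: psd_def mult_ac\<close>)
  show ?thesis
    unfolding 2(1) psd_def quadratic_form_congruence
    by (intro conjI allI impI sym) (rule g[unfolded psd_def, THEN conjunct2, rule_format])
qed

lemma psd_sum_list:
  assumes "\<And>S. S \<in> set Ss \<Longrightarrow> psd q (\<lambda>a b. S a b z)"
  shows "psd q (\<lambda>a b. \<Sum>S\<leftarrow>Ss. S a b z)"
  using assms
proof (induction Ss)
  case Nil
  then show ?case by (simp add: psd_def)
next
  case (Cons S Ss)
  then have "psd q (\<lambda>a b. S a b z)" "psd q (\<lambda>a b. \<Sum>S\<leftarrow>Ss. S a b z)" by auto
  then show ?case by (auto simp: psd_def algebra_simps sum.distrib)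
qed

lemma wsos_psd:
  assumes F: "F \<in> wsos N g q" and z: "z \<in> semialg_set N g"
  shows "psd q (\<lambda>a b. F a b z)"
proof -
  obtain Ss where Ss: "set Ss \<subseteq> wsos_summands N g q"
    "\<And>a b. a < q \<Longrightarrow> b < q \<Longrightarrow> F a b = (\<lambda>z. \<Sum>S\<leftarrow>Ss. S a b z)"
    using F unfolding wsos_def by blast
  have "psd q (\<lambda>a b. \<Sum>S\<leftarrow>Ss. S a b z)"
    using wsos_summands_psd[OF _ z] Ss(1) by (intro psd_sum_list) blast
  then show ?thesis unfolding psd_def by (simp add: Ss(2))
qed

lemma wsos_deg_subset: "wsos_deg N g q D \<subseteq> wsos N g q"
  unfolding wsos_deg_def wsos_def by blast

lemma wsos_deg_mono: "D \<le> D' \<Longrightarrow> wsos_deg N g q D \<subseteq> wsos_deg N g q D'"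
  unfolding wsos_deg_def by (blast intro: degree_le_mono)

lemma wsos_deg_cong:
  "F \<in> wsos_deg N g q D \<Longrightarrow> (\<And>a b. a < q \<Longrightarrow> b < q \<Longrightarrow> F' a b = F a b) \<Longrightarrow> F' \<in> wsos_deg N g q D"
  unfolding wsos_deg_def by auto

lemma wsos_deg_zero: "(\<lambda>_ _ _. 0) \<in> wsos_deg N g q D"
  unfolding wsos_deg_def by (auto intro!: exI[of _ "[]"])

lemma wsos_deg_add:
  assumes "F \<in> wsos_deg N g q D" "F' \<in> wsos_deg N g q D"
  shows "(\<lambda>a b z. F a b z + F' a b z) \<in> wsos_deg N g q D"
proof -
  obtain Ss where 1: "set Ss \<subseteq> wsos_summands N g q" "\<forall>S\<in>set Ss. \<forall>a<q. \<forall>b<q. degree_le D (S a b)"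
    "\<And>a b. a < q \<Longrightarrow> b < q \<Longrightarrow> F a b = (\<lambda>z. \<Sum>S\<leftarrow>Ss. S a b z)"
    using assms(1) unfolding wsos_deg_def by blast
  obtain Ss' where 2: "set Ss' \<subseteq> wsos_summands N g q" "\<forall>S\<in>set Ss'. \<forall>a<q. \<forall>b<q. degree_le D (S a b)"
    "\<And>a b. a < q \<Longrightarrow> b < q \<Longrightarrow> F' a b = (\<lambda>z. \<Sum>S\<leftarrow>Ss'. S a b z)"
    using assms(2) unfolding wsos_deg_def by blast
  show ?thesis unfolding wsos_deg_def mem_Collect_eq
    by (intro exI[of _ "Ss @ Ss'"]) (use 1 2 in auto)
qed

lemma wsos_imp_wsos_deg:
  assumes g: "\<And>i. symmetric_pmat (N i) (g i)" and F: "F \<in> wsos N g q"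
  shows "\<exists>D. F \<in> wsos_deg N g q D"
proof -
  obtain Ss where Ss: "set Ss \<subseteq> wsos_summands N g q"
    "\<forall>a<q. \<forall>b<q. F a b = (\<lambda>z. \<Sum>S\<leftarrow>Ss. S a b z)"
    using F unfolding wsos_def by blast
  have "\<exists>k. degree_le k (S a b)" if "S \<in> set Ss" "a < q" "b < q" for S a b
    unfolding real_polynomial_function_iff_degree_le[symmetric]
    by (rule wsos_summands_polynomial[where N = N and g = g]) (use g that Ss(1) in auto)
  then obtain k where k: "\<And>S a b. S \<in> set Ss \<Longrightarrow> a < q \<Longrightarrow> b < q \<Longrightarrow> degree_le (k S a b) (S a b)"
    by metis
  \<comment> \<open>The inserted 0 keeps the maximum defined for an empty list of summands.\<close>
  define D where "D = Max (insert 0 ((\<lambda>(S, a, b). k S a b) ` (set Ss \<times> {..<q} \<times> {..<q})))"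
  have "degree_le D (S a b)" if "S \<in> set Ss" "a < q" "b < q" for S a b
  proof (rule degree_le_mono[OF k[OF that]])
    show "k S a b \<le> D" unfolding D_def using that by (intro Max_ge) force+
  qed
  then show ?thesis using Ss unfolding wsos_deg_def by blast
qed

lemma scalar_wsos_iff:
  "(\<lambda>_ _. f) \<in> wsos N g 1 \<longleftrightarrow>
    (\<exists>Ss. set Ss \<subseteq> wsos_summands N g 1 \<and> f = (\<lambda>z. \<Sum>S\<leftarrow>Ss. S 0 0 z))"
  unfolding wsos_def by simp

lemma quadratic_module_wsos:
  assumes g: "\<And>i. symmetric_pmat (N i) (g i)"
  shows "quadratic_module {f. (\<lambda>_ _. f) \<in> wsos N g 1}"
proof
  let ?M = "{f. (\<lambda>_ _. f) \<in> wsos N g 1}"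
  fix f assume "f \<in> ?M"
  then obtain Ss where Ss: "set Ss \<subseteq> wsos_summands N g 1" "f = (\<lambda>z. \<Sum>S\<leftarrow>Ss. S 0 0 z)"
    unfolding scalar_wsos_iff by blast
  from Ss(1) have "real_polynomial_function (\<lambda>z. \<Sum>S\<leftarrow>Ss. S 0 0 z)"
  proof (induction Ss)
    case Nil
    show ?case by (simp add: real_polynomial_function.intros(2))
  next
    case (Cons S Ss)
    have "real_polynomial_function (S 0 0)"
      by (rule wsos_summands_polynomial[where N = N and g = g and q = 1]) (use g Cons.prems in auto)
    then show ?case using Cons by (auto intro: real_polynomial_function.intros(3))
  qed
  then show "real_polynomial_function f" using Ss by simp
  show "(\<lambda>z. (h z)\<^sup>2 * f z) \<in> ?M" if h: "real_polynomial_function h" for h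
  proof -
    define Ss' where "Ss' = map (\<lambda>S (a::nat) (b::nat) z. h z * S 0 0 z * h z) Ss"
    have "set Ss' \<subseteq> wsos_summands N g 1"
      unfolding Ss'_def using Ss(1) wsos_summands_conjugate[of _ N g 1 "\<lambda>_. h"] h by auto
    moreover have "(\<lambda>z. (h z)\<^sup>2 * f z) = (\<lambda>z. \<Sum>S\<leftarrow>Ss'. S 0 0 z)"
      by (simp add: Ss'_def Ss(2) comp_def power2_eq_square mult_ac sum_list_const_mult)
    ultimately show ?thesis unfolding mem_Collect_eq scalar_wsos_iff by blast
  qed
  fix f' assume "f' \<in> ?M"
  then obtain Ss' where Ss': "set Ss' \<subseteq> wsos_summands N g 1" "f' = (\<lambda>z. \<Sum>S\<leftarrow>Ss'. S 0 0 z)"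
    unfolding scalar_wsos_iff by blast
  show "(\<lambda>z. f z + f' z) \<in> ?M"
    unfolding mem_Collect_eq scalar_wsos_iff using Ss Ss' by (intro exI[of _ "Ss @ Ss'"]) auto
next
  have "(\<lambda>a b z. 1 * 1) \<in> wsos_summands N g 1"
    by (rule wsos_summands_square) (rule real_polynomial_function.intros)
  then show "(\<lambda>_. 1) \<in> {f. (\<lambda>_ _. f) \<in> wsos N g 1}"
    unfolding mem_Collect_eq scalar_wsos_iff by (intro exI[of _ "[\<lambda>a b z. 1 * 1]"]) simp
qed

text \<open>For every constant vector \<open>u\<close> the polynomial given by the form of
  \<open>g i\<close> at \<open>u\<close> lies in the module. Nonnegativity of the module at a point
  therefore makes each matrix \<open>g i\<close> psd there, so that the point belongs to the
  semialgebraic set.\<close>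

theorem putinar_wsos:
  assumes g: "\<And>i. symmetric_pmat (N i) (g i)" and arch: "archimedean N g"
    and p: "real_polynomial_function p" and pos: "\<And>z. z \<in> semialg_set N g \<Longrightarrow> 0 < p z"
  shows "(\<lambda>_ _. p) \<in> wsos N g 1"
proof -
  let ?M = "{f. (\<lambda>_ _. f) \<in> wsos N g 1}"
  interpret quadratic_module ?M by (rule quadratic_module_wsos[OF g])
  obtain R where R: "(\<lambda>z. R - (norm z)\<^sup>2) \<in> ?M" using arch unfolding archimedean_def by blast
  have "p \<in> ?M"
  proof (rule putinar[OF R p])
    fix z assume z: "\<forall>m\<in>?M. 0 \<le> m z"
    have "psd (N i) (\<lambda>a b. g i a b z)" for i
      unfolding psd_def
    proof (intro conjI allI impI)
      show "g i a b z = g i b a z" if "a < N i" "b < N i" for a b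
        using g[of i] that unfolding symmetric_pmat_def by metis
      fix u :: "nat \<Rightarrow> real"
      have "(\<lambda>a b z. \<Sum>p<N i. \<Sum>r<N i. u p * g i p r z * u r) \<in> wsos_summands N g 1"
        using wsos_summands_weighted[of N i 1 "\<lambda>p a z. u p" g] by (simp add: real_polynomial_function.intros)
      then have "(\<lambda>z. \<Sum>p<N i. \<Sum>r<N i. u p * g i p r z * u r) \<in> ?M"
        unfolding mem_Collect_eq scalar_wsos_iff
        by (intro exI[of _ "[\<lambda>a b z. \<Sum>p<N i. \<Sum>r<N i. u p * g i p r z * u r]"]) simp
      from z[rule_format, OF this] show "0 \<le> (\<Sum>p<N i. \<Sum>r<N i. u p * g i p r z * u r)" .
    qed
    then show "0 < p z" by (intro pos) (simp add: semialg_set_def)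
  qed
  then show ?thesis by simp
qed

lemma degree_le_const_mult:
  assumes "degree_le k p" shows "degree_le k (\<lambda>z. c * p z)"
proof -
  obtain d where "p = (\<lambda>z. \<Sum>\<alpha>\<in>exponents k. d \<alpha> * monomial \<alpha> z)"
    using assms unfolding degree_le_def by blast
  then show ?thesis unfolding degree_le_def
    by (intro exI[of _ "\<lambda>\<alpha>. c * d \<alpha>"]) (simp add: sum_distrib_left mult.assoc)
qed

text \<open>The vectors in the outer product decomposition of \<open>M\<close> are constant, so
  conjugation by them preserves the degree bound of each summand and the same \<open>D\<close>
  serves.\<close>

lemma wsos_deg_scalar_psd:
  assumes f: "(\<lambda>_ _. f) \<in> wsos_deg N g 1 D" and M: "psd n M"
  shows "(\<lambda>a b z. f z * M a b) \<in> wsos_deg N g n D"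
proof -
  obtain Ss where Ss: "set Ss \<subseteq> wsos_summands N g 1" "\<forall>S\<in>set Ss. degree_le D (S 0 0)"
    "f = (\<lambda>z. \<Sum>S\<leftarrow>Ss. S 0 0 z)"
    using f unfolding wsos_deg_def by auto
  have rank1: "(\<lambda>a b z. f z * (u a * u b)) \<in> wsos_deg N g n D" for u :: "nat \<Rightarrow> real"
  proof -
    define Ss' where "Ss' = map (\<lambda>S (a::nat) (b::nat) z. u a * S 0 0 z * u b) Ss"
    have "set Ss' \<subseteq> wsos_summands N g n"
      unfolding Ss'_def using Ss(1) wsos_summands_conjugate[of _ N g n "\<lambda>a _. u a"]
      by (auto simp: real_polynomial_function.intros(2))
    moreover have "\<forall>S\<in>set Ss'. \<forall>a<n. \<forall>b<n. degree_le D (S a b)"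
    proof -
      have "degree_le D (\<lambda>z. u a * S 0 0 z * u b)" if "S \<in> set Ss" for S a b
        using degree_le_const_mult[of D "S 0 0" "u a * u b"] Ss(2) that by (simp add: mult_ac)
      then show ?thesis unfolding Ss'_def by auto
    qed
    moreover have "(\<lambda>z. f z * (u a * u b)) = (\<lambda>z. \<Sum>S\<leftarrow>Ss'. S a b z)" for a b
      by (simp add: Ss'_def Ss(3) comp_def mult_ac sum_list_const_mult)
    ultimately show ?thesis unfolding wsos_deg_def by blast
  qed
  have list: "(\<lambda>a b z. f z * (\<Sum>u\<leftarrow>us. u a * u b)) \<in> wsos_deg N g n D" for us
  proof (induction us)
    case Nil
    then show ?case using wsos_deg_zero by simp
  next
    case (Cons u us)
    then show ?case using wsos_deg_add[OF rank1[of u] Cons] by (simp add: distrib_left)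
  qed
  obtain us where "\<And>a b. a < n \<Longrightarrow> b < n \<Longrightarrow> M a b = (\<Sum>u\<leftarrow>us. u a * u b)"
    using psd_outer_products[OF M] by blast
  then show ?thesis by (intro wsos_deg_cong[OF list[of us]]) simp
qed

lemma multiplier_sos_zero: "multiplier_sos N g D k (\<lambda>_ _ _. 0)"
proof (cases k)
  case (SOC m)
  have "sym2 (\<lambda>_. 0) (\<lambda>_. 0) (\<lambda>_. 0) \<in> wsos_deg N g 2 D"
    by (rule wsos_deg_cong[OF wsos_deg_zero]) (simp add: sym2_def)
  then show ?thesis
    by (auto simp: SOC intro!: exI[of _ "\<lambda>_ _. 0"] real_polynomial_function.intros)
qed (simp_all add: wsos_deg_zero)

lemma multiplier_sos_add:
  assumes "multiplier_sos N g D k \<zeta>" "multiplier_sos N g D k \<zeta>'"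
  shows "multiplier_sos N g D k (\<lambda>i j z. \<zeta> i j z + \<zeta>' i j z)"
proof (cases k)
  case (SOC m)
  obtain \<omega> where \<omega>: "\<And>j. j < m \<Longrightarrow> real_polynomial_function (\<omega> j)" "\<zeta> m 0 = (\<lambda>z. \<Sum>j<m. \<omega> j z)"
    "\<And>j. j < m \<Longrightarrow> sym2 (\<zeta> m 0) (\<zeta> j 0) (\<omega> j) \<in> wsos_deg N g 2 D"
    using assms(1)[unfolded SOC multiplier_sos.simps] by blast
  obtain \<omega>' where \<omega>': "\<And>j. j < m \<Longrightarrow> real_polynomial_function (\<omega>' j)" "\<zeta>' m 0 = (\<lambda>z. \<Sum>j<m. \<omega>' j z)"
    "\<And>j. j < m \<Longrightarrow> sym2 (\<zeta>' m 0) (\<zeta>' j 0) (\<omega>' j) \<in> wsos_deg N g 2 D"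
    using assms(2)[unfolded SOC multiplier_sos.simps] by blast
  have "sym2 (\<lambda>z. \<zeta> m 0 z + \<zeta>' m 0 z) (\<lambda>z. \<zeta> j 0 z + \<zeta>' j 0 z) (\<lambda>z. \<omega> j z + \<omega>' j z) \<in> wsos_deg N g 2 D"
    if "j < m" for j
    by (rule wsos_deg_cong[OF wsos_deg_add[OF \<omega>(3)[OF that] \<omega>'(3)[OF that]]]) (simp add: sym2_def)
  then show ?thesis unfolding SOC multiplier_sos.simps
    using \<omega>(1,2) \<omega>'(1,2)
    by (intro exI[of _ "\<lambda>j z. \<omega> j z + \<omega>' j z"]) (auto simp: sum.distrib intro: real_polynomial_function.intros(3))
qed (use assms wsos_deg_add in auto)

lemma multiplier_sos_sum:
  assumes "\<And>x. x \<in> S \<Longrightarrow> multiplier_sos N g D k (\<zeta> x)"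
  shows "multiplier_sos N g D k (\<lambda>i j z. \<Sum>x\<in>S. \<zeta> x i j z)"
  using assms
proof (induction S rule: infinite_finite_induct)
  case (insert x S)
  then show ?case
    using multiplier_sos_add[of N g D k "\<zeta> x" "\<lambda>i j z. \<Sum>x\<in>S. \<zeta> x i j z"] by simp
qed (simp_all add: multiplier_sos_zero)

text \<open>For the second-order cone, \<open>\<omega> j\<close> is \<open>\<beta>\<^sub>j\<^sup>2 / \<tau>\<close> plus an equal share of the slack
  \<open>\<tau> - \<bar>\<beta>\<bar>\<^sup>2 / \<tau>\<close>; for \<open>\<tau> = 0\<close> also \<open>\<beta> = 0\<close> and the quotients are zero.\<close>

lemma multiplier_sos_constant:
  assumes f: "(\<lambda>_ _. f) \<in> wsos_deg N g 1 D" "real_polynomial_function f"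
    and h: "h \<in> cone_set k" and k: "positive_size k"
  shows "multiplier_sos N g D k (\<lambda>i j z. f z * h i j)"
proof (cases k)
  case NonNeg
  then have "psd 1 h" using h by (simp add: psd_def) (metis mult.assoc mult.commute zero_le_mult_iff zero_le_square)
  then show ?thesis using wsos_deg_scalar_psd[OF f(1)] NonNeg by simp
next
  case (PSD n)
  then show ?thesis using wsos_deg_scalar_psd[OF f(1)] h by simp
next
  case (SOC m)
  define \<tau> where "\<tau> = h m 0"
  define B where "B = (\<Sum>j<m. (h j 0)\<^sup>2)"
  define \<omega> where "\<omega> j = (h j 0)\<^sup>2 / \<tau> + (\<tau> - B / \<tau>) / m" for j
  have m: "0 < m" using k SOC by simp
  have \<tau>: "0 \<le> \<tau>" and "sqrt B \<le> \<tau>" using h SOC by (auto simp: \<tau>_def B_def L2_set_def)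
  have B: "0 \<le> B" "B \<le> \<tau>\<^sup>2"
  proof -
    show "0 \<le> B" by (simp add: B_def sum_nonneg)
    then show "B \<le> \<tau>\<^sup>2" using power_mono[OF \<open>sqrt B \<le> \<tau>\<close>, of 2] by simp
  qed
  have zero: "h j 0 = 0" if "\<tau> = 0" "j < m" for j
  proof -
    have "B = 0" using B that by simp
    then show ?thesis using that unfolding B_def by (simp add: sum_nonneg_eq_0_iff)
  qed
  have sum_\<omega>: "(\<Sum>j<m. \<omega> j) = \<tau>"
    using m by (simp add: \<omega>_def sum.distrib sum_divide_distrib[symmetric] B_def)
  have psd2: "psd 2 (\<lambda>a b. if a = 0 \<and> b = 0 then \<tau> else if a = 1 \<and> b = 1 then \<omega> j else h j 0)"
    (is "psd 2 ?M") if j: "j < m" for j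
    unfolding psd_def
  proof (intro conjI allI impI)
    show "?M a b = ?M b a" for a b by auto
    fix u :: "nat \<Rightarrow> real"
    have form: "(\<Sum>a<2. \<Sum>b<2. u a * ?M a b * u b) = \<tau> * (u 0)\<^sup>2 + 2 * h j 0 * u 0 * u 1 + \<omega> j * (u 1)\<^sup>2"
      by (simp add: numeral_2_eq_2 power2_eq_square algebra_simps)
    show "0 \<le> (\<Sum>a<2. \<Sum>b<2. u a * ?M a b * u b)"
    proof (cases "\<tau> = 0")
      case True
      then show ?thesis unfolding form by (simp add: zero[OF True j] \<omega>_def)
    next
      case False
      then have pos: "0 < \<tau>" using \<tau> by simp
      have "B / \<tau> \<le> \<tau>" using B pos by (simp add: field_simps power2_eq_square)
      then have "(h j 0)\<^sup>2 / \<tau> \<le> \<omega> j" using m by (simp add: \<omega>_def)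
      then have "(h j 0)\<^sup>2 / \<tau> * (u 1)\<^sup>2 \<le> \<omega> j * (u 1)\<^sup>2" by (intro mult_right_mono) auto
      moreover have "\<tau> * (u 0)\<^sup>2 + 2 * h j 0 * u 0 * u 1 + (h j 0)\<^sup>2 / \<tau> * (u 1)\<^sup>2
          = (\<tau> * u 0 + h j 0 * u 1)\<^sup>2 / \<tau>"
        using pos by (simp add: field_simps power2_eq_square)
      moreover have "0 \<le> (\<tau> * u 0 + h j 0 * u 1)\<^sup>2 / \<tau>" using pos by simp
      ultimately show ?thesis unfolding form by linarith
    qed
  qed
  have "sym2 (\<lambda>z. f z * h m 0) (\<lambda>z. f z * h j 0) (\<lambda>z. f z * \<omega> j) \<in> wsos_deg N g 2 D" if "j < m" for j
    by (rule wsos_deg_cong[OF wsos_deg_scalar_psd[OF f(1) psd2[OF that]]]) (auto simp: sym2_def \<tau>_def)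
  moreover have "(\<lambda>z. f z * h m 0) = (\<lambda>z. \<Sum>j<m. f z * \<omega> j)"
    unfolding sum_distrib_left[symmetric] sum_\<omega> \<tau>_def ..
  ultimately show ?thesis unfolding SOC multiplier_sos.simps
    using f(2) by (intro exI[of _ "\<lambda>j z. f z * \<omega> j"]) (auto intro: real_polynomial_function.intros(2,4))
qed

text \<open>In the second-order case each 2 x 2 block bounds the square of its off-diagonal entry by
  \<tau> \<omega>_j. Summing over j and using that the \<omega>_j add up to \<tau> bounds the
  squared norm of the vector part by the square of \<tau>.\<close>

lemma multiplier_sos_in_cone:
  assumes \<zeta>: "multiplier k \<zeta>" "multiplier_sos N g D k \<zeta>" and z: "z \<in> semialg_set N g"
  shows "(\<lambda>i j. \<zeta> i j z) \<in> cone_set k"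
proof -
  have space: "(\<lambda>i j. \<zeta> i j z) \<in> cone_space k" using \<zeta>(1) unfolding multiplier_def by blast
  have psd: "psd q (\<lambda>a b. F a b z)" if "F \<in> wsos_deg N g q D" for F q
    using that wsos_deg_subset wsos_psd[OF _ z] by blast
  show ?thesis
  proof (cases k)
    case NonNeg
    then have "psd 1 (\<lambda>a b. \<zeta> a b z)" using \<zeta>(2) psd by simp
    then have "0 \<le> (\<Sum>i<1. \<Sum>j<1. 1 * \<zeta> i j z * 1)" unfolding psd_def by (elim conjE allE[of _ "\<lambda>_. 1"])
    then show ?thesis using space NonNeg by simp
  next
    case (PSD n)
    then show ?thesis using space \<zeta>(2) psd by simp
  next
    case (SOC m)
    obtain \<omega> where \<omega>: "\<zeta> m 0 = (\<lambda>z. \<Sum>j<m. \<omega> j z)"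
      "\<And>j. j < m \<Longrightarrow> sym2 (\<zeta> m 0) (\<zeta> j 0) (\<omega> j) \<in> wsos_deg N g 2 D"
      using \<zeta>(2)[unfolded SOC multiplier_sos.simps] by blast
    define \<tau> where "\<tau> = \<zeta> m 0 z"
    have form: "0 \<le> \<tau> * s\<^sup>2 + 2 * \<zeta> j 0 z * s * t + \<omega> j z * t\<^sup>2" if j: "j < m" for j s t
    proof -
      have "0 \<le> (\<Sum>a<2. \<Sum>b<2. (if a = 0 then s else t) * sym2 (\<zeta> m 0) (\<zeta> j 0) (\<omega> j) a b z * (if b = 0 then s else t))"
        using psd[OF \<omega>(2)[OF j]] unfolding psd_def by (elim conjE allE[of _ "\<lambda>a. if a = 0 then s else t"])
      then show ?thesis
        by (simp add: numeral_2_eq_2 sym2_def \<tau>_def power2_eq_square algebra_simps)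
    qed
    have \<omega>_nonneg: "0 \<le> \<omega> j z" if "j < m" for j using form[OF that, of 0 1] by simp
    have \<tau>_sum: "\<tau> = (\<Sum>j<m. \<omega> j z)" by (simp add: \<tau>_def \<omega>(1))
    have \<tau>: "0 \<le> \<tau>" unfolding \<tau>_sum by (intro sum_nonneg \<omega>_nonneg) simp
    have "(\<zeta> j 0 z)\<^sup>2 \<le> \<tau> * \<omega> j z" if j: "j < m" for j
    proof (cases "\<tau> = 0")
      case True
      have "\<zeta> j 0 z = 0"
      proof (rule ccontr)
        assume ne: "\<zeta> j 0 z \<noteq> 0"
        have "0 \<le> 2 * \<zeta> j 0 z * s + \<omega> j z" for s using form[OF j, of s 1] True by simp
        from this[of "- (\<omega> j z + 1) / (2 * \<zeta> j 0 z)"] ne show False by (simp add: field_simps)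
      qed
      then show ?thesis using True by simp
    next
      case False
      \<comment> \<open>The form at the vector (\<zeta> j 0 z, -\<tau>) is \<tau> times the
        determinant of the block.\<close>
      have "0 \<le> \<tau> * (\<zeta> j 0 z)\<^sup>2 + 2 * \<zeta> j 0 z * \<zeta> j 0 z * - \<tau> + \<omega> j z * (- \<tau>)\<^sup>2" by (rule form[OF j])
      also have "\<dots> = \<tau> * (\<tau> * \<omega> j z - (\<zeta> j 0 z)\<^sup>2)" by (simp add: power2_eq_square algebra_simps)
      finally show ?thesis using \<tau> False by (simp add: zero_le_mult_iff)
    qed
    then have "(\<Sum>j<m. (\<zeta> j 0 z)\<^sup>2) \<le> (\<Sum>j<m. \<tau> * \<omega> j z)" by (intro sum_mono) simp
    also have "\<dots> = \<tau>\<^sup>2" unfolding sum_distrib_left[symmetric] \<tau>_sum[symmetric] by (simp add: power2_eq_square)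
    finally have "L2_set (\<lambda>j. \<zeta> j 0 z) {..<m} \<le> \<tau>"
      unfolding L2_set_def using \<tau> by (intro real_le_lsqrt) (auto simp: sum_nonneg)
    then show ?thesis using space \<tau> SOC by (simp add: \<tau>_def)
  qed
qed

section \<open>Conic duality\<close>

text \<open>Bartl's induction: project along a direction \<open>u\<close> that violates the conclusion and hence
  satisfies all constraints but the new one.\<close>

lemma farkas:
  fixes a :: "'i \<Rightarrow> 'j \<Rightarrow> real"
  assumes "finite I" "finite J"
    and "\<And>x. (\<forall>i\<in>I. 0 \<le> (\<Sum>j\<in>J. a i j * x j)) \<Longrightarrow> 0 \<le> (\<Sum>j\<in>J. b j * x j)"
  shows "\<exists>y. (\<forall>i\<in>I. 0 \<le> y i) \<and> (\<forall>j\<in>J. b j = (\<Sum>i\<in>I. y i * a i j))"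
  using assms(1,3)
proof (induction I arbitrary: a b rule: finite_induct)
  case empty
  have "0 \<le> (\<Sum>j\<in>J. b j * - b j)" using empty[of "\<lambda>j. - b j"] by simp
  moreover have "(\<Sum>j\<in>J. b j * b j) \<ge> 0" by (simp add: sum_nonneg)
  ultimately have "(\<Sum>j\<in>J. b j * b j) = 0" by (simp add: sum_negf)
  then have "\<forall>j\<in>J. b j = 0" using assms(2) by (simp add: sum_nonneg_eq_0_iff)
  then show ?case by auto
next
  case (insert p I)
  show ?case
  proof (cases "\<forall>x. (\<forall>i\<in>I. 0 \<le> (\<Sum>j\<in>J. a i j * x j)) \<longrightarrow> 0 \<le> (\<Sum>j\<in>J. b j * x j)")
    case True
    then obtain y where y: "\<forall>i\<in>I. 0 \<le> y i" "\<forall>j\<in>J. b j = (\<Sum>i\<in>I. y i * a i j)"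
      using insert.IH[of a b] by blast
    have "(\<Sum>i\<in>I. (y(p := 0)) i * a i j) = (\<Sum>i\<in>I. y i * a i j)" for j
      using insert.hyps by (intro sum.cong) auto
    then show ?thesis using y insert.hyps by (intro exI[of _ "y(p := 0)"]) auto
  next
    case False
    then obtain u where u: "\<And>i. i \<in> I \<Longrightarrow> 0 \<le> (\<Sum>j\<in>J. a i j * u j)" "(\<Sum>j\<in>J. b j * u j) < 0"
      by (auto simp: not_le)
    define P where "P c = (\<Sum>j\<in>J. c j * u j)" for c
    define t where "t = - P (a p)"
    have t: "t > 0"
    proof (rule ccontr)
      assume "\<not> t > 0"
      then have "\<forall>i\<in>insert p I. 0 \<le> (\<Sum>j\<in>J. a i j * u j)" using u(1) by (auto simp: t_def P_def)
      then show False using insert.prems[of u] u(2) by simp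
    qed
    \<comment> \<open>On the right, \<open>x\<close> is projected along \<open>u\<close> onto the
      hyperplane where \<open>a p\<close> vanishes; on the left is the adjoint effect on a
      functional \<open>c\<close>. The new constraint thus becomes an equality and drops out of the
      reduced system.\<close>
    have proj: "(\<Sum>j\<in>J. (c j + P c / t * a p j) * x j)
        = (\<Sum>j\<in>J. c j * (x j + (\<Sum>k\<in>J. a p k * x k) / t * u j))" for c x
    proof -
      have "(\<Sum>j\<in>J. (c j + P c / t * a p j) * x j) = (\<Sum>j\<in>J. c j * x j) + P c / t * (\<Sum>k\<in>J. a p k * x k)"
        by (simp add: algebra_simps sum.distrib sum_distrib_left)
      also have "P c / t * (\<Sum>k\<in>J. a p k * x k) = (\<Sum>j\<in>J. c j * ((\<Sum>k\<in>J. a p k * x k) / t * u j))"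
        unfolding P_def by (simp add: sum_distrib_left sum_distrib_right sum_divide_distrib mult_ac)
      finally show ?thesis by (simp add: distrib_left sum.distrib)
    qed
    have "\<exists>y. (\<forall>i\<in>I. 0 \<le> y i) \<and>
        (\<forall>j\<in>J. b j + P b / t * a p j = (\<Sum>i\<in>I. y i * (a i j + P (a i) / t * a p j)))"
    proof (rule insert.IH)
      fix x assume x: "\<forall>i\<in>I. 0 \<le> (\<Sum>j\<in>J. (a i j + P (a i) / t * a p j) * x j)"
      define x' where "x' j = x j + (\<Sum>k\<in>J. a p k * x k) / t * u j" for j
      have "(\<Sum>j\<in>J. a p j * x' j) = (\<Sum>j\<in>J. (a p j + P (a p) / t * a p j) * x j)"
        unfolding proj x'_def ..
      also have "\<dots> = 0" using t by (simp add: t_def)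
      finally have "0 \<le> (\<Sum>j\<in>J. a p j * x' j)" by simp
      then have "\<forall>i\<in>insert p I. 0 \<le> (\<Sum>j\<in>J. a i j * x' j)"
        using x unfolding proj x'_def by blast
      from insert.prems[OF this] show "0 \<le> (\<Sum>j\<in>J. (b j + P b / t * a p j) * x j)"
        unfolding proj x'_def .
    qed
    then obtain y where y: "\<And>i. i \<in> I \<Longrightarrow> 0 \<le> y i"
      "\<And>j. j \<in> J \<Longrightarrow> b j + P b / t * a p j = (\<Sum>i\<in>I. y i * (a i j + P (a i) / t * a p j))"
      by blast
    \<comment> \<open>The total coefficient of \<open>a p\<close> after undoing the projection. It
      is nonnegative because \<open>u\<close> satisfies the old constraints and P b < 0.\<close>
    define r where "r = ((\<Sum>i\<in>I. y i * P (a i)) - P b) / t"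
    have "0 \<le> (\<Sum>i\<in>I. y i * P (a i))"
      using y(1) u(1) by (intro sum_nonneg mult_nonneg_nonneg) (auto simp: P_def)
    moreover have "P b < 0" using u(2) by (simp add: P_def)
    ultimately have r: "0 \<le> r" using t by (simp add: r_def)
    have "b j = (\<Sum>i\<in>insert p I. (y(p := r)) i * a i j)" if "j \<in> J" for j
    proof -
      have "(\<Sum>i\<in>I. (y(p := r)) i * a i j) = (\<Sum>i\<in>I. y i * a i j)"
        using insert.hyps by (intro sum.cong) auto
      moreover have "(\<Sum>i\<in>I. y i * (a i j + P (a i) / t * a p j))
          = (\<Sum>i\<in>I. y i * a i j) + (\<Sum>i\<in>I. y i * P (a i)) / t * a p j"
        by (simp add: distrib_left sum.distrib sum_distrib_right sum_divide_distrib mult.assoc)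
      ultimately show ?thesis using y(2)[OF that] insert.hyps
        by (simp add: r_def diff_divide_distrib left_diff_distrib)
    qed
    moreover have "\<forall>i\<in>insert p I. 0 \<le> (y(p := r)) i" using y(1) r by auto
    ultimately show ?thesis by blast
  qed
qed

text \<open>The separating functional is the limit of \<open>c\<^sub>n - y\<close> along a sequence of points of the cone
  minimising the distance to \<open>y\<close>; by the parallelogram law such a sequence is Cauchy.\<close>

lemma separation_from_convex_cone:
  fixes C :: "('i \<Rightarrow> real) set"
  assumes J: "finite J"
    and zero: "(\<lambda>_. 0) \<in> C"
    and add: "\<And>a b. a \<in> C \<Longrightarrow> b \<in> C \<Longrightarrow> (\<lambda>i. a i + b i) \<in> C"
    and scale: "\<And>a t. a \<in> C \<Longrightarrow> 0 \<le> t \<Longrightarrow> (\<lambda>i. t * a i) \<in> C"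
    and \<epsilon>: "0 < \<epsilon>" "\<And>c. c \<in> C \<Longrightarrow> \<epsilon> \<le> (\<Sum>i\<in>J. (c i - y i)\<^sup>2)"
  shows "\<exists>\<zeta>. (\<forall>c\<in>C. 0 \<le> (\<Sum>i\<in>J. \<zeta> i * c i)) \<and> (\<Sum>i\<in>J. \<zeta> i * y i) < 0"
proof -
  define D where "D c = (\<Sum>i\<in>J. (c i - y i)\<^sup>2)" for c
  define d where "d = Inf (D ` C)"
  have bdd: "bdd_below (D ` C)" using \<epsilon>(2) unfolding D_def by (intro bdd_belowI[of _ \<epsilon>]) auto
  have d_le: "d \<le> D c" if "c \<in> C" for c
    unfolding d_def using that by (intro cInf_lower[OF _ bdd]) auto
  have "\<epsilon> \<le> d" unfolding d_def using zero \<epsilon>(2) unfolding D_def by (intro cInf_greatest) auto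
  then have d: "0 < d" using \<epsilon>(1) by simp
  have "\<exists>c\<in>C. D c < d + 1 / Suc n" for n
  proof -
    have "Inf (D ` C) < d + 1 / Suc n" by (simp add: d_def)
    then show ?thesis using cInf_less_iff[OF _ bdd] zero by blast
  qed
  then obtain c where c: "\<And>n. c n \<in> C" "\<And>n. D (c n) < d + 1 / Suc n" by metis
  have close: "(\<Sum>i\<in>J. (c m i - c n i)\<^sup>2) \<le> 2 / Suc m + 2 / Suc n" for m n
  proof -
    have "(\<lambda>i. 1/2 * (c m i + c n i)) \<in> C" using c(1) by (intro scale add) auto
    from d_le[OF this] have "4 * d \<le> (\<Sum>i\<in>J. 4 * (1/2 * (c m i + c n i) - y i)\<^sup>2)"
      unfolding D_def by (simp flip: sum_distrib_left)
    moreover have "(\<Sum>i\<in>J. (c m i - c n i)\<^sup>2)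
        = 2 * D (c m) + 2 * D (c n) - (\<Sum>i\<in>J. 4 * (1/2 * (c m i + c n i) - y i)\<^sup>2)"
      unfolding D_def sum_distrib_left sum.distrib[symmetric] sum_subtractf[symmetric]
      by (rule sum.cong) (auto simp: power2_eq_square field_simps)
    moreover have "2 / Suc k = 2 * (1 / Suc k)" for k by simp
    ultimately show ?thesis using c(2)[of m] c(2)[of n] by linarith
  qed
  have "convergent (\<lambda>n. c n i)" if i: "i \<in> J" for i
  proof -
    have "Cauchy (\<lambda>n. c n i)"
    proof (rule CauchyI')
      fix e :: real assume e: "0 < e"
      obtain M where M: "4 / e\<^sup>2 < real M" using reals_Archimedean2 by blast
      have "dist (c m i) (c n i) < e" if mn: "m \<ge> M" "n > m" for m n
      proof -
        have "(c m i - c n i)\<^sup>2 \<le> (\<Sum>i\<in>J. (c m i - c n i)\<^sup>2)"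
          by (rule member_le_sum[OF i _ J]) auto
        also have "\<dots> \<le> 2 / Suc m + 2 / Suc n" by (rule close)
        also have "\<dots> \<le> 2 / Suc M + 2 / Suc M"
          using mn by (intro add_mono divide_left_mono) auto
        also have "\<dots> = 4 / Suc M" by simp
        also have "\<dots> < e\<^sup>2" using M e by (simp add: field_simps add_strict_increasing)
        finally have "\<bar>c m i - c n i\<bar>\<^sup>2 < e\<^sup>2" by simp
        then show ?thesis using e power2_less_imp_less[of "\<bar>c m i - c n i\<bar>" e] by (simp add: dist_real_def)
      qed
      then show "\<exists>M. \<forall>m\<ge>M. \<forall>n>m. dist (c m i) (c n i) < e" by blast
    qed
    then show ?thesis by (simp add: Cauchy_convergent_iff)
  qed
  then have "\<forall>i\<in>J. \<exists>l. (\<lambda>n. c n i) \<longlonglongrightarrow> l" by (auto simp: convergent_def)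
  then obtain l where l: "\<And>i. i \<in> J \<Longrightarrow> (\<lambda>n. c n i) \<longlonglongrightarrow> l i" by metis
  define \<zeta> where "\<zeta> i = l i - y i" for i
  have norm_\<zeta>: "(\<Sum>i\<in>J. (\<zeta> i)\<^sup>2) \<le> d"
  proof (rule LIMSEQ_le)
    show "(\<lambda>n. D (c n)) \<longlonglongrightarrow> (\<Sum>i\<in>J. (\<zeta> i)\<^sup>2)"
      unfolding D_def \<zeta>_def by (intro tendsto_intros l)
    show "(\<lambda>n. d + 1 / Suc n) \<longlonglongrightarrow> d"
      using tendsto_add[OF tendsto_const LIMSEQ_Suc[OF lim_1_over_n], of d] by simp
    show "\<exists>N. \<forall>n\<ge>N. D (c n) \<le> d + 1 / Suc n" using c(2) by (meson less_imp_le)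
  qed
  \<comment> \<open>The limit \<open>l\<close> need not lie in \<open>C\<close>, which is not
    assumed closed. Its optimality is inherited from the combinations of \<open>c n\<close> and
    \<open>a\<close>, which do lie in \<open>C\<close>.\<close>
  have far: "d \<le> (\<Sum>i\<in>J. (s * l i + t * a i - y i)\<^sup>2)" if "a \<in> C" "0 \<le> s" "0 \<le> t" for a s t
  proof (rule LIMSEQ_le_const)
    show "(\<lambda>n. D (\<lambda>i. s * c n i + t * a i)) \<longlonglongrightarrow> (\<Sum>i\<in>J. (s * l i + t * a i - y i)\<^sup>2)"
      unfolding D_def by (intro tendsto_intros l)
    show "\<exists>N. \<forall>n\<ge>N. d \<le> D (\<lambda>i. s * c n i + t * a i)"
      using that c(1) by (intro exI allI impI d_le add scale) auto
  qed
  have first_order: "0 \<le> p" if "\<And>t. 0 < t \<Longrightarrow> t \<le> 1 \<Longrightarrow> d \<le> d + 2 * t * p + t\<^sup>2 * r" for p r :: real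
  proof (rule ccontr)
    assume p: "\<not> 0 \<le> p"
    \<comment> \<open>Small enough for the linear term to dominate: t |r| \<le> -p, so 2p + t r <
      0.\<close>
    define t where "t = min 1 (- p / (\<bar>r\<bar> + 1))"
    have t: "0 < t" "t \<le> 1" "t \<le> - p / (\<bar>r\<bar> + 1)" using p by (auto simp: t_def divide_neg_pos)
    then have "t * (2 * p + t * r) \<ge> 0" using that[of t] by (simp add: power2_eq_square algebra_simps)
    then have "2 * p + t * r \<ge> 0" using t by (simp add: zero_le_mult_iff)
    moreover have "t * r \<le> t * (\<bar>r\<bar> + 1)" using t by (intro mult_left_mono) auto
    moreover have "t * (\<bar>r\<bar> + 1) \<le> - p" using t(3) by (simp add: field_simps)
    ultimately show False using p by linarith
  qed
  have expand: "(\<Sum>i\<in>J. (\<zeta> i + t * a i)\<^sup>2) \<le> d + 2 * t * (\<Sum>i\<in>J. \<zeta> i * a i) + t\<^sup>2 * (\<Sum>i\<in>J. (a i)\<^sup>2)" for t a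
  proof -
    have "(\<Sum>i\<in>J. (\<zeta> i + t * a i)\<^sup>2)
        = (\<Sum>i\<in>J. (\<zeta> i)\<^sup>2) + 2 * t * (\<Sum>i\<in>J. \<zeta> i * a i) + t\<^sup>2 * (\<Sum>i\<in>J. (a i)\<^sup>2)"
      by (simp add: power2_eq_square algebra_simps sum.distrib sum_distrib_left)
    then show ?thesis using norm_\<zeta> by simp
  qed
  have "0 \<le> (\<Sum>i\<in>J. \<zeta> i * a i)" if a: "a \<in> C" for a
  proof (rule first_order)
    fix t :: real assume "0 < t" "t \<le> 1"
    then have "d \<le> (\<Sum>i\<in>J. (1 * l i + t * a i - y i)\<^sup>2)" using a by (intro far) auto
    then show "d \<le> d + 2 * t * (\<Sum>i\<in>J. \<zeta> i * a i) + t\<^sup>2 * (\<Sum>i\<in>J. (a i)\<^sup>2)"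
      using expand[of t a] by (simp add: \<zeta>_def algebra_simps)
  qed
  moreover have "0 \<le> (\<Sum>i\<in>J. \<zeta> i * - l i)"
  proof (rule first_order)
    fix t :: real assume "0 < t" "t \<le> 1"
    \<comment> \<open>Shrinking the limit point is the variation in the direction of its negative;
      it shows that \<open>\<zeta>\<close> is nonpositive on \<open>l\<close>, and then its value at
      \<open>y\<close> is at most -d.\<close>
    then have "d \<le> (\<Sum>i\<in>J. ((1 - t) * l i + 0 * 0 - y i)\<^sup>2)" using zero by (intro far) auto
    then show "d \<le> d + 2 * t * (\<Sum>i\<in>J. \<zeta> i * - l i) + t\<^sup>2 * (\<Sum>i\<in>J. (- l i)\<^sup>2)"
      using expand[of t "\<lambda>i. - l i"] by (simp add: \<zeta>_def algebra_simps)
  qed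
  moreover have "(\<Sum>i\<in>J. \<zeta> i * y i) = - (\<Sum>i\<in>J. \<zeta> i * - l i) - (\<Sum>i\<in>J. (\<zeta> i)\<^sup>2)"
    unfolding sum_negf[symmetric] sum_subtractf[symmetric]
    by (rule sum.cong) (auto simp: \<zeta>_def power2_eq_square algebra_simps)
  moreover have "d \<le> (\<Sum>i\<in>J. (\<zeta> i)\<^sup>2)"
    using far[OF zero, of 1 0] by (simp add: \<zeta>_def)
  ultimately show ?thesis using d by (intro exI[of _ \<zeta>]) auto
qed

text \<open>Weak duality makes such a \<open>\<zeta>\<close> certify that \<open>\<Sum>l. w\<^sub>l * b l + c \<le> 0\<close> on the conic set.\<close>

definition dual_certificate ::
  "('s::finite \<Rightarrow> cone_kind) \<Rightarrow> ('s \<Rightarrow> nat) \<Rightarrow> ('s \<Rightarrow> 'l::finite \<Rightarrow> rmat) \<Rightarrow>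
   ('s \<Rightarrow> nat \<Rightarrow> rmat) \<Rightarrow> ('s \<Rightarrow> rmat) \<Rightarrow> ('l \<Rightarrow> real) \<Rightarrow> real \<Rightarrow> ('s \<Rightarrow> rmat) \<Rightarrow> bool" where
  "dual_certificate K q A G e b c \<zeta> \<longleftrightarrow>
     (\<forall>s. \<zeta> s \<in> cone_set (K s)) \<and>
     (\<forall>s. \<forall>k<q s. cone_inner (K s) (G s k) (\<zeta> s) = 0) \<and>
     (\<forall>l. (\<Sum>s\<in>UNIV. cone_inner (K s) (A s l) (\<zeta> s)) + b l = 0) \<and>
     c + (\<Sum>s\<in>UNIV. cone_inner (K s) (e s) (\<zeta> s)) \<le> 0"

text \<open>Only the joint functional on the product is known to be nonnegative. Testing it on
  tuples with a single nonzero component, together with self-duality, places the representative of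
  each component in its own cone.\<close>

lemma dual_certificateI:
  assumes data: "conic_data K q A G e"
    and pos: "\<And>k. (\<And>s. k s \<in> cone_set (K s)) \<Longrightarrow> 0 \<le> (\<Sum>s\<in>UNIV. cone_inner (K s) (k s) (\<zeta> s))"
    and G0: "\<And>s k. k < q s \<Longrightarrow> cone_inner (K s) (G s k) (\<zeta> s) = 0"
    and Ab: "\<And>l. (\<Sum>s\<in>UNIV. cone_inner (K s) (A s l) (\<zeta> s)) + b l = 0"
    and ec: "c + (\<Sum>s\<in>UNIV. cone_inner (K s) (e s) (\<zeta> s)) \<le> 0"
  shows "\<exists>z. dual_certificate K q A G e b c z"
proof -
  have "\<forall>s. \<exists>z. z \<in> cone_space (K s) \<and> (\<forall>y\<in>cone_space (K s). cone_inner (K s) y z = cone_inner (K s) y (\<zeta> s))"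
    using cone_space_representative by blast
  then obtain z where z: "\<And>s. z s \<in> cone_space (K s)"
    "\<And>s y. y \<in> cone_space (K s) \<Longrightarrow> cone_inner (K s) y (z s) = cone_inner (K s) y (\<zeta> s)"
    by metis
  have "z s \<in> cone_set (K s)" for s
  proof (rule cone_set_self_dual[OF z(1)])
    fix y assume y: "y \<in> cone_set (K s)"
    have "(\<Sum>r\<in>UNIV. cone_inner (K r) (if r = s then y else (\<lambda>_ _. 0)) (\<zeta> r))
        = (\<Sum>r\<in>UNIV. if r = s then cone_inner (K s) y (\<zeta> s) else 0)"
      by (rule sum.cong) (auto simp: cone_inner_def)
    moreover have "0 \<le> (\<Sum>r\<in>UNIV. cone_inner (K r) (if r = s then y else (\<lambda>_ _. 0)) (\<zeta> r))"
      by (rule pos) (auto simp: y cone_set_zero)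
    ultimately have "0 \<le> cone_inner (K s) y (\<zeta> s)" by simp
    also have "\<dots> = cone_inner (K s) (z s) y"
      using z(2)[OF cone_set_subset[OF y]] by (simp add: cone_inner_commute)
    finally show "0 \<le> cone_inner (K s) (z s) y" .
  qed
  moreover have "\<And>s l. A s l \<in> cone_space (K s)" "\<And>s k. k < q s \<Longrightarrow> G s k \<in> cone_space (K s)"
    "\<And>s. e s \<in> cone_space (K s)"
    using data unfolding conic_data_def by auto
  ultimately show ?thesis
    unfolding dual_certificate_def using G0 Ab ec by (intro exI[of _ z]) (simp add: z(2))
qed

text \<open>Scaling the constant term by \<open>\<tau>\<close> makes the image linear in
  \<open>\<tau>\<close>, \<open>w\<close> and \<open>\<mu>\<close>. Feasible triples with \<tau> > 0
  are rescaled points of the conic set; those with \<tau> = 0 are recession directions.\<close>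

definition homogeneous_image ::
  "nat \<Rightarrow> ('l::finite \<Rightarrow> rmat) \<Rightarrow> (nat \<Rightarrow> rmat) \<Rightarrow> rmat \<Rightarrow> real \<Rightarrow> real ^ 'l \<Rightarrow> (nat \<Rightarrow> real) \<Rightarrow> rmat" where
  "homogeneous_image q A G e \<tau> w \<mu> = affine_image q A G (\<lambda>i j. \<tau> * e i j) w \<mu>"

lemma homogeneous_image_1: "homogeneous_image q A G e 1 w \<mu> = affine_image q A G e w \<mu>"
  by (simp add: homogeneous_image_def)

lemma homogeneous_image_scale:
  "homogeneous_image q A G e (t * \<tau>) (t *\<^sub>R w) (\<lambda>k. t * \<mu> k) i j = t * homogeneous_image q A G e \<tau> w \<mu> i j"
  by (simp add: homogeneous_image_def affine_image_def sum_distrib_left algebra_simps)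

lemma homogeneous_image_add:
  "homogeneous_image q A G e (\<tau> + \<tau>') (w + w') (\<lambda>k. \<mu> k + \<mu>' k) i j
    = homogeneous_image q A G e \<tau> w \<mu> i j + homogeneous_image q A G e \<tau>' w' \<mu>' i j"
  by (simp add: homogeneous_image_def affine_image_def sum.distrib algebra_simps)

lemma homogeneous_image_inner:
  "cone_inner k (homogeneous_image q A G e \<tau> w \<mu>) y
    = (\<Sum>l\<in>UNIV. w $ l * cone_inner k (A l) y) + (\<Sum>i<q. \<mu> i * cone_inner k (G i) y) + \<tau> * cone_inner k e y"
  unfolding cone_inner_commute[of k _ y] homogeneous_image_def
  by (simp add: cone_inner_affine_image cone_inner_scale)

lemma homogeneous_image_in_cone_space:
  assumes "conic_data K q A G e"
  shows "homogeneous_image (q s) (A s) (G s) (e s) \<tau> w \<mu> \<in> cone_space (K s)"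
  using assms unfolding conic_data_def homogeneous_image_def
  by (intro affine_image_in_cone_space cone_space_scale) auto

lemma homogenized_bound:
  assumes bound: "\<And>w. w \<in> conic_set K q A G e \<Longrightarrow> (\<Sum>l\<in>UNIV. w $ l * b l) + c \<le> 0"
    and mem: "\<And>s. homogeneous_image (q s) (A s) (G s) (e s) \<tau> w (\<mu> s) \<in> cone_set (K s)"
    and \<tau>: "0 < \<tau>"
  shows "(\<Sum>l\<in>UNIV. w $ l * b l) + \<tau> * c \<le> 0"
proof -
  define t where "t = 1 / \<tau>"
  have t: "0 < t" "t * \<tau> = 1" using \<tau> by (auto simp: t_def)
  have mem': "t *\<^sub>R w \<in> conic_set K q A G e"
    unfolding conic_set_def mem_Collect_eq
  proof (intro allI exI)
    fix s
    have "affine_image (q s) (A s) (G s) (e s) (t *\<^sub>R w) (\<lambda>k. t * \<mu> s k)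
        = (\<lambda>i j. t * homogeneous_image (q s) (A s) (G s) (e s) \<tau> w (\<mu> s) i j)"
      by (intro ext) (simp add: homogeneous_image_1[symmetric] t(2)[symmetric] homogeneous_image_scale)
    then show "affine_image (q s) (A s) (G s) (e s) (t *\<^sub>R w) (\<lambda>k. t * \<mu> s k) \<in> cone_set (K s)"
      using cone_set_scale[OF mem] t(1) by simp
  qed
  have tc: "t * (\<tau> * c) = c" using t(2) by (simp add: mult.assoc[symmetric])
  have "t * (\<Sum>l\<in>UNIV. w $ l * b l) + t * (\<tau> * c) \<le> 0"
    using bound[OF mem'] unfolding tc by (simp add: sum_distrib_left mult.assoc)
  then have "t * ((\<Sum>l\<in>UNIV. w $ l * b l) + \<tau> * c) \<le> 0"
    by (simp add: distrib_left)
  then show ?thesis using t(1) by (simp add: mult_le_0_iff)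
qed

text \<open>\<open>C\<close> collects the pairs of negated objective and constraint residual. If the
  point \<open>y\<close>, with objective entry -1 and residual 0, were nearly in \<open>C\<close>, a
  nearly feasible triple would have objective at least 1/2; adding a small multiple of the Slater
  point would make it feasible with a positive objective, against \<open>homogenized_bound\<close>.
  So \<open>y\<close> has positive distance from \<open>C\<close> and can be separated.\<close>

lemma conic_duality_slater:
  fixes K :: "'s::finite \<Rightarrow> cone_kind" and A :: "'s \<Rightarrow> 'l::finite \<Rightarrow> rmat"
  assumes data: "conic_data K q A G e"
    and slater: "slater K q A G e"
    and bound: "\<And>w. w \<in> conic_set K q A G e \<Longrightarrow> (\<Sum>l\<in>UNIV. w $ l * b l) + c \<le> 0"
  shows "\<exists>\<zeta>. dual_certificate K q A G e b c \<zeta>"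
proof -
  let ?h = "\<lambda>s. homogeneous_image (q s) (A s) (G s) (e s)"
  obtain w0 \<mu>0 where w0: "\<And>s. ?h s 1 w0 (\<mu>0 s) \<in> cone_interior (K s)"
    using slater unfolding slater_def homogeneous_image_1 by blast
  define J' where "J' = (SIGMA s:UNIV. {..<cone_rows (K s)} \<times> {..<cone_cols (K s)})"
  define J where "J = insert None (Some ` J')"
  have finJ: "finite J" unfolding J_def J'_def by simp
  have sumJ: "(\<Sum>x\<in>J. F x) = F None + (\<Sum>s\<in>UNIV. \<Sum>i<cone_rows (K s). \<Sum>j<cone_cols (K s). F (Some (s, i, j)))"
    for F :: "('s \<times> nat \<times> nat) option \<Rightarrow> real"
  proof -
    have "(\<Sum>x\<in>J. F x) = F None + (\<Sum>x\<in>J'. F (Some x))"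
      unfolding J_def J'_def by (subst sum.insert) (auto simp: sum.reindex)
    also have "(\<Sum>x\<in>J'. F (Some x)) = (\<Sum>s\<in>UNIV. \<Sum>p\<in>{..<cone_rows (K s)} \<times> {..<cone_cols (K s)}. F (Some (s, p)))"
      unfolding J'_def by (simp add: sum.Sigma)
    finally show ?thesis by (simp add: sum.cartesian_product)
  qed
  define val where "val w \<tau> = (\<Sum>l\<in>UNIV. w $ l * b l) + \<tau> * c" for w \<tau>
  define P where "P k w \<mu> \<tau> = (\<lambda>x. case x of None \<Rightarrow> - val w \<tau> |
      Some (s, i, j) \<Rightarrow> k s i j - ?h s \<tau> w (\<mu> s) i j)" for k w \<mu> \<tau>
  define C where "C = {P k w \<mu> \<tau> | k w \<mu> \<tau>. (\<forall>s. k s \<in> cone_set (K s)) \<and> 0 \<le> \<tau>}"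
  have CI: "P k w \<mu> \<tau> \<in> C" if "\<And>s. k s \<in> cone_set (K s)" "0 \<le> \<tau>" for k w \<mu> \<tau>
    unfolding C_def using that by blast
  define y where "y = (\<lambda>x::('s \<times> nat \<times> nat) option. if x = None then - 1 else 0 :: real)"
  obtain \<delta> where \<delta>: "0 < \<delta>" "\<And>s \<eta>. \<eta> \<in> cone_space (K s) \<Longrightarrow> (\<And>i j. \<bar>\<eta> i j\<bar> \<le> \<delta>) \<Longrightarrow>
      (\<lambda>i j. ?h s 1 w0 (\<mu>0 s) i j + \<eta> i j) \<in> cone_set (K s)"
  proof -
    have "\<forall>s. \<exists>\<delta>>0. \<forall>\<eta>\<in>cone_space (K s). (\<forall>i j. \<bar>\<eta> i j\<bar> \<le> \<delta>) \<longrightarrow>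
        (\<lambda>i j. ?h s 1 w0 (\<mu>0 s) i j + \<eta> i j) \<in> cone_set (K s)"
      using cone_interior_margin[OF w0] by blast
    then obtain D where D: "\<And>s. 0 < D s" "\<And>s \<eta>. \<eta> \<in> cone_space (K s) \<Longrightarrow> \<forall>i j. \<bar>\<eta> i j\<bar> \<le> D s \<Longrightarrow>
        (\<lambda>i j. ?h s 1 w0 (\<mu>0 s) i j + \<eta> i j) \<in> cone_set (K s)"
      by metis
    have "0 < Min (range D)" "Min (range D) \<le> D s" for s using D(1) by auto
    then show ?thesis using D(2) by (intro that[of "Min (range D)"]) (meson order_trans)+
  qed
  define m where "m = \<bar>val w0 1\<bar> + 1"
  \<comment> \<open>Adding \<theta> times the Slater point changes the objective by less than
    1/2.\<close>
  define \<theta> where "\<theta> = 1 / (2 * m)"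
  have \<theta>: "0 < \<theta>" "\<theta> * \<bar>val w0 1\<bar> < 1 / 2"
    by (auto simp: \<theta>_def m_def field_simps)
  \<comment> \<open>The bound 1/2 keeps the objective at least 1/2; the bound \<theta> \<delta> lets
    the residual, divided by \<theta>, fit into the Slater margin.\<close>
  define \<epsilon> where "\<epsilon> = min (1 / 2) (\<theta> * \<delta>)"
  have \<epsilon>: "0 < \<epsilon>" "\<epsilon> \<le> 1 / 2" "\<epsilon> \<le> \<theta> * \<delta>" using \<theta> \<delta>(1) by (auto simp: \<epsilon>_def)
  have dist: "\<epsilon>\<^sup>2 \<le> (\<Sum>x\<in>J. (a x - y x)\<^sup>2)" if mem: "a \<in> C" for a
  proof (rule ccontr)
    assume less: "\<not> ?thesis"
    obtain k w \<mu> \<tau> where a: "a = P k w \<mu> \<tau>" "\<And>s. k s \<in> cone_set (K s)" "0 \<le> \<tau>"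
      using mem unfolding C_def by blast
    have small: "\<bar>a x - y x\<bar> \<le> \<epsilon>" if "x \<in> J" for x
    proof -
      have "\<bar>a x - y x\<bar>\<^sup>2 \<le> (\<Sum>x\<in>J. (a x - y x)\<^sup>2)"
        unfolding power2_abs by (rule member_le_sum[OF that _ finJ]) auto
      also have "\<dots> \<le> \<epsilon>\<^sup>2" using less by (rule less_imp_le[OF not_le_imp_less])
      finally show ?thesis by (rule power2_le_imp_le) (use \<epsilon>(1) in simp)
    qed
    have "\<bar>- val w \<tau> + 1\<bar> \<le> \<epsilon>"
      using small[of None] by (simp add: a(1) P_def y_def J_def)
    then have val: "1 / 2 \<le> val w \<tau>" using \<epsilon>(2) by linarith
    define \<eta> where "\<eta> s i j = k s i j - ?h s \<tau> w (\<mu> s) i j" for s i j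
    have \<eta>_space: "(\<lambda>i j. - (1 / \<theta>) * \<eta> s i j) \<in> cone_space (K s)" for s
    proof -
      have "(\<lambda>i j. k s i j + (- 1) * ?h s \<tau> w (\<mu> s) i j) \<in> cone_space (K s)"
        using homogeneous_image_in_cone_space[OF data] cone_set_subset[OF a(2)]
        by (intro cone_space_add cone_space_scale) auto
      then have "\<eta> s \<in> cone_space (K s)" by (simp add: \<eta>_def[abs_def])
      then show ?thesis by (rule cone_space_scale)
    qed
    have \<eta>_small: "\<bar>- (1 / \<theta>) * \<eta> s i j\<bar> \<le> \<delta>" for s i j
    proof (cases "i < cone_rows (K s) \<and> j < cone_cols (K s)")
      case True
      then have "\<bar>\<eta> s i j\<bar> \<le> \<epsilon>"
        using small[of "Some (s, i, j)"] by (simp add: a(1) P_def y_def J_def J'_def \<eta>_def)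
      then have "\<bar>\<eta> s i j\<bar> \<le> \<theta> * \<delta>" using \<epsilon>(3) by linarith
      then show ?thesis using \<theta>(1) by (simp add: abs_mult field_simps)
    next
      case False
      then have "- (1 / \<theta>) * \<eta> s i j = 0" using \<eta>_space[of s] unfolding cone_space_def by blast
      then show ?thesis using \<delta>(1) by (simp only: abs_zero less_imp_le)
    qed
    have "?h s (\<tau> + \<theta> * 1) (w + \<theta> *\<^sub>R w0) (\<lambda>i. \<mu> s i + \<theta> * \<mu>0 s i) \<in> cone_set (K s)" for s
    proof -
      have "(\<lambda>i j. k s i j + \<theta> * (?h s 1 w0 (\<mu>0 s) i j + - (1 / \<theta>) * \<eta> s i j)) \<in> cone_set (K s)"
        using \<theta>(1) by (intro cone_set_add cone_set_scale a(2) \<delta>(2) \<eta>_space \<eta>_small) auto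
      moreover have "k s i j + \<theta> * (?h s 1 w0 (\<mu>0 s) i j + - (1 / \<theta>) * \<eta> s i j)
          = ?h s (\<tau> + \<theta> * 1) (w + \<theta> *\<^sub>R w0) (\<lambda>i. \<mu> s i + \<theta> * \<mu>0 s i) i j" for i j
        unfolding homogeneous_image_add homogeneous_image_scale
        using \<theta>(1) by (simp add: \<eta>_def field_simps)
      ultimately show ?thesis by simp
    qed
    from homogenized_bound[OF bound this] have "val (w + \<theta> *\<^sub>R w0) (\<tau> + \<theta> * 1) \<le> 0"
      using a(3) \<theta>(1) unfolding val_def by simp
    moreover have "val (w + \<theta> *\<^sub>R w0) (\<tau> + \<theta> * 1) = val w \<tau> + \<theta> * val w0 1"
      unfolding val_def by (simp add: sum.distrib sum_distrib_left algebra_simps)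
    moreover have "- (1 / 2) < \<theta> * val w0 1"
    proof -
      have "\<theta> * - \<bar>val w0 1\<bar> \<le> \<theta> * val w0 1" using \<theta>(1) by (intro mult_left_mono) auto
      then show ?thesis using \<theta>(2) by simp
    qed
    ultimately show False using val by linarith
  qed
  have "\<exists>\<zeta>. (\<forall>a\<in>C. 0 \<le> (\<Sum>x\<in>J. \<zeta> x * a x)) \<and> (\<Sum>x\<in>J. \<zeta> x * y x) < 0"
  proof (rule separation_from_convex_cone[OF finJ _ _ _ _ dist])
    have "(\<lambda>_. 0) = P (\<lambda>s _ _. 0) 0 (\<lambda>s _. 0) 0"
      by (auto simp: P_def val_def homogeneous_image_def affine_image_def fun_eq_iff split: option.split)
    also have "\<dots> \<in> C" by (intro CI cone_set_zero) simp
    finally show "(\<lambda>_. 0) \<in> C" .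
    show "0 < \<epsilon>\<^sup>2" using \<epsilon>(1) by simp
    fix a assume "a \<in> C"
    then obtain k w \<mu> \<tau> where a: "a = P k w \<mu> \<tau>" "\<And>s. k s \<in> cone_set (K s)" "0 \<le> \<tau>"
      unfolding C_def by blast
    show "(\<lambda>x. t * a x) \<in> C" if "0 \<le> t" for t
    proof -
      have "(\<lambda>x. t * a x) = P (\<lambda>s i j. t * k s i j) (t *\<^sub>R w) (\<lambda>s i. t * \<mu> s i) (t * \<tau>)"
        by (auto simp: a(1) P_def val_def homogeneous_image_scale fun_eq_iff distrib_left right_diff_distrib
            sum_distrib_left mult.assoc
            split: option.split)
      also have "\<dots> \<in> C" using a that by (intro CI cone_set_scale) auto
      finally show ?thesis .
    qed
    fix a' assume "a' \<in> C"
    then obtain k' w' \<mu>' \<tau>' where a': "a' = P k' w' \<mu>' \<tau>'" "\<And>s. k' s \<in> cone_set (K s)" "0 \<le> \<tau>'"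
      unfolding C_def by blast
    have "(\<lambda>x. a x + a' x) = P (\<lambda>s i j. k s i j + k' s i j) (w + w') (\<lambda>s i. \<mu> s i + \<mu>' s i) (\<tau> + \<tau>')"
      by (auto simp: a(1) a'(1) P_def val_def homogeneous_image_add fun_eq_iff distrib_right sum.distrib
          split: option.split)
    also have "\<dots> \<in> C" using a a' by (intro CI cone_set_add) auto
    finally show "(\<lambda>x. a x + a' x) \<in> C" .
  qed
  then obtain Z where Z: "\<And>a. a \<in> C \<Longrightarrow> 0 \<le> (\<Sum>x\<in>J. Z x * a x)" "(\<Sum>x\<in>J. Z x * y x) < 0"
    by blast
  define \<sigma> where "\<sigma> = Z None"
  \<comment> \<open>This is the strict part of the separation, as \<open>y\<close> is nonzero only
    at \<open>None\<close>. Dividing by \<sigma> normalises the weight of the objective to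
    1.\<close>
  have \<sigma>: "0 < \<sigma>"
    using Z(2) unfolding sumJ y_def \<sigma>_def by simp
  define \<zeta> where "\<zeta> s i j = Z (Some (s, i, j)) / \<sigma>" for s i j
  have main: "0 \<le> (\<Sum>s\<in>UNIV. cone_inner (K s) (k s) (\<zeta> s))
      - (\<Sum>s\<in>UNIV. cone_inner (K s) (?h s \<tau> w (\<mu> s)) (\<zeta> s)) - val w \<tau>"
    if k: "\<And>s. k s \<in> cone_set (K s)" and \<tau>: "0 \<le> \<tau>" for k w \<mu> \<tau>
  proof -
    from Z(1)[OF CI[OF k \<tau>]] have "0 \<le> - \<sigma> * val w \<tau>
        + (\<Sum>s\<in>UNIV. \<Sum>i<cone_rows (K s). \<Sum>j<cone_cols (K s). Z (Some (s, i, j)) * (k s i j - ?h s \<tau> w (\<mu> s) i j))"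
      unfolding sumJ P_def \<sigma>_def by simp
    also have "(\<Sum>s\<in>UNIV. \<Sum>i<cone_rows (K s). \<Sum>j<cone_cols (K s). Z (Some (s, i, j)) * (k s i j - ?h s \<tau> w (\<mu> s) i j))
        = \<sigma> * ((\<Sum>s\<in>UNIV. cone_inner (K s) (k s) (\<zeta> s)) - (\<Sum>s\<in>UNIV. cone_inner (K s) (?h s \<tau> w (\<mu> s)) (\<zeta> s)))"
      unfolding cone_inner_def sum_subtractf[symmetric] sum_distrib_left \<zeta>_def
      using \<sigma> by (intro sum.cong refl) (simp add: field_simps)
    finally have "0 \<le> \<sigma> * ((\<Sum>s\<in>UNIV. cone_inner (K s) (k s) (\<zeta> s))
      - (\<Sum>s\<in>UNIV. cone_inner (K s) (?h s \<tau> w (\<mu> s)) (\<zeta> s)) - val w \<tau>)"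
      by (simp add: algebra_simps)
    then show ?thesis using \<sigma> by (simp add: zero_le_mult_iff)
  qed
  have lin: "(\<Sum>s\<in>UNIV. cone_inner (K s) (?h s \<tau> w (\<mu> s)) (\<zeta> s)) + val w \<tau> \<le> 0" if "0 \<le> \<tau>" for w \<mu> \<tau>
    using main[where k = "\<lambda>s _ _. 0" and \<tau> = \<tau> and \<mu> = \<mu> and w = w, OF cone_set_zero that] by (simp add: cone_inner_def)
  show ?thesis
  proof (rule dual_certificateI[OF data, where \<zeta> = \<zeta>])
    show "0 \<le> (\<Sum>s\<in>UNIV. cone_inner (K s) (k s) (\<zeta> s))" if "\<And>s. k s \<in> cone_set (K s)" for k
      using main[where k = k and \<tau> = 0 and \<mu> = "\<lambda>_ _. 0" and w = 0, OF that] by (simp add: homogeneous_image_inner val_def)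
    show "c + (\<Sum>s\<in>UNIV. cone_inner (K s) (e s) (\<zeta> s)) \<le> 0"
      using lin[where \<tau> = 1 and \<mu> = "\<lambda>_ _. 0" and w = 0] by (simp add: homogeneous_image_inner val_def)
    show "(\<Sum>s\<in>UNIV. cone_inner (K s) (A s l) (\<zeta> s)) + b l = 0" for l
    proof -
      have *: "(\<Sum>k\<in>UNIV. axis l x $ k * f k) = x * f l" for x :: real and f :: "'l \<Rightarrow> real"
        by (simp add: axis_def if_distrib[of "\<lambda>x. x * _"] cong: if_cong)
      \<comment> \<open>At \<tau> = 0 the direction may be reversed, which turns the inequality into
        an equality.\<close>
      have "x * ((\<Sum>s\<in>UNIV. cone_inner (K s) (A s l) (\<zeta> s)) + b l) \<le> 0" for x
        using lin[where \<tau> = 0 and \<mu> = "\<lambda>_ _. 0" and w = "axis l x"]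
        by (simp add: homogeneous_image_inner val_def * distrib_left sum_distrib_left)
      from this[of 1] this[of "- 1"] show ?thesis by simp
    qed
    show "cone_inner (K s) (G s k) (\<zeta> s) = 0" if k: "k < q s" for s k
    proof -
      have "x * cone_inner (K s) (G s k) (\<zeta> s) \<le> 0" for x
      proof -
        have "(\<Sum>i<q r. (if r = s \<and> i = k then x else 0) * cone_inner (K r) (G r i) (\<zeta> r))
            = (if r = s then x * cone_inner (K s) (G s k) (\<zeta> s) else 0)" for r
          using k by (cases "r = s") (simp_all add: if_distrib[of "\<lambda>x. x * _"] cong: if_cong)
        then show ?thesis
          using lin[where \<tau> = 0 and \<mu> = "\<lambda>r i. if r = s \<and> i = k then x else 0" and w = 0]
          by (simp add: homogeneous_image_inner val_def)
      qed
      from this[of 1] this[of "- 1"] show ?thesis by simp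
    qed
  qed
qed

text \<open>On a cone the affine inequalities in \<open>H\<close> have nonnegative right sides, and
  scaling shows that the left sides are nonpositive on it; so the homogeneous system defines the
  same set. Farkas' lemma for the variables \<open>w\<close>, \<open>\<mu>\<close> and
  \<open>\<tau>\<close> then gives the multipliers.\<close>

lemma conic_duality_polyhedral:
  fixes K :: "'s::finite \<Rightarrow> cone_kind" and A :: "'s \<Rightarrow> 'l::finite \<Rightarrow> rmat"
  assumes data: "conic_data K q A G e"
    and poly: "polyhedral_product K"
    and ne: "conic_set K q A G e \<noteq> {}"
    and bound: "\<And>w. w \<in> conic_set K q A G e \<Longrightarrow> (\<Sum>l\<in>UNIV. w $ l * b l) + c \<le> 0"
  shows "\<exists>\<zeta>. dual_certificate K q A G e b c \<zeta>"
proof -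
  let ?h = "\<lambda>s. homogeneous_image (q s) (A s) (G s) (e s)"
  define L where "L a y = (\<Sum>s\<in>UNIV. cone_inner (K s) (a s) (y s))" for a y
  obtain H where finH: "finite H" and H: "\<And>y. (\<And>s. y s \<in> cone_space (K s)) \<Longrightarrow>
      (\<forall>s. y s \<in> cone_set (K s)) \<longleftrightarrow> (\<forall>(a, b)\<in>H. L a y \<le> b)"
    using poly unfolding polyhedral_product_def L_def by blast
  have rhs: "0 \<le> b" if "(a, b) \<in> H" for a b
  proof -
    have "L a (\<lambda>_ _ _. 0) \<le> b"
      using H[of "\<lambda>_ _ _. 0"] cone_space_zero cone_set_zero that by blast
    then show ?thesis by (simp add: L_def cone_inner_def)
  qed
  have neg: "L a y \<le> 0" if ab: "(a, b) \<in> H" and y: "\<And>s. y s \<in> cone_set (K s)" for a b y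
  proof (rule ccontr)
    assume pos: "\<not> L a y \<le> 0"
    \<comment> \<open>Scaled so that the left side becomes b + 1, violating the inequality.\<close>
    define t where "t = (b + 1) / L a y"
    have t: "0 \<le> t" "t * L a y = b + 1" using pos rhs[OF ab] by (auto simp: t_def)
    have mem: "(\<lambda>i j. t * y s i j) \<in> cone_set (K s)" for s using cone_set_scale[OF y t(1)] .
    then have "L a (\<lambda>s i j. t * y s i j) \<le> b"
      using H[of "\<lambda>s i j. t * y s i j"] cone_set_subset ab by blast
    also have "L a (\<lambda>s i j. t * y s i j) = t * L a y"
      unfolding L_def by (simp add: cone_inner_scale sum_distrib_left)
    finally show False using t(2) by simp
  qed
  \<comment> \<open>\<open>None\<close> stands for the constraint \<tau> \<ge> 0, the other indices
    for the inequalities in \<open>H\<close>. The summands of \<open>J\<close> below index the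
    variables \<open>w\<close>, \<open>\<mu>\<close> and \<open>\<tau>\<close>.\<close>
  define I where "I = insert None (Some ` fst ` H)"
  define J where "J = (UNIV :: 'l set) <+> ((SIGMA s:UNIV. {..<q s}) <+> (UNIV :: unit set))"
  define a where "a = (\<lambda>i. case i of
      None \<Rightarrow> (\<lambda>j. if j = Inr (Inr ()) then 1 else 0)
    | Some a \<Rightarrow> case_sum (\<lambda>l. - (\<Sum>s\<in>UNIV. cone_inner (K s) (a s) (A s l)))
        (case_sum (\<lambda>(s, k). - cone_inner (K s) (a s) (G s k))
          (\<lambda>_. - (\<Sum>s\<in>UNIV. cone_inner (K s) (a s) (e s)))))"
  define d where "d = case_sum (\<lambda>l. - b l) (case_sum (\<lambda>(s :: 's, k :: nat). 0) (\<lambda>_ :: unit. - c))"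
  have finI: "finite I" and finJ: "finite J" using finH by (auto simp: I_def J_def)
  have sumJ: "(\<Sum>j\<in>J. F j) = (\<Sum>l\<in>UNIV. F (Inl l)) + (\<Sum>s\<in>UNIV. \<Sum>k<q s. F (Inr (Inl (s, k)))) + F (Inr (Inr ()))"
    for F :: "'l + ('s \<times> nat) + unit \<Rightarrow> real"
  proof -
    have "(\<Sum>p\<in>(SIGMA s:UNIV. {..<q s}). F (Inr (Inl p))) = (\<Sum>s\<in>UNIV. \<Sum>k<q s. F (Inr (Inl (s, k))))"
      by (simp add: sum.Sigma split_def)
    then show ?thesis
      unfolding J_def by (simp add: sum.Plus comp_def UNIV_unit)
  qed
  define val where "val w \<tau> = (\<Sum>l\<in>UNIV. w $ l * b l) + \<tau> * c" for w \<tau>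
  have "\<exists>y. (\<forall>i\<in>I. 0 \<le> y i) \<and> (\<forall>j\<in>J. d j = (\<Sum>i\<in>I. y i * a i j))"
  proof (rule farkas[OF finI finJ])
    fix x :: "'l + ('s \<times> nat) + unit \<Rightarrow> real"
    assume x: "\<forall>i\<in>I. 0 \<le> (\<Sum>j\<in>J. a i j * x j)"
    define w where "w = (\<chi> l. x (Inl l))"
    define \<mu> where "\<mu> s k = x (Inr (Inl (s, k)))" for s k
    define \<tau> where "\<tau> = x (Inr (Inr ()))"
    have \<tau>: "0 \<le> \<tau>" using x unfolding I_def sumJ by (simp add: a_def \<tau>_def)
    have "(\<Sum>j\<in>J. a (Some \<alpha>) j * x j) = - L \<alpha> (\<lambda>s. ?h s \<tau> w (\<mu> s))" for \<alpha>
    proof -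
      have "(\<Sum>l\<in>UNIV. (\<Sum>s\<in>UNIV. cone_inner (K s) (\<alpha> s) (A s l)) * x (Inl l))
          = (\<Sum>s\<in>UNIV. \<Sum>l\<in>UNIV. x (Inl l) * cone_inner (K s) (\<alpha> s) (A s l))"
        unfolding sum_distrib_right by (subst sum.swap) (simp add: mult.commute)
      then show ?thesis
        unfolding sumJ L_def cone_inner_commute[of _ "\<alpha> _" "?h _ _ _ _"] homogeneous_image_inner
        by (simp add: a_def w_def \<mu>_def \<tau>_def sum_negf sum.distrib sum_distrib_left mult.commute
            cone_inner_commute[of _ _ "\<alpha> _"])
    qed
    then have "L \<alpha> (\<lambda>s. ?h s \<tau> w (\<mu> s)) \<le> 0" if "(\<alpha>, \<beta>) \<in> H" for \<alpha> \<beta>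
      using x that unfolding I_def by force
    then have "\<forall>s. ?h s \<tau> w (\<mu> s) \<in> cone_set (K s)"
      using H[of "\<lambda>s. ?h s \<tau> w (\<mu> s)"] homogeneous_image_in_cone_space[OF data] rhs by fastforce
    then have mem: "?h s \<tau> w (\<mu> s) \<in> cone_set (K s)" for s by blast
    obtain w0 where "w0 \<in> conic_set K q A G e" using ne by blast
    then have "\<forall>s. \<exists>\<mu>. ?h s 1 w0 \<mu> \<in> cone_set (K s)"
      unfolding conic_set_def homogeneous_image_1 by blast
    then obtain \<mu>0 where mem0: "\<And>s. ?h s 1 w0 (\<mu>0 s) \<in> cone_set (K s)" by metis
    \<comment> \<open>The bound on the conic set says nothing directly at \<tau> = 0. Moving by
      \<open>t\<close> towards a feasible point makes the scale positive; afterwards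
      \<open>t\<close> tends to 0.\<close>
    have shifted: "val w \<tau> + t * val w0 1 \<le> 0" if t: "0 < t" for t
    proof -
      have "?h s (\<tau> + t * 1) (w + t *\<^sub>R w0) (\<lambda>i. \<mu> s i + t * \<mu>0 s i)
          = (\<lambda>i j. ?h s \<tau> w (\<mu> s) i j + t * ?h s 1 w0 (\<mu>0 s) i j)" for s
        unfolding homogeneous_image_add[abs_def] homogeneous_image_scale ..
      then have "?h s (\<tau> + t * 1) (w + t *\<^sub>R w0) (\<lambda>i. \<mu> s i + t * \<mu>0 s i) \<in> cone_set (K s)" for s
        using cone_set_add[OF mem cone_set_scale[OF mem0]] t by simp
      from homogenized_bound[OF bound this] have "val (w + t *\<^sub>R w0) (\<tau> + t * 1) \<le> 0"
        using \<tau> t unfolding val_def by simp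
      then show ?thesis
        unfolding val_def by (simp add: sum.distrib sum_distrib_left algebra_simps)
    qed
    have "val w \<tau> \<le> 0"
    proof (rule field_le_epsilon)
      fix r :: real assume r: "0 < r"
      define t where "t = r / (\<bar>val w0 1\<bar> + 1)"
      have "0 < t" "t * \<bar>val w0 1\<bar> \<le> r" using r by (auto simp: t_def field_simps)
      moreover have "t * - \<bar>val w0 1\<bar> \<le> t * val w0 1"
        using \<open>0 < t\<close> by (intro mult_left_mono) auto
      ultimately show "val w \<tau> \<le> 0 + r" using shifted[of t] by simp
    qed
    then show "0 \<le> (\<Sum>j\<in>J. d j * x j)"
      unfolding sumJ by (simp add: d_def val_def w_def \<tau>_def sum_negf mult.commute)
  qed
  then obtain y where y: "\<And>i. i \<in> I \<Longrightarrow> 0 \<le> y i" "\<And>j. j \<in> J \<Longrightarrow> d j = (\<Sum>i\<in>I. y i * a i j)"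
    by blast
  have y': "d j = y None * a None j + (\<Sum>\<alpha>\<in>fst ` H. y (Some \<alpha>) * a (Some \<alpha>) j)" if "j \<in> J" for j
    using y(2)[OF that] finH unfolding I_def by (simp add: sum.reindex)
  define \<zeta> where "\<zeta> s = (\<lambda>i j. \<Sum>\<alpha>\<in>fst ` H. - y (Some \<alpha>) * \<alpha> s i j)" for s
  have inner_\<zeta>: "cone_inner (K s) z (\<zeta> s) = - (\<Sum>\<alpha>\<in>fst ` H. y (Some \<alpha>) * cone_inner (K s) (\<alpha> s) z)" for s z
    unfolding \<zeta>_def cone_inner_sum cone_inner_scale by (simp add: sum_negf cone_inner_commute[of _ z])
  have sum_inner_\<zeta>: "(\<Sum>s\<in>UNIV. cone_inner (K s) (z s) (\<zeta> s))
      = - (\<Sum>\<alpha>\<in>fst ` H. y (Some \<alpha>) * L \<alpha> z)" for z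
    unfolding inner_\<zeta> sum_negf L_def sum_distrib_left by (subst sum.swap) simp
  show ?thesis
  proof (rule dual_certificateI[OF data, where \<zeta> = \<zeta>])
    show "0 \<le> (\<Sum>s\<in>UNIV. cone_inner (K s) (k s) (\<zeta> s))" if k: "\<And>s. k s \<in> cone_set (K s)" for k
    proof -
      have "(\<Sum>\<alpha>\<in>fst ` H. y (Some \<alpha>) * L \<alpha> k) \<le> 0"
        using y(1) neg[OF _ k] unfolding I_def by (intro sum_nonpos mult_nonneg_nonpos) auto
      then show ?thesis unfolding sum_inner_\<zeta> by simp
    qed
    show "(\<Sum>s\<in>UNIV. cone_inner (K s) (A s l) (\<zeta> s)) + b l = 0" for l
      using y'[of "Inl l"] unfolding sum_inner_\<zeta>
      by (simp add: J_def InlI a_def d_def L_def sum_negf)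
    show "cone_inner (K s) (G s k) (\<zeta> s) = 0" if "k < q s" for s k
      using y'[of "Inr (Inl (s, k))"] that unfolding inner_\<zeta>
      by (simp add: J_def InlI InrI a_def d_def sum_negf)
    \<comment> \<open>The multiplier of \<tau> \<ge> 0 is exactly the slack in the inequality for
      the constant term.\<close>
    have "0 \<le> y None" using y(1) by (simp add: I_def)
    then show "c + (\<Sum>s\<in>UNIV. cone_inner (K s) (e s) (\<zeta> s)) \<le> 0"
      using y'[of "Inr (Inr ())"] unfolding sum_inner_\<zeta>
      by (simp add: J_def InlI InrI a_def d_def L_def sum_negf)
  qed
qed

lemma conic_duality:
  assumes "conic_data K q A G e" "\<not> polyhedral_product K \<longrightarrow> slater K q A G e"
    and "conic_set K q A G e \<noteq> {}"
    and "\<And>w. w \<in> conic_set K q A G e \<Longrightarrow> (\<Sum>l\<in>UNIV. w $ l * b l) + c \<le> 0"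
  shows "\<exists>\<zeta>. dual_certificate K q A G e b c \<zeta>"
  using conic_duality_slater[OF assms(1) _ assms(4)] conic_duality_polyhedral[OF assms(1) _ assms(3,4)]
    assms(2) by blast

section \<open>Multipliers for the robust constraint\<close>

text \<open>Weak duality at a fixed point: pairing \<open>\<zeta>\<close> with the affine image of
  \<open>w\<close> is nonnegative, the unknown \<open>\<mu>\<close> disappears by \<open>G0\<close>,
  and \<open>Ab\<close> turns the terms in \<open>w\<close> into the negated input part of the Lie
  derivative.\<close>

lemma lie_negative_of_certificate:
  fixes f0 :: "('n::finite) tx \<Rightarrow> real ^ 'n" and f :: "'l::finite \<Rightarrow> 'n tx \<Rightarrow> real ^ 'n"
    and K :: "'s::finite \<Rightarrow> cone_kind"
  assumes z: "(t, x) \<in> semialg_set N g" and w: "w \<in> conic_set K q A G e"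
    and \<epsilon>: "\<epsilon> > 0" and mult: "\<And>s. multiplier (K s) (\<zeta> s)"
    and slack: "(\<lambda>_ _ z. - lie0 f0 v z - (\<Sum>s\<in>UNIV. pairing (K s) (e s) (\<zeta> s) z) - \<epsilon>) \<in> wsos_deg N g 1 D"
    and G0: "\<And>s k z. k < q s \<Longrightarrow> pairing (K s) (G s k) (\<zeta> s) z = 0"
    and Ab: "\<And>l z. (\<Sum>s\<in>UNIV. pairing (K s) (A s l) (\<zeta> s) z) + f l z \<bullet> grad_x v z = 0"
    and sos: "\<And>s. multiplier_sos N g D (K s) (\<zeta> s)"
  shows "lie f0 f v t x w < 0"
proof -
  let ?\<zeta> = "\<lambda>s i j. \<zeta> s i j (t, x)"
  have "psd 1 (\<lambda>_ _. - lie0 f0 v (t, x) - (\<Sum>s\<in>UNIV. pairing (K s) (e s) (\<zeta> s) (t, x)) - \<epsilon>)"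
    using wsos_psd[OF _ z] slack wsos_deg_subset by blast
  then have "0 \<le> (\<Sum>i<1::nat. \<Sum>j<1::nat. 1 *
      (- lie0 f0 v (t, x) - (\<Sum>s\<in>UNIV. pairing (K s) (e s) (\<zeta> s) (t, x)) - \<epsilon>) * 1)"
    unfolding psd_def by (elim conjE allE[of _ "\<lambda>_. 1"])
  then have bound: "lie0 f0 v (t, x) + (\<Sum>s\<in>UNIV. cone_inner (K s) (?\<zeta> s) (e s)) \<le> - \<epsilon>"
    by (simp add: pairing_def cone_inner_commute[of _ "e _"])
  have "0 \<le> (\<Sum>l\<in>UNIV. w $ l * cone_inner (K s) (?\<zeta> s) (A s l)) + cone_inner (K s) (?\<zeta> s) (e s)" for s
  proof -
    obtain \<mu> where "affine_image (q s) (A s) (G s) (e s) w \<mu> \<in> cone_set (K s)"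
      using w unfolding conic_set_def by blast
    then have "0 \<le> cone_inner (K s) (?\<zeta> s) (affine_image (q s) (A s) (G s) (e s) w \<mu>)"
      by (intro cone_inner_nonneg multiplier_sos_in_cone[OF mult sos z])
    moreover have "cone_inner (K s) (?\<zeta> s) (G s k) = 0" if "k < q s" for k
      using G0[OF that, of "(t, x)"] by (simp add: pairing_def cone_inner_commute)
    ultimately show ?thesis by (simp add: cone_inner_affine_image)
  qed
  then have "0 \<le> (\<Sum>s\<in>UNIV. (\<Sum>l\<in>UNIV. w $ l * cone_inner (K s) (?\<zeta> s) (A s l)) + cone_inner (K s) (?\<zeta> s) (e s))"
    by (intro sum_nonneg) blast
  also have "\<dots> = (\<Sum>l\<in>UNIV. w $ l * (\<Sum>s\<in>UNIV. cone_inner (K s) (?\<zeta> s) (A s l)))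
      + (\<Sum>s\<in>UNIV. cone_inner (K s) (?\<zeta> s) (e s))"
    by (simp add: sum.distrib sum_distrib_left) (rule sum.swap)
  also have "(\<Sum>l\<in>UNIV. w $ l * (\<Sum>s\<in>UNIV. cone_inner (K s) (?\<zeta> s) (A s l)))
      = - (\<Sum>l\<in>UNIV. w $ l * (f l (t, x) \<bullet> grad_x v (t, x)))"
  proof -
    have "(\<Sum>s\<in>UNIV. cone_inner (K s) (?\<zeta> s) (A s l)) = - (f l (t, x) \<bullet> grad_x v (t, x))" for l
      using Ab[of l "(t, x)"] by (simp add: pairing_def cone_inner_commute[of _ "A _ _"])
    then show ?thesis by (simp add: sum_negf)
  qed
  finally show ?thesis using bound \<epsilon> unfolding lie_def by linarith
qed

text \<open>All multipliers are combinations, with positive scalar polynomial coefficients, of finitely many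
  constant elements of \<open>K \<inter> ker G\<^sup>T\<close>. This way only scalar polynomials have to be certified,
  and no interior point of \<open>K \<inter> ker G\<^sup>T\<close> is needed. The elements \<open>\<gamma> l\<close> with
  \<open>A\<^sup>T (\<gamma> l)\<close> the unit vectors absorb the equality constraint.\<close>

lemma multipliers_exist:
  fixes K :: "'s::finite \<Rightarrow> cone_kind" and A :: "'s \<Rightarrow> 'l::finite \<Rightarrow> rmat"
    and Z :: "('a::euclidean_space) set"
  assumes data: "conic_data K q A G e" "\<not> polyhedral_product K \<longrightarrow> slater K q A G e"
    and W: "W = conic_set K q A G e" "compact W" "W \<noteq> {}"
    and Z: "compact Z" and c: "continuous_on Z c" and b: "\<And>l. real_polynomial_function (b l)"
    and neg: "\<And>z w. z \<in> Z \<Longrightarrow> w \<in> W \<Longrightarrow> c z + (\<Sum>l\<in>UNIV. w $ l * b l z) < 0"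
  shows "\<exists>(I :: (('s \<Rightarrow> rmat) + 'l) set) p h. finite I \<and>
    (\<forall>i\<in>I. real_polynomial_function (p i) \<and> (\<forall>z\<in>Z. 0 < p i z)) \<and>
    (\<forall>i\<in>I. \<forall>s. h i s \<in> cone_set (K s) \<and> (\<forall>k<q s. cone_inner (K s) (G s k) (h i s) = 0)) \<and>
    (\<forall>l z. (\<Sum>i\<in>I. p i z * (\<Sum>s\<in>UNIV. cone_inner (K s) (A s l) (h i s))) + b l z = 0) \<and>
    (\<forall>z\<in>Z. c z + (\<Sum>i\<in>I. p i z * (\<Sum>s\<in>UNIV. cone_inner (K s) (e s) (h i s))) < 0)"
proof -
  define P where "P = {\<zeta>. \<forall>s. \<zeta> s \<in> cone_set (K s) \<and> (\<forall>k<q s. cone_inner (K s) (G s k) (\<zeta> s) = 0)}"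
  define a where "a l \<zeta> = (\<Sum>s\<in>UNIV. cone_inner (K s) (A s l) (\<zeta> s))" for l \<zeta>
  define r where "r \<zeta> = (\<Sum>s\<in>UNIV. cone_inner (K s) (e s) (\<zeta> s))" for \<zeta>
  have dual: "\<exists>\<zeta>\<in>P. (\<forall>l. a l \<zeta> = - \<beta> l) \<and> r \<zeta> \<le> m" if "\<And>w. w \<in> W \<Longrightarrow> (\<Sum>l\<in>UNIV. w $ l * \<beta> l) \<le> m" for \<beta> m
  proof -
    have "\<exists>\<zeta>. dual_certificate K q A G e \<beta> (- m) \<zeta>"
      by (rule conic_duality[OF data]) (use W that in auto)
    then obtain \<zeta> where \<zeta>: "dual_certificate K q A G e \<beta> (- m) \<zeta>" by blast
    then have "\<zeta> \<in> P" "\<forall>l. a l \<zeta> + \<beta> l = 0" "- m + r \<zeta> \<le> 0"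
      unfolding dual_certificate_def P_def a_def r_def by auto
    then show ?thesis by (intro bexI[of _ \<zeta>]) (auto simp: eq_neg_iff_add_eq_0)
  qed
  obtain M where M: "\<And>w. w \<in> W \<Longrightarrow> norm w \<le> M"
    using compact_imp_bounded[OF W(2)] unfolding bounded_iff by blast
  have unit: "\<exists>\<zeta>\<in>P. \<forall>k. a k \<zeta> = (if k = l then \<sigma> else 0)" if \<sigma>: "\<bar>\<sigma>\<bar> = 1" for l \<sigma>
  proof -
    have "(\<Sum>k\<in>UNIV. w $ k * - (if k = l then \<sigma> else 0)) \<le> M" if "w \<in> W" for w
    proof -
      have "(\<Sum>k\<in>UNIV. w $ k * - (if k = l then \<sigma> else 0)) = (\<Sum>k\<in>UNIV. if k = l then - (w $ l * \<sigma>) else 0)"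
        by (rule sum.cong) auto
      also have "\<dots> = - (w $ l * \<sigma>)" by simp
      also have "\<dots> \<le> \<bar>w $ l * \<sigma>\<bar>" by simp
      also have "\<dots> \<le> norm w" using \<sigma> component_le_norm_cart[of w l] by (simp add: abs_mult)
      finally show ?thesis using M[OF that] by simp
    qed
    from dual[OF this] show ?thesis by (simp only: minus_minus) blast
  qed
  have "\<forall>l. \<exists>\<zeta>. \<zeta> \<in> P \<and> (\<forall>k. a k \<zeta> = (if k = l then 1 else 0))" using unit[OF abs_one] by blast
  from choice[OF this] obtain \<gamma> where \<gamma>: "\<And>l. \<gamma> l \<in> P" "\<And>l k. a k (\<gamma> l) = (if k = l then 1 else 0)" by blast
  \<comment> \<open>The \<open>\<gamma>' l\<close> create the overshoot in the equalities and the
    \<open>\<gamma> l\<close> remove it again.\<close>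
  have "\<forall>l. \<exists>\<zeta>. \<zeta> \<in> P \<and> (\<forall>k. a k \<zeta> = (if k = l then - 1 else 0))" using unit[of "- 1"] abs_neg_one by blast
  from choice[OF this] obtain \<gamma>' where \<gamma>': "\<And>l. \<gamma>' l \<in> P" "\<And>l k. a k (\<gamma>' l) = (if k = l then - 1 else 0)" by blast
  \<comment> \<open>The inequality for \<open>Some l\<close> asks for a positive residual of the
    \<open>l\<close>-th equality; the one for \<open>None\<close> asks for a negative constant term
    after the residuals have been passed on to the \<open>\<gamma> l\<close>.\<close>
  define u where "u j z = (case j of Some l \<Rightarrow> - b l z | None \<Rightarrow> - c z + (\<Sum>l\<in>UNIV. b l z * r (\<gamma> l)))" for j z
  define v where "v j h = (case j of Some l \<Rightarrow> - a l h | None \<Rightarrow> - r h + (\<Sum>l\<in>UNIV. a l h * r (\<gamma> l)))" for j h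
  have cont_b: "continuous_on Z (b l)" for l
    using b continuous_on_polymonial_function by (auto simp: real_polynomial_function_eq)
  have feasible: "\<exists>h\<in>P. \<forall>j\<in>UNIV. 0 < u j z + v j h" if z: "z \<in> Z" for z
  proof -
    have "continuous_on W (\<lambda>w. \<Sum>l\<in>UNIV. w $ l * b l z)" by (intro continuous_intros)
    \<comment> \<open>As the maximum over \<open>W\<close> is attained, the strict inequality at
      \<open>w1\<close> gives a positive gap at this \<open>z\<close>.\<close>
    from continuous_attains_sup[OF W(2,3) this] obtain w1 where w1: "w1 \<in> W"
      "\<And>w. w \<in> W \<Longrightarrow> (\<Sum>l\<in>UNIV. w $ l * b l z) \<le> (\<Sum>l\<in>UNIV. w1 $ l * b l z)" by blast
    obtain \<zeta> where \<zeta>: "\<zeta> \<in> P" "\<And>l. a l \<zeta> = - b l z" "r \<zeta> \<le> (\<Sum>l\<in>UNIV. w1 $ l * b l z)"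
      using dual[OF w1(2)] by blast
    define gap where "gap = - (c z + r \<zeta>)"
    have gap: "0 < gap" using \<zeta>(3) neg[OF z w1(1)] by (simp add: gap_def)
    \<comment> \<open>\<open>r (\<gamma>' l)\<close> is the price of overshooting in component
      \<open>l\<close>, \<open>r (\<gamma> l)\<close> that of correcting it; \<open>\<delta>\<close>
      keeps the total price below the gap.\<close>
    define S where "S = (\<Sum>l\<in>UNIV. r (\<gamma>' l) + r (\<gamma> l))"
    define \<delta> where "\<delta> = gap / (\<bar>S\<bar> + 1)"
    have \<delta>: "0 < \<delta>" using gap by (simp add: \<delta>_def)
    have "\<delta> * S \<le> \<delta> * \<bar>S\<bar>" using \<delta> by (intro mult_left_mono) auto
    also have "\<dots> < gap" using gap by (simp add: \<delta>_def field_simps)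
    finally have \<delta>S: "\<delta> * S < gap" .
    define h where "h = (\<lambda>s i j. \<zeta> s i j + \<delta> * (\<Sum>l\<in>UNIV. \<gamma>' l s i j))"
    have inner_h: "cone_inner (K s) y (h s) = cone_inner (K s) y (\<zeta> s) + \<delta> * (\<Sum>l\<in>UNIV. cone_inner (K s) y (\<gamma>' l s))" for y s
      unfolding h_def by (simp add: cone_inner_add cone_inner_scale cone_inner_sum)
    have "h s \<in> cone_set (K s)" for s
      unfolding h_def using \<zeta>(1) \<gamma>'(1) \<delta> unfolding P_def
      by (intro cone_set_add cone_set_scale cone_set_sum) auto
    then have hP: "h \<in> P" using \<zeta>(1) \<gamma>'(1) unfolding P_def by (simp add: inner_h)
    have "a l h = a l \<zeta> + \<delta> * (\<Sum>k\<in>UNIV. a l (\<gamma>' k))" for l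
      unfolding a_def inner_h sum.distrib sum_distrib_left[symmetric] by (subst sum.swap) simp
    then have ah: "a l h = - b l z - \<delta>" for l by (simp add: \<zeta>(2) \<gamma>'(2))
    have rh: "r h = r \<zeta> + \<delta> * (\<Sum>l\<in>UNIV. r (\<gamma>' l))"
      unfolding r_def inner_h sum.distrib sum_distrib_left[symmetric] by (subst sum.swap) simp
    have "u None z + v None h = gap - \<delta> * S"
      by (simp add: u_def v_def ah rh gap_def S_def left_diff_distrib sum_subtractf sum_negf sum.distrib
          sum_distrib_left distrib_left)
    moreover have "u (Some l) z + v (Some l) h = \<delta>" for l by (simp add: u_def v_def ah)
    ultimately have "0 < u j z + v j h" for j using \<delta> \<delta>S by (cases j) simp_all
    then show ?thesis using hP by blast
  qed
  have u_cont: "continuous_on Z (u j)" for j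
    unfolding u_def[abs_def] using c cont_b by (cases j) (auto intro!: continuous_intros)
  have "\<exists>F p. finite F \<and> F \<subseteq> P \<and> (\<forall>h\<in>F. real_polynomial_function (p h) \<and> (\<forall>z\<in>Z. 0 < p h z)) \<and>
      (\<forall>z\<in>Z. \<forall>j\<in>UNIV. 0 < u j z + (\<Sum>h\<in>F. p h z * v j h))"
    by (rule polynomial_selection[OF Z finite u_cont feasible])
  then obtain F p where sel: "finite F" "F \<subseteq> P"
      "\<forall>h\<in>F. real_polynomial_function (p h) \<and> (\<forall>z\<in>Z. 0 < p h z)"
      "\<forall>z\<in>Z. \<forall>j\<in>UNIV. 0 < u j z + (\<Sum>h\<in>F. p h z * v j h)"
    by (elim exE conjE)
  have F: "finite F" "F \<subseteq> P"
      "\<And>h. h \<in> F \<Longrightarrow> real_polynomial_function (p h)" "\<And>h z. h \<in> F \<Longrightarrow> z \<in> Z \<Longrightarrow> 0 < p h z"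
      "\<And>j z. z \<in> Z \<Longrightarrow> 0 < u j z + (\<Sum>h\<in>F. p h z * v j h)"
    using sel by blast+
  define \<kappa> where "\<kappa> l z = - b l z - (\<Sum>h\<in>F. p h z * a l h)" for l z
  have \<kappa>_pos: "0 < \<kappa> l z" if "z \<in> Z" for l z
    using F(5)[OF that, of "Some l"] by (simp add: u_def v_def \<kappa>_def sum_negf)
  have \<kappa>_poly: "real_polynomial_function (\<kappa> l)" for l
    unfolding \<kappa>_def[abs_def] by (intro polynomial_intros b F(1,3))
  \<comment> \<open>A disjoint sum, because some \<open>\<gamma> l\<close> may already occur in
    \<open>F\<close> or coincide with another one.\<close>
  define I where "I = F <+> (UNIV :: 'l set)"
  define p' where "p' = case_sum p \<kappa>"
  define h' where "h' = case_sum (\<lambda>h. h) \<gamma>"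
  have sumI: "(\<Sum>i\<in>I. p' i z * \<phi> (h' i)) = (\<Sum>h\<in>F. p h z * \<phi> h) + (\<Sum>l\<in>UNIV. \<kappa> l z * \<phi> (\<gamma> l))" for \<phi> z
    unfolding I_def p'_def h'_def using F(1) by (simp add: sum.Plus comp_def)
  have "(\<Sum>i\<in>I. p' i z * a l (h' i)) + b l z = 0" for l z
    unfolding sumI by (simp add: \<gamma>(2) if_distrib[of "\<lambda>x. _ * x"] cong: if_cong) (simp add: \<kappa>_def)
  moreover have "c z + (\<Sum>i\<in>I. p' i z * r (h' i)) < 0" if "z \<in> Z" for z
  proof -
    have "(\<Sum>l\<in>UNIV. \<kappa> l z * r (\<gamma> l))
        = - (\<Sum>l\<in>UNIV. b l z * r (\<gamma> l)) - (\<Sum>h\<in>F. p h z * (\<Sum>l\<in>UNIV. a l h * r (\<gamma> l)))"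
    proof -
      have "(\<Sum>l\<in>UNIV. (\<Sum>h\<in>F. p h z * a l h) * r (\<gamma> l)) = (\<Sum>h\<in>F. p h z * (\<Sum>l\<in>UNIV. a l h * r (\<gamma> l)))"
        unfolding sum_distrib_right sum_distrib_left by (subst sum.swap) (simp add: mult.assoc)
      then show ?thesis
        by (simp add: \<kappa>_def left_diff_distrib sum_subtractf sum_negf)
    qed
    then have "c z + (\<Sum>i\<in>I. p' i z * r (h' i)) = - (u None z + (\<Sum>h\<in>F. p h z * v None h))"
      unfolding sumI by (simp add: u_def v_def right_diff_distrib sum_subtractf)
    then show ?thesis using F(5)[OF that, of None] by simp
  qed
  moreover have "finite I" unfolding I_def using F(1) by simp
  moreover have "\<forall>i\<in>I. real_polynomial_function (p' i) \<and> (\<forall>z\<in>Z. 0 < p' i z)"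
    unfolding I_def p'_def using F(3,4) \<kappa>_pos \<kappa>_poly by auto
  moreover have "\<forall>i\<in>I. h' i \<in> P"
    unfolding I_def h'_def using F(2) \<gamma>(1) by auto
  ultimately show ?thesis
    unfolding P_def a_def r_def
    by (intro exI[of _ I] exI[of _ p'] exI[of _ h']) simp
qed

theorem theorem4p4:
  fixes T :: real
    and X X0 :: "(real ^ 'n::finite) set"
    and f0 :: "'n tx \<Rightarrow> real ^ 'n"
    and f :: "'l::finite \<Rightarrow> 'n tx \<Rightarrow> real ^ 'n"
    and W :: "(real ^ 'l) set"
    and K :: "'s::finite \<Rightarrow> cone_kind"
    and q :: "'s \<Rightarrow> nat"
    and A :: "'s \<Rightarrow> 'l \<Rightarrow> rmat"
    and G :: "'s \<Rightarrow> nat \<Rightarrow> rmat"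
    and e :: "'s \<Rightarrow> rmat"
    and N :: "'c::finite \<Rightarrow> nat"
    and g :: "'c \<Rightarrow> 'n pmat"
    and v :: "'n pol"
  assumes A1: "0 < T"
    and A2: "compact X" "compact X0" "X0 \<subseteq> X"
    and A3: "\<exists>M. M-lipschitz_on ({0..T} \<times> X) f0"
      "\<forall>l. \<exists>M. M-lipschitz_on ({0..T} \<times> X) (f l)"
    and A4: "conic_data K q A G e"
      "W = conic_set K q A G e"
      "compact W" "interior W \<noteq> {}"
      "\<not> polyhedral_product K \<longrightarrow> slater K q A G e"
    and A5: "non_return (dynamics f0 f) T X X0 W"
    and A6: "polynomial_function f0" "\<forall>l. polynomial_function (f l)"
      "\<forall>i. symmetric_pmat (N i) (g i)"
      "semialg_set N g = {0..T} \<times> X"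
      "archimedean N g"
    and v: "real_polynomial_function v"
  shows "(\<forall>t\<in>{0..T}. \<forall>x\<in>X. \<forall>w\<in>W. lie f0 f v t x w < 0) \<longleftrightarrow>
    (\<exists>(d::nat) (\<epsilon>::real) (\<zeta> :: 's \<Rightarrow> 'n pmat).
       \<epsilon> > 0 \<and> (\<forall>s. multiplier (K s) (\<zeta> s)) \<and>
       (\<lambda>_ _ z. - lie0 f0 v z - (\<Sum>s\<in>UNIV. pairing (K s) (e s) (\<zeta> s) z) - \<epsilon>)
         \<in> wsos_deg N g 1 (2 * d) \<and>
       (\<forall>s. \<forall>k<q s. \<forall>z. pairing (K s) (G s k) (\<zeta> s) z = 0) \<and>
       (\<forall>l. \<forall>z. (\<Sum>s\<in>UNIV. pairing (K s) (A s l) (\<zeta> s) z) + f l z \<bullet> grad_x v z = 0) \<and>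
       (\<forall>s. multiplier_sos N g (2 * d) (K s) (\<zeta> s)))"
proof
  let ?Z = "{0..T} \<times> X"
  assume neg: "\<forall>t\<in>{0..T}. \<forall>x\<in>X. \<forall>w\<in>W. lie f0 f v t x w < 0"
  define b where "b l z = f l z \<bullet> grad_x v z" for l z
  have b_poly: "real_polynomial_function (b l)" for l
    unfolding b_def[abs_def] using v A6(2) by (intro real_polynomial_function_inner_grad_x) auto
  have lie0_poly: "real_polynomial_function (lie0 f0 v)"
    using v A6(1) by (rule real_polynomial_function_lie0)
  have Z: "compact ?Z" using A2(1) by (intro compact_Times) auto
  have cont: "continuous_on ?Z p" if "real_polynomial_function p" for p
    using that continuous_on_polymonial_function by (auto simp: real_polynomial_function_eq)
  have W: "W \<noteq> {}" using A4(4) interior_subset by fastforce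
  have negb: "lie0 f0 v z + (\<Sum>l\<in>UNIV. w $ l * b l z) < 0" if "z \<in> ?Z" "w \<in> W" for z w
    using neg that by (auto simp: lie_def b_def)
  have "\<exists>(I :: (('s \<Rightarrow> rmat) + 'l) set) p h. finite I \<and>
    (\<forall>i\<in>I. real_polynomial_function (p i) \<and> (\<forall>z\<in>?Z. 0 < p i z)) \<and>
    (\<forall>i\<in>I. \<forall>s. h i s \<in> cone_set (K s) \<and> (\<forall>k<q s. cone_inner (K s) (G s k) (h i s) = 0)) \<and>
    (\<forall>l z. (\<Sum>i\<in>I. p i z * (\<Sum>s\<in>UNIV. cone_inner (K s) (A s l) (h i s))) + b l z = 0) \<and>
    (\<forall>z\<in>?Z. lie0 f0 v z + (\<Sum>i\<in>I. p i z * (\<Sum>s\<in>UNIV. cone_inner (K s) (e s) (h i s))) < 0)"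
    by (rule multipliers_exist[OF A4(1,5,2,3) W Z cont[OF lie0_poly] b_poly negb])
  then obtain I :: "(('s \<Rightarrow> rmat) + 'l) set" and p h where I: "finite I"
    "\<forall>i\<in>I. real_polynomial_function (p i) \<and> (\<forall>z\<in>?Z. 0 < p i z)"
    "\<forall>i\<in>I. \<forall>s. h i s \<in> cone_set (K s) \<and> (\<forall>k<q s. cone_inner (K s) (G s k) (h i s) = 0)"
    "\<forall>l z. (\<Sum>i\<in>I. p i z * (\<Sum>s\<in>UNIV. cone_inner (K s) (A s l) (h i s))) + b l z = 0"
    "\<forall>z\<in>?Z. lie0 f0 v z + (\<Sum>i\<in>I. p i z * (\<Sum>s\<in>UNIV. cone_inner (K s) (e s) (h i s))) < 0"
    by (elim exE conjE)
  have g: "symmetric_pmat (N i) (g i)" for i using A6(3) by blast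
  have size: "positive_size (K s)" for s using A4(1) unfolding conic_data_def by blast
  define \<zeta> where "\<zeta> s = (\<lambda>i j z. \<Sum>x\<in>I. p x z * h x s i j)" for s
  have pairing_\<zeta>: "pairing (K s) y (\<zeta> s) z = (\<Sum>x\<in>I. p x z * cone_inner (K s) y (h x s))" for s y z
    unfolding pairing_def \<zeta>_def by (simp add: cone_inner_sum cone_inner_scale)
  have sum_pairing: "(\<Sum>s\<in>UNIV. pairing (K s) (y s) (\<zeta> s) z)
      = (\<Sum>x\<in>I. p x z * (\<Sum>s\<in>UNIV. cone_inner (K s) (y s) (h x s)))" for y z
    unfolding pairing_\<zeta> sum_distrib_left by (rule sum.swap)
  have mult: "multiplier (K s) (\<zeta> s)" for s
    unfolding multiplier_def \<zeta>_def
    using I(2,3) by (intro conjI allI cone_space_sum cone_space_scale cone_set_subset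
        real_polynomial_function_sum I(1) real_polynomial_function.intros(2,4)) auto
  define slack where "slack z = - lie0 f0 v z - (\<Sum>s\<in>UNIV. pairing (K s) (e s) (\<zeta> s) z)" for z
  have slack_poly: "real_polynomial_function slack"
    unfolding slack_def sum_pairing using lie0_poly I(1,2)
    by (intro real_polynomial_function_diff real_polynomial_function_minus
        real_polynomial_function_sum real_polynomial_function.intros(2,4)) auto
  have "0 < slack z" if "z \<in> ?Z" for z
    using I(5)[rule_format, OF that] unfolding slack_def sum_pairing by linarith
  then obtain m where m: "0 < m" "\<And>z. z \<in> ?Z \<Longrightarrow> m \<le> slack z"
    using compact_positive_lower_bound[OF Z cont[OF slack_poly]] by blast
  \<comment> \<open>Half of the minimum, so that the slack minus \<open>\<epsilon>\<close> is still
    strictly positive, as Putinar's theorem requires.\<close>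
  define \<epsilon> where "\<epsilon> = m / 2"
  have \<epsilon>: "0 < \<epsilon>" using m(1) by (simp add: \<epsilon>_def)
  have "(\<lambda>_ _ z. slack z - \<epsilon>) \<in> wsos N g 1"
  proof (rule putinar_wsos[OF g A6(5)])
    show "real_polynomial_function (\<lambda>z. slack z - \<epsilon>)"
      by (intro real_polynomial_function_diff slack_poly real_polynomial_function.intros(2))
    fix z assume "z \<in> semialg_set N g"
    then show "0 < slack z - \<epsilon>" using m(1) m(2)[of z] A6(4) by (simp add: \<epsilon>_def)
  qed
  then obtain D0 where D0: "(\<lambda>_ _ z. slack z - \<epsilon>) \<in> wsos_deg N g 1 D0"
    using wsos_imp_wsos_deg[of N g, OF g] by blast
  have "\<exists>D. (\<lambda>_ _. p x) \<in> wsos_deg N g 1 D" if "x \<in> I" for x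
    using putinar_wsos[of N g "p x", OF g A6(5)] I(2) that A6(4)
      wsos_imp_wsos_deg[of N g "\<lambda>_ _. p x" 1, OF g] by auto
  then obtain D where D: "\<And>x. x \<in> I \<Longrightarrow> (\<lambda>_ _. p x) \<in> wsos_deg N g 1 (D x)" by metis
  \<comment> \<open>A sum instead of a maximum: it dominates \<open>D0\<close> and every
    \<open>D x\<close>, and so does its double.\<close>
  define d where "d = D0 + (\<Sum>x\<in>I. D x)"
  have "D x \<le> 2 * d" if "x \<in> I" for x
    using member_le_sum[OF that, of D] I(1) by (simp add: d_def)
  then have p_sos: "(\<lambda>_ _. p x) \<in> wsos_deg N g 1 (2 * d)" if "x \<in> I" for x
    using D[OF that] wsos_deg_mono that by blast
  have "multiplier_sos N g (2 * d) (K s) (\<zeta> s)" for s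
    unfolding \<zeta>_def
    by (intro multiplier_sos_sum multiplier_sos_constant p_sos size) (use I(2,3) in auto)
  moreover have "(\<lambda>_ _ z. - lie0 f0 v z - (\<Sum>s\<in>UNIV. pairing (K s) (e s) (\<zeta> s) z) - \<epsilon>)
      \<in> wsos_deg N g 1 (2 * d)"
    using D0 wsos_deg_mono[of D0 "2 * d" N g 1] unfolding slack_def d_def by auto
  moreover have "pairing (K s) (G s k) (\<zeta> s) z = 0" if "k < q s" for s k z
    unfolding pairing_\<zeta> using I(3) that by simp
  moreover have "(\<Sum>s\<in>UNIV. pairing (K s) (A s l) (\<zeta> s) z) + f l z \<bullet> grad_x v z = 0" for l z
    using I(4) unfolding sum_pairing b_def by blast
  ultimately show "\<exists>d \<epsilon> (\<zeta> :: 's \<Rightarrow> 'n pmat). \<epsilon> > 0 \<and> (\<forall>s. multiplier (K s) (\<zeta> s)) \<and>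
       (\<lambda>_ _ z. - lie0 f0 v z - (\<Sum>s\<in>UNIV. pairing (K s) (e s) (\<zeta> s) z) - \<epsilon>)
         \<in> wsos_deg N g 1 (2 * d) \<and>
       (\<forall>s. \<forall>k<q s. \<forall>z. pairing (K s) (G s k) (\<zeta> s) z = 0) \<and>
       (\<forall>l. \<forall>z. (\<Sum>s\<in>UNIV. pairing (K s) (A s l) (\<zeta> s) z) + f l z \<bullet> grad_x v z = 0) \<and>
       (\<forall>s. multiplier_sos N g (2 * d) (K s) (\<zeta> s))"
    using \<epsilon> mult by (intro exI[of _ d] exI[of _ \<epsilon>] exI[of _ \<zeta>] conjI allI impI) auto
next
  assume "\<exists>d \<epsilon> (\<zeta> :: 's \<Rightarrow> 'n pmat). \<epsilon> > 0 \<and> (\<forall>s. multiplier (K s) (\<zeta> s)) \<and>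
       (\<lambda>_ _ z. - lie0 f0 v z - (\<Sum>s\<in>UNIV. pairing (K s) (e s) (\<zeta> s) z) - \<epsilon>)
         \<in> wsos_deg N g 1 (2 * d) \<and>
       (\<forall>s. \<forall>k<q s. \<forall>z. pairing (K s) (G s k) (\<zeta> s) z = 0) \<and>
       (\<forall>l. \<forall>z. (\<Sum>s\<in>UNIV. pairing (K s) (A s l) (\<zeta> s) z) + f l z \<bullet> grad_x v z = 0) \<and>
       (\<forall>s. multiplier_sos N g (2 * d) (K s) (\<zeta> s))"
  then obtain d \<epsilon> and \<zeta> :: "'s \<Rightarrow> 'n pmat" where cert: "\<epsilon> > 0" "\<forall>s. multiplier (K s) (\<zeta> s)"
    "(\<lambda>_ _ z. - lie0 f0 v z - (\<Sum>s\<in>UNIV. pairing (K s) (e s) (\<zeta> s) z) - \<epsilon>) \<in> wsos_deg N g 1 (2 * d)"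
    "\<forall>s. \<forall>k<q s. \<forall>z. pairing (K s) (G s k) (\<zeta> s) z = 0"
    "\<forall>l. \<forall>z. (\<Sum>s\<in>UNIV. pairing (K s) (A s l) (\<zeta> s) z) + f l z \<bullet> grad_x v z = 0"
    "\<forall>s. multiplier_sos N g (2 * d) (K s) (\<zeta> s)"
    by (elim exE conjE)
  show "\<forall>t\<in>{0..T}. \<forall>x\<in>X. \<forall>w\<in>W. lie f0 f v t x w < 0"
  proof (intro ballI)
    fix t x w assume "t \<in> {0..T}" "x \<in> X" "w \<in> W"
    then have "(t, x) \<in> semialg_set N g" "w \<in> conic_set K q A G e" using A6(4) A4(2) by auto
    then show "lie f0 f v t x w < 0"
      by (rule lie_negative_of_certificate[where \<zeta> = \<zeta>]) (use cert in auto)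
  qed
qed

end
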